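(* In the setting described in the context with $(r,s)=(3,1)$, let $\Lambda=(\lambda_1,\lambda_2,\lambda_3,-\mu_1)$ be a polarization for $(W,G)$ and $\tilde\Lambda=(\alpha_1,\alpha_2,\alpha_3,-\mu_1)$ the associated polarization for $(\mathbf{W},\mathbf{G})$ (so $\mu_1=\frac1{n_1}$), and assume that all $\alpha_i>0$. Let $Z=\mathbf{G}\,\zeta(W)$ with closure $\overline{Z}$ in $\mathbf{W}$. If (1) $\alpha_2c_3+\lambda_1c_3'\ge\mu_1c_3c_3'$, (2) $\lambda_2\ge a_{21}\mu_1c_1$, (3) $\lambda_3\ge a_{31}\mu_1c_1$, then $\overline{Z}\smallsetminus Z$ contains no semi-stable point, i.e. $(\overline{Z}\smallsetminus Z)\cap\mathbf{W}^{ss}(\mathbf{G},\tilde\Lambda)=\emptyset$. Moreover, condition (1) may be replaced by any one of the conditions (i) $\lambda_3\ge\mu_1c_3'a_{32}+a_{31}\lambda_1$, (ii) $\lambda_3\ge\mu_1c_3a_{31}+a_{32}\alpha_2$, (iii) $\lambda_3\ge\mu_1c_3a_{32}a_{21}$.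
   Context: Setting (type $(3,1)$). Over $\mathbb{C}$, let $A_{ji}$ ($1\le i\le j\le3$) and $H_{1i}$ ($1\le i\le3$) be finite dimensional vector spaces, $A_{ii}=\mathbb{C}$, with linear composition maps $H_{1j}\otimes A_{ji}\to H_{1i}$ and $A_{kj}\otimes A_{ji}\to A_{ki}$ (for $i\le j\le k$), identities when a factor is $A_{ii}$, and associative in all possible combinations. These maps and the induced maps $H_{1i}^*\otimes A_{ji}\to H_{1j}^*$ are assumed surjective. Let $M_1,M_2,M_3,N_1$ be finite dimensional vector spaces; $a_{ji}=\dim A_{ji}$, $m_i=\dim M_i$, $n_1=\dim N_1$. $W=\bigoplus_i\mathrm{Hom}(M_i,N_1\otimes H_{1i})$, with elements $w=(\phi_{1i})$. ($G=G_L\times GL(N_1)$ where $G_L$ consists of lower triangular matrices with diagonal entries in $GL(M_i)$ and entries $u_{ji}\in\mathrm{Hom}(M_i,M_j\otimes A_{ji})$, $i<j$; it acts by $(g,h).w=hwg^{-1}$.) $P_i=\bigoplus_{j\ge i}M_j\otimes A_{ji}$, so $P_3=M_3$, $P_2=M_2\oplus M_3\otimes A_{32}$, $P_1=M_1\oplus M_2\otimes A_{21}\oplus M_3\otimes A_{31}$; $\xi_i:P_i\otimes A_{i,i-1}\to P_{i-1}$ ($i=2,3$) is induced by the compositions. $\mathbf{W}=\mathrm{Hom}(P_2\otimes A_{21},P_1)\oplus\mathrm{Hom}(P_3\otimes A_{32},P_2)\oplus\mathrm{Hom}(P_1\otimes H_{11}^*,N_1)$ with the natural action of $\mathbf{G}=\prod_iGL(P_i)\times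 GL(N_1)$: $(x_2,x_3,\psi)\mapsto(g_1x_2(g_2\otimes\mathrm{id})^{-1},g_2x_3(g_3\otimes\mathrm{id})^{-1},h\psi(g_1\otimes\mathrm{id})^{-1})$. For $w=(\phi_{1i})$, $\gamma(w)\in\mathrm{Hom}(P_1,N_1\otimes H_{11})$ has components $M_i\otimes A_{i1}\to N_1\otimes H_{1i}\otimes A_{i1}\to N_1\otimes H_{11}$, and $\zeta(w)=(\xi_2,\xi_3,\gamma(w))$. Polarizations. $\Lambda=(\lambda_1,\lambda_2,\lambda_3,-\mu_1)$ has rational entries with $\sum\lambda_im_i=\mu_1n_1=1$. The $\alpha_i$ are determined by $\lambda_1=\alpha_1$, $\lambda_2=a_{21}\alpha_1+\alpha_2$, $\lambda_3=a_{31}\alpha_1+a_{32}\alpha_2+\alpha_3$. Semi-stability. $(x_2,x_3,\psi)\in\mathbf{W}$ lies in $\mathbf{W}^{ss}(\mathbf{G},\tilde\Lambda)$ if $\sum\alpha_i\dim P_i'-\mu_1\dim Q_1'\le0$ for all families of subspaces $P_i'\subset P_i$, $Q_1'\subset N_1$, not all zero and not all full, with $x_i(P_i'\otimes A_{i,i-1})\subset P_{i-1}'$ and $\psi(P_1'\otimes H_{11}^* )\subset Q_1'$. Constants. $c_1=c_1(m_2,m_3)=\sup_K\mathrm{codim}(\delta_1(K\otimes H_{11}^* ))/\mathrm{codim}(K)$, where $\delta_1:(M_2\otimes A_{21}\oplus M_3\otimes A_{31})\otimes H_{11}^*\to M_2\otimes H_{12}^*\oplus M_3\otimes H_{13}^*$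 is induced by the maps $A_{i1}\otimes H_{11}^*\to H_{1i}^*$ and $K$ runs over proper subspaces of $M_2\otimes A_{21}\oplus M_3\otimes A_{31}$ not contained in $M_2'\otimes A_{21}\oplus M_3'\otimes A_{31}$ for any subspaces with $(M_2',M_3')\ne(M_2,M_3)$. $c_3=c_1(0,m_3)$ is the same constant with $M_2$ replaced by $0$. $c_3'=\sup_K\mathrm{codim}(\tau(K\otimes H_{12}^* ))/\mathrm{codim}(K)$, where $\tau:M_3\otimes A_{32}\otimes H_{12}^*\to M_3\otimes H_{13}^*$ is induced by the pairing and $K$ runs over proper subspaces of $M_3\otimes A_{32}$ not contained in $M_3'\otimes A_{32}$ for any proper subspace $M_3'\subset M_3$. (Supremum of the empty set is $0$.) *)

theory Defs
  imports Complex_Main "HOL-Library.Function_Algebras"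
begin

section \<open>Finite dimensional complex vector spaces in coordinates\<close>

text \<open>
  Every finite dimensional vector space is given with a basis, indexed by a finite set I
  (which may be empty), and is represented by the functions vanishing outside I.
  Tensor products and direct sums have the products and the disjoint sums of the index sets
  as index sets; a dual space carries the dual basis, with the same index set.
\<close>

abbreviation (input) cscale :: "complex \<Rightarrow> ('i \<Rightarrow> complex) \<Rightarrow> 'i \<Rightarrow> complex" where
  "cscale c v \<equiv> (\<lambda>i. c * v i)"

interpretation cvec: vector_space "cscale :: complex \<Rightarrow> ('i \<Rightarrow> complex) \<Rightarrow> 'i \<Rightarrow> complex"
  by unfold_locales (simp_all add: fun_eq_iff algebra_simps)

definition cspace :: "'i set \<Rightarrow> ('i \<Rightarrow> complex) set" where
  "cspace I = {v. \<forall>i. i \<notin> I \<longrightarrow> v i = 0}"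

definition subspace_of :: "('i \<Rightarrow> complex) set \<Rightarrow> ('i \<Rightarrow> complex) set \<Rightarrow> bool" where
  "subspace_of U V \<longleftrightarrow> cvec.subspace U \<and> U \<subseteq> V"

definition codim :: "('i \<Rightarrow> complex) set \<Rightarrow> ('i \<Rightarrow> complex) set \<Rightarrow> real" where
  "codim V U = real (cvec.dim V) - real (cvec.dim U)"

definition tensor :: "('i \<Rightarrow> complex) \<Rightarrow> ('j \<Rightarrow> complex) \<Rightarrow> 'i \<times> 'j \<Rightarrow> complex" where
  "tensor u v = (\<lambda>(i, j). u i * v j)"

text \<open>For subspaces U and V, the image of their tensor product in the ambient tensor product.\<close>

definition tensor_space ::
    "('i \<Rightarrow> complex) set \<Rightarrow> ('j \<Rightarrow> complex) set \<Rightarrow> ('i \<times> 'j \<Rightarrow> complex) set" where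
  "tensor_space U V = cvec.span {tensor u v | u v. u \<in> U \<and> v \<in> V}"

definition sum_space ::
    "('i \<Rightarrow> complex) set \<Rightarrow> ('j \<Rightarrow> complex) set \<Rightarrow> ('i + 'j \<Rightarrow> complex) set" where
  "sum_space U V = {case_sum u v | u v. u \<in> U \<and> v \<in> V}"

text \<open>Linear maps from the space on I to the space on J are matrices, row index first.\<close>

definition Hom :: "'i set \<Rightarrow> 'j set \<Rightarrow> ('j \<Rightarrow> 'i \<Rightarrow> complex) set" where
  "Hom I J = {X. \<forall>j i. j \<notin> J \<or> i \<notin> I \<longrightarrow> X j i = 0}"

definition app :: "'i set \<Rightarrow> ('j \<Rightarrow> 'i \<Rightarrow> complex) \<Rightarrow> ('i \<Rightarrow> complex) \<Rightarrow> 'j \<Rightarrow> complex" where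
  "app I X v = (\<lambda>j. \<Sum>i\<in>I. X j i * v i)"

definition comp_map ::
    "'j set \<Rightarrow> ('k \<Rightarrow> 'j \<Rightarrow> complex) \<Rightarrow> ('j \<Rightarrow> 'i \<Rightarrow> complex) \<Rightarrow> 'k \<Rightarrow> 'i \<Rightarrow> complex" where
  "comp_map J X Y = (\<lambda>k i. \<Sum>j\<in>J. X k j * Y j i)"

definition id_map :: "'i set \<Rightarrow> 'i \<Rightarrow> 'i \<Rightarrow> complex" where
  "id_map I = (\<lambda>i j. if i = j \<and> i \<in> I then 1 else 0)"

definition tensor_map ::
    "('j \<Rightarrow> 'i \<Rightarrow> complex) \<Rightarrow> ('l \<Rightarrow> 'k \<Rightarrow> complex) \<Rightarrow> 'j \<times> 'l \<Rightarrow> 'i \<times> 'k \<Rightarrow> complex" where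
  "tensor_map X Y = (\<lambda>(j, l) (i, k). X j i * Y l k)"

definition is_inverse :: "'i set \<Rightarrow> ('i \<Rightarrow> 'i \<Rightarrow> complex) \<Rightarrow> ('i \<Rightarrow> 'i \<Rightarrow> complex) \<Rightarrow> bool" where
  "is_inverse I g g' \<longleftrightarrow>
     g' \<in> Hom I I \<and> comp_map I g g' = id_map I \<and> comp_map I g' g = id_map I"

definition GL :: "'i set \<Rightarrow> ('i \<Rightarrow> 'i \<Rightarrow> complex) set" where
  "GL I = {g \<in> Hom I I. \<exists>g'. is_inverse I g g'}"

definition inv_map :: "'i set \<Rightarrow> ('i \<Rightarrow> 'i \<Rightarrow> complex) \<Rightarrow> 'i \<Rightarrow> 'i \<Rightarrow> complex" where
  "inv_map I g = (THE g'. is_inverse I g g')"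

definition surj_map :: "'i set \<Rightarrow> 'j set \<Rightarrow> ('j \<Rightarrow> 'i \<Rightarrow> complex) \<Rightarrow> bool" where
  "surj_map I J X \<longleftrightarrow> app I X ` cspace I = cspace J"


section \<open>The spaces A and H and the compositions\<close>

text \<open>
  The spaces \<open>A\<^sub>i\<^sub>i\<close> are the field of complex numbers, acting by scalar
  multiplication, and do not occur explicitly. The remaining structure consists of
  \<open>comp_A : A\<^sub>3\<^sub>2 \<otimes> A\<^sub>2\<^sub>1 \<rightarrow> A\<^sub>3\<^sub>1\<close> and, for \<open>i < j\<close>,
  \<open>act_ji : H\<^sub>1\<^sub>j \<otimes> A\<^sub>j\<^sub>i \<rightarrow> H\<^sub>1\<^sub>i\<close>.
\<close>

record comp_data =
  a21 :: nat
  a31 :: nat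
  a32 :: nat
  h11 :: nat
  h12 :: nat
  h13 :: nat
  comp_A :: "nat \<Rightarrow> nat \<times> nat \<Rightarrow> complex"
  act_21 :: "nat \<Rightarrow> nat \<times> nat \<Rightarrow> complex"
  act_31 :: "nat \<Rightarrow> nat \<times> nat \<Rightarrow> complex"
  act_32 :: "nat \<Rightarrow> nat \<times> nat \<Rightarrow> complex"

text \<open>
  A map \<open>H\<^sub>j \<otimes> A \<rightarrow> H\<^sub>i\<close> induces \<open>A \<otimes> H\<^sub>i\<^sup>* \<rightarrow> H\<^sub>j\<^sup>*\<close>,
  where \<open>(a \<otimes> f)\<close> is sent to \<open>x \<mapsto> f (x a)\<close>.
\<close>

definition dual_act ::
    "('l \<Rightarrow> 'k \<times> 'a \<Rightarrow> complex) \<Rightarrow> 'k \<Rightarrow> 'a \<times> 'l \<Rightarrow> complex" where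
  "dual_act X = (\<lambda>k (a, l). X l (k, a))"

definition composition_system :: "comp_data \<Rightarrow> bool" where
  "composition_system D \<longleftrightarrow>
     comp_A D \<in> Hom ({..<a32 D} \<times> {..<a21 D}) {..<a31 D} \<and>
     act_21 D \<in> Hom ({..<h12 D} \<times> {..<a21 D}) {..<h11 D} \<and>
     act_31 D \<in> Hom ({..<h13 D} \<times> {..<a31 D}) {..<h11 D} \<and>
     act_32 D \<in> Hom ({..<h13 D} \<times> {..<a32 D}) {..<h12 D} \<and>
     (\<forall>x\<in>cspace {..<h13 D}. \<forall>b\<in>cspace {..<a32 D}. \<forall>a\<in>cspace {..<a21 D}.
        app ({..<h12 D} \<times> {..<a21 D}) (act_21 D)
          (tensor (app ({..<h13 D} \<times> {..<a32 D}) (act_32 D) (tensor x b)) a) =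
        app ({..<h13 D} \<times> {..<a31 D}) (act_31 D)
          (tensor x (app ({..<a32 D} \<times> {..<a21 D}) (comp_A D) (tensor b a)))) \<and>
     surj_map ({..<a32 D} \<times> {..<a21 D}) {..<a31 D} (comp_A D) \<and>
     surj_map ({..<h12 D} \<times> {..<a21 D}) {..<h11 D} (act_21 D) \<and>
     surj_map ({..<h13 D} \<times> {..<a31 D}) {..<h11 D} (act_31 D) \<and>
     surj_map ({..<h13 D} \<times> {..<a32 D}) {..<h12 D} (act_32 D) \<and>
     surj_map ({..<a21 D} \<times> {..<h11 D}) {..<h12 D} (dual_act (act_21 D)) \<and>
     surj_map ({..<a31 D} \<times> {..<h11 D}) {..<h13 D} (dual_act (act_31 D)) \<and>
     surj_map ({..<a32 D} \<times> {..<h12 D}) {..<h13 D} (dual_act (act_32 D))"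


section \<open>The spaces \<open>P\<^sub>i\<close> and the space \<open>\<^bold>W\<close>\<close>

text \<open>
  The index types of \<open>P\<^sub>1 = M\<^sub>1 \<oplus> M\<^sub>2 \<otimes> A\<^sub>2\<^sub>1 \<oplus> M\<^sub>3 \<otimes> A\<^sub>3\<^sub>1\<close> and
  \<open>P\<^sub>2 = M\<^sub>2 \<oplus> M\<^sub>3 \<otimes> A\<^sub>3\<^sub>2\<close>; the space \<open>P\<^sub>3 = M\<^sub>3\<close> is indexed by \<open>{..<m3}\<close>.
\<close>

type_synonym ix1 = "nat + nat \<times> nat + nat \<times> nat"
type_synonym ix2 = "nat + nat \<times> nat"

definition P1 :: "comp_data \<Rightarrow> nat \<Rightarrow> nat \<Rightarrow> nat \<Rightarrow> ix1 set" where
  "P1 D m1 m2 m3 = {..<m1} <+> ({..<m2} \<times> {..<a21 D} <+> {..<m3} \<times> {..<a31 D})"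

definition P2 :: "comp_data \<Rightarrow> nat \<Rightarrow> nat \<Rightarrow> ix2 set" where
  "P2 D m2 m3 = {..<m2} <+> {..<m3} \<times> {..<a32 D}"

text \<open>
  A point \<open>(x\<^sub>2, x\<^sub>3, \<psi>)\<close> consists of maps \<open>P\<^sub>2 \<otimes> A\<^sub>2\<^sub>1 \<rightarrow> P\<^sub>1\<close>,
  \<open>P\<^sub>3 \<otimes> A\<^sub>3\<^sub>2 \<rightarrow> P\<^sub>2\<close> and \<open>P\<^sub>1 \<otimes> H\<^sub>1\<^sub>1\<^sup>* \<rightarrow> N\<^sub>1\<close>.
\<close>

type_synonym pt =
  "(ix1 \<Rightarrow> ix2 \<times> nat \<Rightarrow> complex) \<times> (ix2 \<Rightarrow> nat \<times> nat \<Rightarrow> complex) \<times> (nat \<Rightarrow> ix1 \<times> nat \<Rightarrow> complex)"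

definition bigW :: "comp_data \<Rightarrow> nat \<Rightarrow> nat \<Rightarrow> nat \<Rightarrow> nat \<Rightarrow> pt set" where
  "bigW D m1 m2 m3 n1 =
     Hom (P2 D m2 m3 \<times> {..<a21 D}) (P1 D m1 m2 m3) \<times>
     Hom ({..<m3} \<times> {..<a32 D}) (P2 D m2 m3) \<times>
     Hom (P1 D m1 m2 m3 \<times> {..<h11 D}) {..<n1}"

type_synonym grp =
  "(ix1 \<Rightarrow> ix1 \<Rightarrow> complex) \<times> (ix2 \<Rightarrow> ix2 \<Rightarrow> complex) \<times> (nat \<Rightarrow> nat \<Rightarrow> complex) \<times> (nat \<Rightarrow> nat \<Rightarrow> complex)"

definition bigG :: "comp_data \<Rightarrow> nat \<Rightarrow> nat \<Rightarrow> nat \<Rightarrow> nat \<Rightarrow> grp set" where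
  "bigG D m1 m2 m3 n1 =
     GL (P1 D m1 m2 m3) \<times> GL (P2 D m2 m3) \<times> GL {..<m3} \<times> GL {..<n1}"

definition bigG_act :: "comp_data \<Rightarrow> nat \<Rightarrow> nat \<Rightarrow> nat \<Rightarrow> nat \<Rightarrow> grp \<Rightarrow> pt \<Rightarrow> pt" where
  "bigG_act D m1 m2 m3 n1 = (\<lambda>(g1, g2, g3, h) (x2, x3, psi).
     (let I1 = P1 D m1 m2 m3; I2 = P2 D m2 m3; I3 = {..<m3};
          J21 = I2 \<times> {..<a21 D}; J32 = I3 \<times> {..<a32 D}; J1 = I1 \<times> {..<h11 D} in
      (comp_map J21 (comp_map I1 g1 x2) (inv_map J21 (tensor_map g2 (id_map {..<a21 D}))),
       comp_map J32 (comp_map I2 g2 x3) (inv_map J32 (tensor_map g3 (id_map {..<a32 D}))),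
       comp_map J1 (comp_map {..<n1} h psi) (inv_map J1 (tensor_map g1 (id_map {..<h11 D}))))))"


section \<open>The space \<open>W\<close> and the map \<open>\<zeta>\<close>\<close>

type_synonym wpt =
  "(nat \<times> nat \<Rightarrow> nat \<Rightarrow> complex) \<times> (nat \<times> nat \<Rightarrow> nat \<Rightarrow> complex) \<times> (nat \<times> nat \<Rightarrow> nat \<Rightarrow> complex)"

definition smallW :: "comp_data \<Rightarrow> nat \<Rightarrow> nat \<Rightarrow> nat \<Rightarrow> nat \<Rightarrow> wpt set" where
  "smallW D m1 m2 m3 n1 =
     Hom {..<m1} ({..<n1} \<times> {..<h11 D}) \<times>
     Hom {..<m2} ({..<n1} \<times> {..<h12 D}) \<times>
     Hom {..<m3} ({..<n1} \<times> {..<h13 D})"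

text \<open>
  \<open>\<xi>\<^sub>2\<close> is \<open>(m \<otimes> a) \<mapsto> m \<otimes> a\<close> on \<open>M\<^sub>2 \<otimes> A\<^sub>2\<^sub>1\<close> and
  \<open>(m \<otimes> b) \<otimes> a \<mapsto> m \<otimes> (b a)\<close> on \<open>M\<^sub>3 \<otimes> A\<^sub>3\<^sub>2 \<otimes> A\<^sub>2\<^sub>1\<close>;
  \<open>\<xi>\<^sub>3\<close> is the inclusion of \<open>M\<^sub>3 \<otimes> A\<^sub>3\<^sub>2\<close>.
\<close>

definition xi2 :: "comp_data \<Rightarrow> nat \<Rightarrow> nat \<Rightarrow> ix1 \<Rightarrow> ix2 \<times> nat \<Rightarrow> complex" where
  "xi2 D m2 m3 = (\<lambda>r (p, a).
     (case (r, p) of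
        (Inr (Inl s), Inl m) \<Rightarrow> id_map ({..<m2} \<times> {..<a21 D}) s (m, a)
      | (Inr (Inr (m', c)), Inr (m, b)) \<Rightarrow> id_map {..<m3} m' m * comp_A D c (b, a)
      | _ \<Rightarrow> 0))"

definition xi3 :: "comp_data \<Rightarrow> nat \<Rightarrow> ix2 \<Rightarrow> nat \<times> nat \<Rightarrow> complex" where
  "xi3 D m3 = (\<lambda>p s.
     (case p of Inl _ \<Rightarrow> 0 | Inr t \<Rightarrow> id_map ({..<m3} \<times> {..<a32 D}) t s))"

definition gamma :: "comp_data \<Rightarrow> wpt \<Rightarrow> nat \<times> nat \<Rightarrow> ix1 \<Rightarrow> complex" where
  "gamma D = (\<lambda>(phi1, phi2, phi3) (n, l) p.
     (case p of
        Inl m \<Rightarrow> phi1 (n, l) m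
      | Inr (Inl (m, a)) \<Rightarrow> (\<Sum>k<h12 D. phi2 (n, k) m * act_21 D l (k, a))
      | Inr (Inr (m, a)) \<Rightarrow> (\<Sum>k<h13 D. phi3 (n, k) m * act_31 D l (k, a))))"

text \<open>In \<open>\<zeta>(w)\<close>, \<open>Hom(P\<^sub>1, N\<^sub>1 \<otimes> H\<^sub>1\<^sub>1)\<close> is identified with \<open>Hom(P\<^sub>1 \<otimes> H\<^sub>1\<^sub>1\<^sup>*, N\<^sub>1)\<close>.\<close>

definition zeta :: "comp_data \<Rightarrow> nat \<Rightarrow> nat \<Rightarrow> wpt \<Rightarrow> pt" where
  "zeta D m2 m3 w = (xi2 D m2 m3, xi3 D m3, (\<lambda>n (p, l). gamma D w (n, l) p))"

definition Zset :: "comp_data \<Rightarrow> nat \<Rightarrow> nat \<Rightarrow> nat \<Rightarrow> nat \<Rightarrow> pt set" where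
  "Zset D m1 m2 m3 n1 =
     {bigG_act D m1 m2 m3 n1 g (zeta D m2 m3 w) | g w.
        g \<in> bigG D m1 m2 m3 n1 \<and> w \<in> smallW D m1 m2 m3 n1}"


section \<open>Zariski closure\<close>

text \<open>
  The polynomial functions on a space with coordinate functions L. The Zariski closure
  contains the closure in the Euclidean topology, as polynomial functions are continuous.
\<close>

inductive_set polyfuns :: "('x \<Rightarrow> complex) set \<Rightarrow> ('x \<Rightarrow> complex) set"
  for L :: "('x \<Rightarrow> complex) set" where
  coordinate: "f \<in> L \<Longrightarrow> f \<in> polyfuns L"
| const: "(\<lambda>_. c) \<in> polyfuns L"
| add: "f \<in> polyfuns L \<Longrightarrow> g \<in> polyfuns L \<Longrightarrow> (\<lambda>x. f x + g x) \<in> polyfuns L"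
| mult: "f \<in> polyfuns L \<Longrightarrow> g \<in> polyfuns L \<Longrightarrow> (\<lambda>x. f x * g x) \<in> polyfuns L"

definition zariski_closure :: "('x \<Rightarrow> complex) set \<Rightarrow> 'x set \<Rightarrow> 'x set \<Rightarrow> 'x set" where
  "zariski_closure L X S =
     {x \<in> X. \<forall>f\<in>polyfuns L. (\<forall>s\<in>S. f s = 0) \<longrightarrow> f x = 0}"

definition pt_coords :: "(pt \<Rightarrow> complex) set" where
  "pt_coords =
     {(\<lambda>(x2, x3, psi). x2 r s) | r s. True} \<union>
     {(\<lambda>(x2, x3, psi). x3 r s) | r s. True} \<union>
     {(\<lambda>(x2, x3, psi). psi r s) | r s. True}"


section \<open>Semi-stability\<close>

definition semistable ::
    "comp_data \<Rightarrow> nat \<Rightarrow> nat \<Rightarrow> nat \<Rightarrow> nat \<Rightarrow> real \<Rightarrow> real \<Rightarrow> real \<Rightarrow> real \<Rightarrow> pt set" where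
  "semistable D m1 m2 m3 n1 alpha1 alpha2 alpha3 mu1 =
     {(x2, x3, psi) \<in> bigW D m1 m2 m3 n1.
        \<forall>U1 U2 U3 Q.
          subspace_of U1 (cspace (P1 D m1 m2 m3)) \<and>
          subspace_of U2 (cspace (P2 D m2 m3)) \<and>
          subspace_of U3 (cspace {..<m3}) \<and>
          subspace_of Q (cspace {..<n1}) \<and>
          \<not> (U1 = {0} \<and> U2 = {0} \<and> U3 = {0} \<and> Q = {0}) \<and>
          \<not> (U1 = cspace (P1 D m1 m2 m3) \<and> U2 = cspace (P2 D m2 m3) \<and>
             U3 = cspace {..<m3} \<and> Q = cspace {..<n1}) \<and>
          app (P2 D m2 m3 \<times> {..<a21 D}) x2 ` tensor_space U2 (cspace {..<a21 D}) \<subseteq> U1 \<and>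
          app ({..<m3} \<times> {..<a32 D}) x3 ` tensor_space U3 (cspace {..<a32 D}) \<subseteq> U2 \<and>
          app (P1 D m1 m2 m3 \<times> {..<h11 D}) psi ` tensor_space U1 (cspace {..<h11 D}) \<subseteq> Q
          \<longrightarrow> alpha1 * real (cvec.dim U1) + alpha2 * real (cvec.dim U2)
                + alpha3 * real (cvec.dim U3) - mu1 * real (cvec.dim Q) \<le> 0}"


section \<open>The constants\<close>

definition sup_ratio :: "real set \<Rightarrow> real" where
  "sup_ratio R = (if R = {} then 0 else Sup R)"

definition delta1 ::
    "comp_data \<Rightarrow> nat \<Rightarrow> nat \<Rightarrow>
      nat \<times> nat + nat \<times> nat \<Rightarrow> (nat \<times> nat + nat \<times> nat) \<times> nat \<Rightarrow> complex" where
  "delta1 D m2 m3 = (\<lambda>r (p, l).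
     (case (r, p) of
        (Inl (m', k), Inl (m, a)) \<Rightarrow> id_map {..<m2} m' m * dual_act (act_21 D) k (a, l)
      | (Inr (m', k), Inr (m, a)) \<Rightarrow> id_map {..<m3} m' m * dual_act (act_31 D) k (a, l)
      | _ \<Rightarrow> 0))"

definition c1 :: "comp_data \<Rightarrow> nat \<Rightarrow> nat \<Rightarrow> real" where
  "c1 D m2 m3 =
     (let I = {..<m2} \<times> {..<a21 D} <+> {..<m3} \<times> {..<a31 D};
          J = {..<m2} \<times> {..<h12 D} <+> {..<m3} \<times> {..<h13 D} in
      sup_ratio
        {codim (cspace J)
           (app (I \<times> {..<h11 D}) (delta1 D m2 m3) ` tensor_space K (cspace {..<h11 D}))
           / codim (cspace I) K | K.
         subspace_of K (cspace I) \<and> K \<noteq> cspace I \<and>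
         (\<forall>U2 U3. subspace_of U2 (cspace {..<m2}) \<and> subspace_of U3 (cspace {..<m3}) \<and>
            (U2, U3) \<noteq> (cspace {..<m2}, cspace {..<m3}) \<longrightarrow>
            \<not> K \<subseteq> sum_space (tensor_space U2 (cspace {..<a21 D}))
                             (tensor_space U3 (cspace {..<a31 D})))})"

definition c3 :: "comp_data \<Rightarrow> nat \<Rightarrow> real" where
  "c3 D m3 = c1 D 0 m3"

definition tau :: "comp_data \<Rightarrow> nat \<Rightarrow> nat \<times> nat \<Rightarrow> (nat \<times> nat) \<times> nat \<Rightarrow> complex" where
  "tau D m3 = (\<lambda>(m', k) ((m, b), l). id_map {..<m3} m' m * dual_act (act_32 D) k (b, l))"

definition c3' :: "comp_data \<Rightarrow> nat \<Rightarrow> real" where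
  "c3' D m3 =
     (let I = {..<m3} \<times> {..<a32 D}; J = {..<m3} \<times> {..<h13 D} in
      sup_ratio
        {codim (cspace J)
           (app (I \<times> {..<h12 D}) (tau D m3) ` tensor_space K (cspace {..<h12 D}))
           / codim (cspace I) K | K.
         subspace_of K (cspace I) \<and> K \<noteq> cspace I \<and>
         (\<forall>U. subspace_of U (cspace {..<m3}) \<and> U \<noteq> cspace {..<m3} \<longrightarrow>
            \<not> K \<subseteq> tensor_space U (cspace {..<a32 D}))})"

end

theory Submission
  imports Defs "Jordan_Normal_Form.Determinant"
begin

text \<open>
  A point of \<open>\<^bold>W\<close> is read as a family of linear maps \<open>X2 a\<close>, \<open>X3 b\<close>, \<open>Psi l\<close>. Products of two of
  them factor through the compositions of the system on Z, hence, these being polynomial equations,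
  on the closure of Z. Conversely, a point of \<open>\<^bold>W\<close> with these factorizations lies in Z as soon as the maps
  \<open>M\<^sub>3 \<otimes> A\<^sub>3\<^sub>2 \<rightarrow> P\<^sub>2\<close> and
  \<open>M\<^sub>2 \<otimes> A\<^sub>2\<^sub>1 \<oplus> M\<^sub>3 \<otimes> A\<^sub>3\<^sub>1 \<rightarrow> P\<^sub>1\<close> are injective: bases of
  the images are completed to elements of the general linear groups.

  If one of them has a kernel K, let \<open>M\<^sub>i'\<close> be the smallest subspaces with K in the sum of the
  \<open>M\<^sub>i' \<otimes> A\<close>. The subspaces generated by the \<open>M\<^sub>i'\<close> form an invariant family. The
  constants bound the dimension of its part in \<open>N\<^sub>1\<close> by that of its part in \<open>P\<^sub>1\<close> or \<open>P\<^sub>2\<close>, since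
  the map to \<open>N\<^sub>1\<close> kills \<open>\<delta>\<^sub>1(K \<otimes> H\<^sub>1\<^sub>1\<^sup>*)\<close>, and the numerical conditions then contradict
  semi-stability.
\<close>

text \<open>The delicate case is a kernel K of \<open>M\<^sub>3 \<otimes> A\<^sub>3\<^sub>2
  \<rightarrow> P\<^sub>2\<close>. The estimate with \<open>c3'\<close> applies to K directly. The
  estimate with \<open>c3\<close> needs a kernel in
  \<open>M\<^sub>3 \<otimes> A\<^sub>3\<^sub>1\<close>; it consists of the products of K with
  elements of \<open>A\<^sub>2\<^sub>1\<close>, and its smallest space \<open>M\<^sub>3'\<close>
  must be as large as that of K. This fails only if a nonzero element of
  \<open>A\<^sub>3\<^sub>2\<close> is annihilated by all of \<open>A\<^sub>2\<^sub>1\<close>. Then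
  every point of Z has a nonzero vector of \<open>P\<^sub>2\<close> killed by its first component, a
  condition on ranks that persists on the closure, and the line through such a vector violates
  semi-stability. The two injectivity statements are proved in this order because the second needs
  the exact dimension of the subspace generated in \<open>P\<^sub>2\<close>, which the first
  provides. Condition (1) or one of its replacements serves the first statement, conditions (2) and
  (3) the second.\<close>

section \<open>Finite dimensional subspaces\<close>

text \<open>The space of all functions on an infinite index type has infinite dimension, so
  finiteness is a property of subsets here. Without it \<open>dim\<close> says little: an infinite
  basis has cardinality 0.\<close>

definition (in vector_space) findim :: "'b set \<Rightarrow> bool" where
  "findim V \<longleftrightarrow> (\<exists>W. finite W \<and> V \<subseteq> span W)"

lemma (in vector_space) findim_subset: "findim V \<Longrightarrow> U \<subseteq> V \<Longrightarrow> findim U"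
  unfolding findim_def by blast

lemma (in vector_space) findim_independent_finite:
  "findim V \<Longrightarrow> B \<subseteq> V \<Longrightarrow> independent B \<Longrightarrow> finite B"
  unfolding findim_def using independent_span_bound by (meson subset_trans)

lemma (in vector_space) findim_dim_mono:
  assumes "findim V" "U \<subseteq> V"
  shows "dim U \<le> dim V"
proof -
  obtain B where B: "B \<subseteq> V" "independent B" "V \<subseteq> span B" "card B = dim V"
    using basis_exists by blast
  with assms findim_independent_finite show ?thesis
    by (metis dim_le_card subset_trans)
qed

lemma (in vector_space) findim_subspace_eq:
  assumes "findim V" "U \<subseteq> V" "subspace U" "dim V \<le> dim U"
  shows "U = V"
proof -
  obtain B where B: "B \<subseteq> U" "independent B" "U \<subseteq> span B" "card B = dim U"
    using basis_exists by blast
  obtain C where C: "B \<subseteq> C" "C \<subseteq> V" "independent C" "V \<subseteq> span C"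
    using maximal_independent_subset_extend[of B V] B assms(2) by blast
  have "finite C" using C findim_independent_finite[OF assms(1)] by blast
  moreover have "card C = dim V" using C basis_card_eq_dim by blast
  ultimately have "B = C" using B C assms(4) by (metis card_seteq)
  then show ?thesis using B C assms by (metis span_minimal subset_antisym subset_trans)
qed

lemma (in vector_space) findim_dim_zero:
  assumes "findim V" "dim V = 0"
  shows "V \<subseteq> {0}"
proof -
  obtain B where B: "B \<subseteq> V" "independent B" "V \<subseteq> span B" "card B = dim V"
    using basis_exists by blast
  then have "B = {}" using assms findim_independent_finite by (metis card_eq_0_iff)
  then show ?thesis using B by simp
qed

lemma (in vector_space) dim_zero_space: "dim {0} = 0"
  using dim_span_eq_card_independent[of "{}"] independent_empty by simp

lemma (in vector_space) exists_projection:
  assumes "subspace F"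
  obtains p where "Vector_Spaces.linear scale scale p" "range p \<subseteq> F" "\<forall>v\<in>F. p v = v"
proof -
  interpret vector_space_pair scale scale by unfold_locales
  have "Vector_Spaces.linear scale scale id" by (simp add: linear_id)
  from linear_exists_left_inverse_on[OF this assms]
  obtain g where "range g \<subseteq> F" "Vector_Spaces.linear scale scale g" "\<forall>v\<in>F. g (id v) = v"
    by auto
  then show thesis using that by simp
qed

lemma (in vector_space_pair) findim_image:
  assumes "Vector_Spaces.linear s1 s2 f" "vs1.findim V"
  shows "vs2.findim (f ` V)"
proof -
  obtain W where "finite W" "V \<subseteq> vs1.span W" using assms unfolding vs1.findim_def by blast
  then have "finite (f ` W)" "f ` V \<subseteq> vs2.span (f ` W)"
    using linear_span_image[OF assms(1)] by auto
  then show ?thesis unfolding vs2.findim_def by blast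
qed

text \<open>A basis C of the kernel is extended to a basis B of V, and the images of
  \<open>B - C\<close> form a basis of the image. Only V, not the ambient space, has to be finite
  dimensional.\<close>

lemma (in vector_space_pair) rank_nullity:
  assumes f: "Vector_Spaces.linear s1 s2 f" and V: "vs1.subspace V" "vs1.findim V"
  shows "vs1.dim V = vs2.dim (f ` V) + vs1.dim {v \<in> V. f v = 0}"
proof -
  let ?K = "{v \<in> V. f v = 0}"
  obtain C where C: "C \<subseteq> ?K" "vs1.independent C" "?K \<subseteq> vs1.span C" "card C = vs1.dim ?K"
    using vs1.basis_exists by blast
  then obtain B where B: "C \<subseteq> B" "B \<subseteq> V" "vs1.independent B" "V \<subseteq> vs1.span B"
    using vs1.maximal_independent_subset_extend[of C V] by (metis (no_types, lifting) mem_Collect_eq subset_iff)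
  have fin: "finite B" using B V(2) vs1.findim_independent_finite by blast
  let ?D = "B - C"
  have D: "vs1.span ?D \<subseteq> V" "vs1.independent ?D"
    using vs1.span_minimal[OF _ V(1), of ?D] B vs1.independent_mono[OF B(3), of ?D] by auto
  \<comment> \<open>Such a v lies in the span of C and in that of \<open>B - C\<close>; its
    coordinates in B are supported on disjoint sets and therefore vanish.\<close>
  have ker: "v = 0" if v: "v \<in> vs1.span ?D" "f v = 0" for v
  proof -
    have "v \<in> vs1.span C" using v D C by blast
    have "vs1.representation B v = vs1.representation C v"
      by (rule vs1.representation_extend[OF B(3) \<open>v \<in> vs1.span C\<close> B(1)])
    moreover have "vs1.representation B v = vs1.representation ?D v"
      by (rule vs1.representation_extend[OF B(3) v(1)]) blast
    ultimately have "vs1.representation B v b = 0" for b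
      by (metis DiffE vs1.representation_ne_zero)
    moreover have "v \<in> vs1.span B" using v D B by blast
    ultimately show ?thesis
      using vs1.sum_nonzero_representation_eq[OF B(3), of v] by simp
  qed
  have "inj_on f (vs1.span ?D)"
    using linear_inj_on_iff_eq_0[OF f vs1.subspace_span] ker by blast
  then have ind: "vs2.independent (f ` ?D)" and inj: "inj_on f ?D"
    using linear_independent_injective_image[OF f D(2)] vs1.span_superset
    by (blast, meson inj_on_subset)
  have "f ` V \<subseteq> vs2.span (f ` ?D)"
  proof -
    have "f ` V \<subseteq> vs2.span (f ` B)" using B linear_span_image[OF f] by blast
    also have "\<dots> \<subseteq> vs2.span (f ` ?D)"
    proof (rule vs2.span_minimal[OF _ vs2.subspace_span])
      show "f ` B \<subseteq> vs2.span (f ` ?D)"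
      proof
        fix y assume "y \<in> f ` B"
        then obtain b where b: "b \<in> B" "y = f b" by blast
        show "y \<in> vs2.span (f ` ?D)"
        proof (cases "b \<in> C")
          case True then show ?thesis using b C vs2.span_zero by auto
        next
          case False then show ?thesis using b by (intro vs2.span_base) blast
        qed
      qed
    qed
    finally show ?thesis .
  qed
  then have "vs2.dim (f ` V) = card (f ` ?D)"
    using vs2.basis_card_eq_dim[OF _ _ ind, of "f ` V"] B by (metis Diff_subset image_mono subset_trans)
  moreover have "card (f ` ?D) = card B - card C"
    using inj fin B by (simp add: card_image card_Diff_subset finite_subset)
  moreover have "card B = vs1.dim V" using B vs1.basis_card_eq_dim by blast
  moreover have "card C \<le> card B" using B fin card_mono by blast
  ultimately show ?thesis using C by linarith
qed

lemma (in vector_space_pair) dim_image_le: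
  assumes "Vector_Spaces.linear s1 s2 f" "vs1.subspace V" "vs1.findim V"
  shows "vs2.dim (f ` V) \<le> vs1.dim V"
  using rank_nullity[OF assms] by simp

lemma (in vector_space_pair) dim_image_inj:
  assumes "Vector_Spaces.linear s1 s2 f" "vs1.subspace V" "vs1.findim V"
    "\<And>v. v \<in> V \<Longrightarrow> f v = 0 \<Longrightarrow> v = 0"
  shows "vs2.dim (f ` V) = vs1.dim V"
proof -
  have "{v \<in> V. f v = 0} = {0}"
    using assms vs1.subspace_0 linear_0[OF assms(1)] by blast
  then show ?thesis using rank_nullity[OF assms(1-3)] vs1.dim_zero_space by simp
qed

abbreviation (input) clinear :: "(('i \<Rightarrow> complex) \<Rightarrow> 'j \<Rightarrow> complex) \<Rightarrow> bool" where
  "clinear f \<equiv> Vector_Spaces.linear cscale cscale f"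

interpretation cpair: vector_space_pair
  "cscale :: complex \<Rightarrow> ('i \<Rightarrow> complex) \<Rightarrow> 'i \<Rightarrow> complex"
  "cscale :: complex \<Rightarrow> ('j \<Rightarrow> complex) \<Rightarrow> 'j \<Rightarrow> complex"
  by unfold_locales

lemma clinear_iff:
  "clinear f \<longleftrightarrow> (\<forall>u v. f (u + v) = f u + f v) \<and> (\<forall>c v. f (\<lambda>i. c * v i) = (\<lambda>j. c * f v j))"
  by (simp add: Vector_Spaces.linear_iff cvec.vector_space_axioms)

lemma clinearD:
  assumes "clinear f"
  shows "f (u + v) = f u + f v" "f (\<lambda>i. c * v i) = (\<lambda>j. c * f v j)" "f 0 = 0"
    "f (\<Sum>x\<in>S. g x) = (\<Sum>x\<in>S. f (g x))" "f (u - v) = f u - f v"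
  using assms clinear_iff[of f] cpair.linear_0[OF assms] cpair.linear_sum[OF assms]
    cpair.linear_diff[OF assms] by auto

lemma clinear_compose: "clinear f \<Longrightarrow> clinear g \<Longrightarrow> clinear (\<lambda>v. f (g v))"
  by (simp add: clinear_iff)

lemma clinear_add: "clinear f \<Longrightarrow> clinear g \<Longrightarrow> clinear (\<lambda>v. f v + g v)"
  by (simp add: clinear_iff fun_eq_iff algebra_simps)

lemma clinear_sum: "(\<And>x. x \<in> S \<Longrightarrow> clinear (f x)) \<Longrightarrow> clinear (\<lambda>v. \<Sum>x\<in>S. f x v)"
  by (induction S rule: infinite_finite_induct) (auto simp: clinear_iff fun_eq_iff algebra_simps)

lemma clinear_app: "clinear (app I X)"
  by (simp add: clinear_iff fun_eq_iff app_def algebra_simps sum.distrib sum_distrib_left)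

lemma clinear_reindex: "clinear (\<lambda>v i. v (h i))"
  by (simp add: clinear_iff fun_eq_iff)

lemma sum_fun_apply: "(\<Sum>x\<in>S. f x) i = (\<Sum>x\<in>S. f x i)" for f :: "'a \<Rightarrow> 'i \<Rightarrow> complex"
  by (induction S rule: infinite_finite_induct) auto

lemma clinear_scale: "clinear (\<lambda>v i. c * v i)"
  by (simp add: clinear_iff fun_eq_iff distrib_left mult.left_commute)

lemma clinear_weighted_sum:
  assumes "\<And>s. s \<in> S \<Longrightarrow> clinear (f s)"
  shows "clinear (\<lambda>v i. \<Sum>s\<in>S. c s * f s v i)"
proof -
  have "clinear (\<lambda>v i. c s * f s v i)" if "s \<in> S" for s
    by (rule clinear_compose[where f = "\<lambda>v i. c s * v i", OF clinear_scale assms[OF that]])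
  then have "clinear (\<lambda>v. \<Sum>s\<in>S. (\<lambda>i. c s * f s v i))"
    by (rule clinear_sum[where f = "\<lambda>s v i. c s * f s v i"])
  moreover have "(\<lambda>v. \<Sum>s\<in>S. (\<lambda>i. c s * f s v i)) = (\<lambda>v i. \<Sum>s\<in>S. c s * f s v i)"
    by (simp add: fun_eq_iff sum_fun_apply)
  ultimately show ?thesis by simp
qed

lemma csubspaceI:
  assumes "0 \<in> V" "\<And>u v. u \<in> V \<Longrightarrow> v \<in> V \<Longrightarrow> u + v \<in> V"
    "\<And>c v. v \<in> V \<Longrightarrow> (\<lambda>i. c * v i) \<in> V"
  shows "cvec.subspace V"
  using assms unfolding cvec.subspace_def by blast

lemma subspace_cspace: "cvec.subspace (cspace I)"
  by (rule csubspaceI) (auto simp: cspace_def)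

definition unit :: "'i \<Rightarrow> 'i \<Rightarrow> complex" where
  "unit i = (\<lambda>j. if j = i then 1 else 0)"

lemma unit_in_cspace: "i \<in> I \<Longrightarrow> unit i \<in> cspace I"
  by (auto simp: unit_def cspace_def)

lemma cspace_expand:
  assumes "finite I" "v \<in> cspace I"
  shows "v = (\<Sum>i\<in>I. (\<lambda>j. v i * unit i j))"
proof
  fix j
  have "(\<Sum>i\<in>I. v i * unit i j) = (\<Sum>i\<in>I. if i = j then v i else 0)"
    by (intro sum.cong) (auto simp: unit_def)
  also have "\<dots> = v j" using assms by (auto simp: cspace_def)
  finally show "v j = (\<Sum>i\<in>I. (\<lambda>j. v i * unit i j)) j" by (simp add: sum_fun_apply)
qed

lemma inj_unit: "inj_on unit I"
  by (auto simp: inj_on_def unit_def fun_eq_iff split: if_splits)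

lemma independent_units:
  assumes "finite I"
  shows "cvec.independent (unit ` I)"
proof (rule cvec.independent_if_scalars_zero)
  fix f x assume *: "(\<Sum>x\<in>unit ` I. (\<lambda>i. f x * x i)) = (0 :: 'a \<Rightarrow> complex)" "x \<in> unit ` I"
  then obtain i where i: "i \<in> I" "x = unit i" by blast
  have "0 = (\<Sum>x\<in>unit ` I. f x * x i)"
    using fun_cong[OF *(1), of i] by (simp add: sum_fun_apply)
  also have "\<dots> = (\<Sum>j\<in>I. f (unit j) * unit j i)"
    using inj_unit by (subst sum.reindex) auto
  also have "\<dots> = (\<Sum>j\<in>I. if j = i then f (unit j) else 0)"
    by (intro sum.cong) (auto simp: unit_def)
  also have "\<dots> = f x" using i assms by simp
  finally show "f x = 0" by simp
qed (simp add: assms)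

lemma span_units:
  assumes "finite I"
  shows "cvec.span (unit ` I) = cspace I"
proof (rule antisym)
  show "cvec.span (unit ` I) \<subseteq> cspace I"
    by (intro cvec.span_minimal image_subsetI unit_in_cspace subspace_cspace)
  show "cspace I \<subseteq> cvec.span (unit ` I)"
  proof
    fix v :: "'a \<Rightarrow> complex" assume v: "v \<in> cspace I"
    show "v \<in> cvec.span (unit ` I)"
      by (subst cspace_expand[OF assms v])
        (intro cvec.span_sum cvec.span_scale cvec.span_base imageI)
  qed
qed

lemma findim_cspace: "finite I \<Longrightarrow> cvec.findim (cspace I)"
  unfolding cvec.findim_def by (metis finite_imageI order_refl span_units)

lemma dim_cspace: "finite I \<Longrightarrow> cvec.dim (cspace I) = card I"
  using cvec.dim_span_eq_card_independent[OF independent_units, of I]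
  by (simp add: span_units card_image inj_unit)

text \<open>The tensor product of U with \<open>cspace A\<close>, described so that membership is
  tested at one basis vector of the second factor at a time instead of through a span of pure
  tensors.\<close>

definition slices_in :: "'j set \<Rightarrow> ('i \<Rightarrow> complex) set \<Rightarrow> ('i \<times> 'j \<Rightarrow> complex) set" where
  "slices_in A U = {t. (\<forall>a\<in>A. (\<lambda>i. t (i, a)) \<in> U) \<and> (\<forall>i a. a \<notin> A \<longrightarrow> t (i, a) = 0)}"

lemma subspace_slices_in:
  assumes "cvec.subspace U"
  shows "cvec.subspace (slices_in A U)"
proof (rule csubspaceI)
  show "0 \<in> slices_in A U" using cvec.subspace_0[OF assms] by (auto simp: slices_in_def zero_fun_def)
next
  fix u v assume "u \<in> slices_in A U" "v \<in> slices_in A U"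
  then show "u + v \<in> slices_in A U" using cvec.subspace_add[OF assms] by (fastforce simp: slices_in_def plus_fun_def)
next
  fix c v assume "v \<in> slices_in A U"
  then show "(\<lambda>i. c * v i) \<in> slices_in A U" using cvec.subspace_scale[OF assms] by (fastforce simp: slices_in_def)
qed

text \<open>A pure tensor has multiples of its first factor as slices; conversely a tensor is the
  sum of its slices, each tensored with a unit vector.\<close>

lemma tensor_space_eq_slices_in:
  assumes U: "cvec.subspace U" and A: "finite A"
  shows "tensor_space U (cspace A) = slices_in A U"
proof (rule antisym)
  show "tensor_space U (cspace A) \<subseteq> slices_in A U"
    unfolding tensor_space_def
  proof (rule cvec.span_minimal[OF _ subspace_slices_in[OF U]])
    show "{tensor u v |u v. u \<in> U \<and> v \<in> cspace A} \<subseteq> slices_in A U"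
    proof clarsimp
      fix u v assume "u \<in> U" "v \<in> cspace A"
      moreover have "(\<lambda>i. u i * v a) \<in> U" for a
        using cvec.subspace_scale[OF U \<open>u \<in> U\<close>, of "v a"] by (simp add: mult.commute)
      ultimately show "tensor u v \<in> slices_in A U"
        by (simp add: slices_in_def tensor_def cspace_def)
    qed
  qed
next
  show "slices_in A U \<subseteq> tensor_space U (cspace A)"
  proof
    fix t assume t: "t \<in> slices_in A U"
    have "t = (\<Sum>a\<in>A. tensor (\<lambda>i. t (i, a)) (unit a))"
    proof
      fix x :: "'a \<times> 'b"
      obtain i a where x: "x = (i, a)" by (cases x)
      have "(\<Sum>a'\<in>A. tensor (\<lambda>i. t (i, a')) (unit a') x) = (\<Sum>a'\<in>A. if a' = a then t (i, a') else 0)"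
        by (intro sum.cong) (auto simp: tensor_def unit_def x)
      also have "\<dots> = t x" using t A by (auto simp: slices_in_def x)
      finally show "t x = (\<Sum>a\<in>A. tensor (\<lambda>i. t (i, a)) (unit a)) x" by (simp add: sum_fun_apply)
    qed
    also have "\<dots> \<in> tensor_space U (cspace A)"
      unfolding tensor_space_def using t
      by (intro cvec.span_sum cvec.span_base) (auto simp: slices_in_def intro!: unit_in_cspace)
    finally show "t \<in> tensor_space U (cspace A)" .
  qed
qed

lemma slices_in_cspace: "slices_in A (cspace I) = cspace (I \<times> A)"
  by (auto simp: slices_in_def cspace_def)

lemma slices_in_mono: "U \<subseteq> V \<Longrightarrow> slices_in A U \<subseteq> slices_in A V"
  by (auto simp: slices_in_def)

text \<open>Induction on A: taking the slice at the new index maps onto U, and the kernel is the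
  space for the smaller index set.\<close>

lemma dim_slices_in:
  fixes A :: "'j set" and U :: "('i \<Rightarrow> complex) set"
  assumes U: "cvec.subspace U" "U \<subseteq> cspace I" "finite I" and A: "finite A"
  shows "cvec.dim (slices_in A U) = card A * cvec.dim U"
  using A
proof (induction A rule: finite_induct)
  case empty
  have "slices_in ({} :: 'j set) U = {0}" by (auto simp: slices_in_def)
  then show ?case by (simp add: cvec.dim_zero_space)
next
  case (insert a A)
  let ?V = "slices_in (insert a A) U" and ?f = "\<lambda>t i. t (i, a)"
  have fd: "cvec.findim ?V"
    using insert U slices_in_mono[OF U(2), of "insert a A"]
    by (metis cvec.findim_subset finite.insertI finite_cartesian_product findim_cspace slices_in_cspace)
  have "?f ` ?V = U"
  proof
    show "U \<subseteq> ?f ` ?V"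
    proof
      fix u assume "u \<in> U"
      then have "tensor u (unit a) \<in> ?V" "u = ?f (tensor u (unit a))"
        using cvec.subspace_0[OF U(1)] by (auto simp: slices_in_def tensor_def unit_def zero_fun_def)
      then show "u \<in> ?f ` ?V" by blast
    qed
  qed (auto simp: slices_in_def)
  moreover have "{t \<in> ?V. ?f t = 0} = slices_in A U"
    using insert(2) cvec.subspace_0[OF U(1)]
    by (auto simp: slices_in_def fun_eq_iff zero_fun_def) (metis (mono_tags))
  ultimately show ?case
    using cpair.rank_nullity[OF clinear_reindex subspace_slices_in[OF U(1)] fd, of "\<lambda>i. (i, a)"] insert
    by simp
qed

section \<open>Matrices and invertible maps\<close>

lemma HomD: "X \<in> Hom I J \<Longrightarrow> j \<notin> J \<or> i \<notin> I \<Longrightarrow> X j i = 0"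
  by (auto simp: Hom_def)

lemma comp_map_assoc: "comp_map J X (comp_map I Y Z) = comp_map I (comp_map J X Y) Z"
  by (simp add: comp_map_def fun_eq_iff sum_distrib_left sum_distrib_right mult.assoc sum.swap[of _ I J])

lemma app_comp_map: "app I (comp_map J X Y) v = app J X (app I Y v)"
  by (simp add: comp_map_def app_def fun_eq_iff sum_distrib_left sum_distrib_right mult.assoc sum.swap[of _ I J])

lemma comp_map_Hom: "X \<in> Hom J K \<Longrightarrow> Y \<in> Hom I J' \<Longrightarrow> comp_map L X Y \<in> Hom I K"
  by (auto simp: Hom_def comp_map_def)

lemma comp_map_id_left:
  assumes "finite J" "X \<in> Hom I J"
  shows "comp_map J (id_map J) X = X"
proof (intro ext)
  fix k i
  have "comp_map J (id_map J) X k i = (\<Sum>j\<in>J. if j = k then X j i else 0)"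
    unfolding comp_map_def by (intro sum.cong) (auto simp: id_map_def)
  then show "comp_map J (id_map J) X k i = X k i" using assms by (auto simp: Hom_def)
qed

lemma comp_map_id_right:
  assumes "finite I" "X \<in> Hom I J"
  shows "comp_map I X (id_map I) = X"
proof (intro ext)
  fix k i
  have "comp_map I X (id_map I) k i = (\<Sum>j\<in>I. if j = i then X k j else 0)"
    unfolding comp_map_def by (intro sum.cong) (auto simp: id_map_def)
  then show "comp_map I X (id_map I) k i = X k i" using assms by (auto simp: Hom_def)
qed

lemma id_map_Hom: "id_map I \<in> Hom I I"
  by (auto simp: id_map_def Hom_def)

lemma id_map_GL: "finite I \<Longrightarrow> id_map I \<in> GL I"
  unfolding GL_def is_inverse_def using id_map_Hom comp_map_id_left by blast

lemma app_in_cspace: "X \<in> Hom I J \<Longrightarrow> app K X v \<in> cspace J"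
  by (auto simp: Hom_def app_def cspace_def)

lemma app_unit: "finite I \<Longrightarrow> i \<in> I \<Longrightarrow> app I X (unit i) = (\<lambda>j. X j i)"
proof
  fix j assume *: "finite I" "i \<in> I"
  have "app I X (unit i) j = (\<Sum>k\<in>I. if k = i then X j k else 0)"
    unfolding app_def by (intro sum.cong) (auto simp: unit_def)
  then show "app I X (unit i) j = X j i" using * by auto
qed

lemma app_id_map: "finite I \<Longrightarrow> v \<in> cspace I \<Longrightarrow> app I (id_map I) v = v"
proof
  fix j assume *: "finite I" "v \<in> cspace I"
  have "app I (id_map I) v j = (\<Sum>k\<in>I. if k = j then v k else 0)"
    unfolding app_def by (intro sum.cong) (auto simp: id_map_def)
  then show "app I (id_map I) v j = v j" using * by (auto simp: cspace_def)
qed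

lemma Hom_eqI:
  assumes "finite I" "X \<in> Hom I J" "Y \<in> Hom I J'" "\<And>v. v \<in> cspace I \<Longrightarrow> app I X v = app I Y v"
  shows "X = Y"
proof (intro ext)
  fix j i
  show "X j i = Y j i"
  proof (cases "i \<in> I")
    case True
    then show ?thesis using assms(1,4) app_unit[OF assms(1) True] unit_in_cspace[OF True]
      by metis
  qed (use assms in \<open>auto simp: Hom_def\<close>)
qed

text \<open>The columns of R are preimages of the unit vectors.\<close>

lemma surj_right_inverse:
  assumes "finite I" "finite J" "X \<in> Hom I J" "cspace J \<subseteq> app I X ` cspace I"
  obtains R where "R \<in> Hom J I" "comp_map I X R = id_map J"
proof -
  have "\<exists>v. v \<in> cspace I \<and> app I X v = unit j" if "j \<in> J" for j
    using unit_in_cspace[OF that] assms(4) by (metis imageE subsetD)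
  then obtain u where u: "\<And>j. j \<in> J \<Longrightarrow> u j \<in> cspace I \<and> app I X (u j) = unit j" by metis
  define R where "R = (\<lambda>i j. if j \<in> J then u j i else 0)"
  have "R \<in> Hom J I" using u by (auto simp: R_def Hom_def cspace_def)
  moreover have "comp_map I X R = id_map J"
  proof (intro ext)
    fix k j
    show "comp_map I X R k j = id_map J k j"
    proof (cases "j \<in> J")
      case True
      then have "comp_map I X R k j = app I X (u j) k" by (simp add: comp_map_def app_def R_def)
      then show ?thesis using u[OF True] True by (auto simp: unit_def id_map_def)
    qed (auto simp: comp_map_def R_def id_map_def)
  qed
  ultimately show thesis using that by blast
qed

text \<open>By rank and nullity a surjective g is injective. A right inverse R is then also a left
  inverse, since g maps \<open>R g v - v\<close> to 0.\<close>

lemma surj_in_GL: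
  assumes I: "finite I" and g: "g \<in> Hom I I" "cspace I \<subseteq> app I g ` cspace I"
  shows "g \<in> GL I"
proof -
  obtain R where R: "R \<in> Hom I I" "comp_map I g R = id_map I"
    using surj_right_inverse[OF I I g] by blast
  have "app I g ` cspace I = cspace I" using g app_in_cspace[OF g(1)] by blast
  then have "cvec.dim {v \<in> cspace I. app I g v = 0} = 0"
    using cpair.rank_nullity[OF clinear_app subspace_cspace findim_cspace[OF I], of I g] by simp
  then have ker: "v = 0" if "v \<in> cspace I" "app I g v = 0" for v
    using that cvec.findim_dim_zero[OF cvec.findim_subset[OF findim_cspace[OF I]], of "{v \<in> cspace I. app I g v = 0}"]
    by blast
  have "comp_map I R g = id_map I"
  proof (rule Hom_eqI[OF I comp_map_Hom[OF R(1) g(1)] id_map_Hom])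
    fix v :: "'a \<Rightarrow> complex" assume v: "v \<in> cspace I"
    have "app I g (app I (comp_map I R g) v) = app I g v"
      using I v R g by (simp add: app_comp_map[symmetric] comp_map_assoc comp_map_id_left)
    then have "app I g (app I (comp_map I R g) v - v) = 0"
      by (simp add: clinearD(5)[OF clinear_app])
    moreover have "app I (comp_map I R g) v - v \<in> cspace I"
      using v app_in_cspace[OF comp_map_Hom[OF R(1) g(1)]] cvec.subspace_diff[OF subspace_cspace] by blast
    ultimately have "app I (comp_map I R g) v - v = 0" using ker by blast
    then show "app I (comp_map I R g) v = app I (id_map I) v"
      using app_id_map[OF I v] by simp
  qed
  then show ?thesis using R g by (auto simp: GL_def is_inverse_def)
qed

lemma inverse_unique:
  assumes "finite I" "is_inverse I g h" "is_inverse I g h'"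
  shows "h = h'"
proof -
  have "h = comp_map I h (comp_map I g h')" using assms comp_map_id_right[OF assms(1), of h I] by (simp add: is_inverse_def)
  also have "\<dots> = h'" using assms comp_map_id_left[OF assms(1), of h' I] unfolding is_inverse_def by (metis comp_map_assoc)
  finally show ?thesis .
qed

lemma is_inverse_inv_map:
  assumes "finite I" "g \<in> GL I"
  shows "is_inverse I g (inv_map I g)"
proof -
  have "\<exists>!h. is_inverse I g h" using assms inverse_unique by (auto simp: GL_def)
  then show ?thesis unfolding inv_map_def by (rule theI')
qed

lemma comp_map_tensor_id:
  assumes "finite A" "a \<in> A"
  shows "comp_map (I \<times> A) x (tensor_map g (id_map A)) p (q, a) = (\<Sum>q'\<in>I. x p (q', a) * g q' q)"
proof -
  have "comp_map (I \<times> A) x (tensor_map g (id_map A)) p (q, a)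
      = (\<Sum>q'\<in>I. \<Sum>a'\<in>A. x p (q', a') * (g q' q * id_map A a' a))"
    unfolding comp_map_def tensor_map_def sum.cartesian_product by (intro sum.cong) auto
  also have "\<dots> = (\<Sum>q'\<in>I. \<Sum>a'\<in>A. if a' = a then x p (q', a) * g q' q else 0)"
    using assms by (intro sum.cong) (auto simp: id_map_def)
  finally show ?thesis using assms by simp
qed

lemma tensor_id_is_inverse:
  assumes "finite A" "is_inverse I g h" "g \<in> Hom I I"
  shows "is_inverse (I \<times> A) (tensor_map g (id_map A)) (tensor_map h (id_map A))"
proof -
  have *: "comp_map (I \<times> A) (tensor_map g (id_map A)) (tensor_map h (id_map A)) = id_map (I \<times> A)"
    if "comp_map I g h = id_map I" "h \<in> Hom I I" for g h :: "'b \<Rightarrow> 'b \<Rightarrow> complex"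
  proof (intro ext)
    fix p r :: "'b \<times> 'a"
    obtain i b q a where pr: "p = (i, b)" "r = (q, a)" by (cases p, cases r)
    show "comp_map (I \<times> A) (tensor_map g (id_map A)) (tensor_map h (id_map A)) p r = id_map (I \<times> A) p r"
    proof (cases "a \<in> A")
      case True
      have "(\<Sum>q'\<in>I. g i q' * id_map A b a * h q' q) = comp_map I g h i q * id_map A b a"
        by (simp add: comp_map_def sum_distrib_right sum_distrib_left ac_simps)
      then show ?thesis
        unfolding pr comp_map_tensor_id[OF assms(1) True] that
        using True by (auto simp: tensor_map_def id_map_def)
    qed (auto simp: pr comp_map_def tensor_map_def id_map_def intro!: sum.neutral)
  qed
  have "tensor_map h (id_map A) \<in> Hom (I \<times> A) (I \<times> A)"
    using assms by (auto simp: is_inverse_def Hom_def tensor_map_def id_map_def)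
  then show ?thesis using * assms unfolding is_inverse_def by auto
qed

text \<open>A map on the tensor product of the spaces on I and A is a family of maps indexed by A.\<close>

abbreviation (input) sl :: "('j \<Rightarrow> 'i \<times> 'a \<Rightarrow> complex) \<Rightarrow> 'a \<Rightarrow> 'j \<Rightarrow> 'i \<Rightarrow> complex" where
  "sl x a \<equiv> (\<lambda>p q. x p (q, a))"

text \<open>Moving the inverse to the other side turns the definition of the group action into
  equations without inverses, one for each basis vector of the second factor. Membership in
  \<open>Hom\<close> is stated separately because \<open>comp_map\<close> does not see the entries
  of x outside the index set.\<close>

lemma eq_comp_inv_iff:
  assumes I: "finite I" and A: "finite A" and g: "g \<in> GL I" and y: "y \<in> Hom (I \<times> A) J"
  shows "x = comp_map (I \<times> A) y (inv_map (I \<times> A) (tensor_map g (id_map A))) \<longleftrightarrow>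
    x \<in> Hom (I \<times> A) J \<and> (\<forall>a\<in>A. comp_map I (sl x a) g = sl y a)"
    (is "x = comp_map ?IA y (inv_map ?IA ?G) \<longleftrightarrow> ?R")
proof -
  obtain h where h: "is_inverse I g h" "g \<in> Hom I I" using g by (auto simp: GL_def)
  have inv: "is_inverse ?IA ?G (tensor_map h (id_map A))"
    by (rule tensor_id_is_inverse[OF A h])
  have GH: "?G \<in> Hom ?IA ?IA" using h(2) by (auto simp: Hom_def tensor_map_def id_map_def)
  have IA: "finite ?IA" using I A by simp
  have "?G \<in> GL ?IA" using GH inv unfolding GL_def by blast
  then have inv': "is_inverse ?IA ?G (inv_map ?IA ?G)" by (rule is_inverse_inv_map[OF IA])
  have *: "comp_map ?IA x ?G = y \<longleftrightarrow> (\<forall>a\<in>A. comp_map I (sl x a) g = sl y a)"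
  proof
    assume r: "\<forall>a\<in>A. comp_map I (sl x a) g = sl y a"
    show "comp_map ?IA x ?G = y"
    proof (intro ext)
      fix s :: "'a \<times> 'b" and p :: 'c
      obtain q a where s: "s = (q, a)" by (cases s)
      show "comp_map ?IA x ?G p s = y p s"
      proof (cases "a \<in> A")
        case True
        then show ?thesis using r unfolding s comp_map_tensor_id[OF A True]
          by (auto simp: comp_map_def fun_eq_iff)
      next
        case False
        then show ?thesis using y by (auto simp: s Hom_def comp_map_def tensor_map_def id_map_def intro!: sum.neutral)
      qed
    qed
  next
    assume "comp_map ?IA x ?G = y"
    then show "\<forall>a\<in>A. comp_map I (sl x a) g = sl y a"
      using comp_map_tensor_id[OF A, of _ I x g] by (auto simp: comp_map_def fun_eq_iff)
  qed
  have "x = comp_map ?IA y (inv_map ?IA ?G) \<longleftrightarrow> x \<in> Hom ?IA J \<and> comp_map ?IA x ?G = y"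
  proof
    assume x: "x = comp_map ?IA y (inv_map ?IA ?G)"
    then have "x \<in> Hom ?IA J" using inv' y by (auto simp: is_inverse_def intro: comp_map_Hom)
    moreover have "comp_map ?IA x ?G = y"
      using x inv' comp_map_id_right[OF IA y] by (simp add: is_inverse_def comp_map_assoc[symmetric])
    ultimately show "x \<in> Hom ?IA J \<and> comp_map ?IA x ?G = y" by blast
  next
    assume x: "x \<in> Hom ?IA J \<and> comp_map ?IA x ?G = y"
    then have "comp_map ?IA y (inv_map ?IA ?G) = comp_map ?IA x (comp_map ?IA ?G (inv_map ?IA ?G))"
      by (simp add: comp_map_assoc)
    then show "x = comp_map ?IA y (inv_map ?IA ?G)"
      using x inv' comp_map_id_right[OF IA, of x J] by (auto simp: is_inverse_def)
  qed
  then show ?thesis using * by blast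
qed

text \<open>The columns of X are independent. A basis of the whole space that contains them has
  exactly \<open>card M\<close> further vectors, which become the columns of the first
  block.\<close>

lemma extend_to_GL:
  fixes M :: "'m set" and S :: "'s set"
  assumes fin: "finite M" "finite S" and X: "X \<in> Hom S (M <+> S)"
    and inj: "\<And>v. v \<in> cspace S \<Longrightarrow> app S X v = 0 \<Longrightarrow> v = 0"
  obtains g where "g \<in> GL (M <+> S)" "\<And>r s. g r (Inr s) = X r s"
proof -
  let ?I = "M <+> S" and ?C = "app S X ` unit ` S"
  have I: "finite ?I" using fin by simp
  have injon: "inj_on (app S X) (cvec.span (unit ` S))"
    unfolding span_units[OF fin(2)] cpair.linear_inj_on_iff_eq_0[OF clinear_app subspace_cspace]
    using inj by blast
  have C: "cvec.independent ?C" "?C \<subseteq> cspace ?I"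
    using cpair.linear_independent_injective_image[OF clinear_app independent_units[OF fin(2)] injon]
      app_in_cspace[OF X] by auto
  obtain B where B: "?C \<subseteq> B" "B \<subseteq> cspace ?I" "cvec.independent B" "cspace ?I \<subseteq> cvec.span B"
    by (rule cvec.maximal_independent_subset_extend[OF C(2,1)])
  have "card ?C = card S"
  proof -
    have "inj_on (app S X) (unit ` S)" by (rule inj_on_subset[OF injon cvec.span_superset])
    then show ?thesis by (simp add: card_image inj_unit)
  qed
  moreover have "card B = card M + card S"
    using cvec.basis_card_eq_dim[OF B(2,4,3)] dim_cspace[OF I] fin by (simp add: card_Plus)
  moreover have finB: "finite B"
    using cvec.findim_independent_finite[OF findim_cspace[OF I] B(2,3)] .
  ultimately have "card (B - ?C) = card M" using B(1) fin by (simp add: card_Diff_subset)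
  then obtain \<beta> where \<beta>: "bij_betw \<beta> M (B - ?C)"
    using finB fin finite_same_card_bij[of M "B - ?C"] by auto
  define g where "g = (\<lambda>r. case_sum (\<lambda>m. if m \<in> M then \<beta> m r else 0) (\<lambda>s. X r s))"
  have gH: "g \<in> Hom ?I ?I"
  proof -
    have "\<beta> m r = 0" if "m \<in> M" "r \<notin> ?I" for m r
      using \<beta> that B(2) by (auto simp: bij_betw_def cspace_def)
    then show ?thesis using X by (auto simp: g_def Hom_def split: sum.splits)
  qed
  have "B \<subseteq> app ?I g ` cspace ?I"
  proof
    fix b assume b: "b \<in> B"
    show "b \<in> app ?I g ` cspace ?I"
    proof (cases "b \<in> ?C")
      case True
      then obtain s where s: "s \<in> S" "b = app S X (unit s)" by blast
      then have "app ?I g (unit (Inr s)) = b"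
        using app_unit[OF I, of "Inr s" g] app_unit[OF fin(2), of s X] by (auto simp: g_def)
      then show ?thesis using s unit_in_cspace[of "Inr s" ?I] by blast
    next
      case False
      then have "b \<in> \<beta> ` M" using \<beta> b by (simp add: bij_betw_def)
      then obtain m where m: "m \<in> M" "\<beta> m = b" by blast
      then have "app ?I g (unit (Inl m)) = b"
        using app_unit[OF I, of "Inl m" g] by (auto simp: g_def)
      then show ?thesis using m unit_in_cspace[of "Inl m" ?I] by blast
    qed
  qed
  then have "cspace ?I \<subseteq> app ?I g ` cspace ?I"
    using B(4) cvec.span_minimal[OF _ cpair.linear_subspace_image[OF clinear_app subspace_cspace]]
    by blast
  then have "g \<in> GL ?I" by (rule surj_in_GL[OF I gH])
  then show thesis using that[of g] by (simp add: g_def)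
qed

section \<open>The constants as bounds for ranks\<close>

lemma clinear_comb:
  assumes "clinear f"
  shows "f (\<lambda>i. \<Sum>a\<in>S. c a * u a i) = (\<lambda>j. \<Sum>a\<in>S. c a * f (u a) j)"
proof -
  have "(\<lambda>i. \<Sum>a\<in>S. c a * u a i) = (\<Sum>a\<in>S. (\<lambda>i. c a * u a i))"
    by (simp add: fun_eq_iff sum_fun_apply)
  then have "f (\<lambda>i. \<Sum>a\<in>S. c a * u a i) = (\<Sum>a\<in>S. f (\<lambda>i. c a * u a i))"
    by (simp only: clinearD(4)[OF assms])
  also have "\<dots> = (\<lambda>j. \<Sum>a\<in>S. c a * f (u a) j)"
    by (simp add: clinearD(2)[OF assms] fun_eq_iff sum_fun_apply)
  finally show ?thesis .
qed

lemma subspace_comb: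
  assumes "cvec.subspace U" "\<And>a. a \<in> S \<Longrightarrow> u a \<in> U"
  shows "(\<lambda>i. \<Sum>a\<in>S. c a * u a i) \<in> U"
proof -
  have "(\<Sum>a\<in>S. (\<lambda>i. c a * u a i)) \<in> U"
    using assms by (intro cvec.subspace_sum cvec.subspace_scale) auto
  moreover have "(\<Sum>a\<in>S. (\<lambda>i. c a * u a i)) = (\<lambda>i. \<Sum>a\<in>S. c a * u a i)"
    by (simp add: fun_eq_iff sum_fun_apply)
  ultimately show ?thesis by simp
qed

text \<open>The kernel K of f competes in the supremum. Its codimension is the rank of f, and \<Phi>
  vanishes on the image of \<open>K \<otimes> H\<close>, so the rank of \<Phi> is at most the
  codimension of that image. If K is the whole space, it does not compete, and \<open>zero\<close>
  makes both ranks 0.\<close>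

lemma rank_le_sup_ratio:
  fixes P :: "('i \<Rightarrow> complex) set \<Rightarrow> bool"
    and I :: "'i set" and J :: "'j set" and H :: "'c set" and d :: "'j \<Rightarrow> 'i \<times> 'c \<Rightarrow> complex"
  defines "R \<equiv> {codim (cspace J) (app (I \<times> H) d ` tensor_space K (cspace H)) / codim (cspace I) K | K.
      subspace_of K (cspace I) \<and> K \<noteq> cspace I \<and> P K}"
  assumes fin: "finite I" "finite J" "finite H" and d: "d \<in> Hom (I \<times> H) J"
    and f: "clinear f" and \<Phi>: "clinear \<Phi>"
    and kills: "\<And>v l. v \<in> cspace I \<Longrightarrow> f v = 0 \<Longrightarrow> l \<in> H \<Longrightarrow> \<Phi> (app (I \<times> H) d (tensor v (unit l))) = 0"
    and P: "P {v \<in> cspace I. f v = 0}"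
    and zero: "(\<And>v. v \<in> cspace I \<Longrightarrow> f v = 0) \<Longrightarrow> (\<And>s. s \<in> cspace J \<Longrightarrow> \<Phi> s = 0)"
  shows "real (cvec.dim (\<Phi> ` cspace J)) \<le> sup_ratio (R) * real (cvec.dim (f ` cspace I))"
proof (cases "{v \<in> cspace I. f v = 0} = cspace I")
  case True
  then have "\<Phi> ` cspace J \<subseteq> {0}" "f ` cspace I \<subseteq> {0}" using zero by auto
  moreover have "0 \<in> \<Phi> ` cspace J"
    using clinearD(3)[OF \<Phi>] cvec.subspace_0[OF subspace_cspace] by (metis image_eqI)
  moreover have "0 \<in> f ` cspace I"
    using clinearD(3)[OF f] cvec.subspace_0[OF subspace_cspace] by (metis image_eqI)
  ultimately have "\<Phi> ` cspace J = {0}" "f ` cspace I = {0}" by auto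
  then show ?thesis by (simp add: cvec.dim_zero_space)
next
  case False
  let ?K = "{v \<in> cspace I. f v = 0}"
  let ?S = "\<lambda>K. app (I \<times> H) d ` tensor_space K (cspace H)"
  have fdI: "cvec.findim (cspace I)" and fdJ: "cvec.findim (cspace J)"
    using findim_cspace fin by auto
  have K: "cvec.subspace ?K"
    using clinearD[OF f] cvec.subspace_0[OF subspace_cspace] cvec.subspace_add[OF subspace_cspace]
      cvec.subspace_scale[OF subspace_cspace]
    by (intro csubspaceI) auto
  have rf: "codim (cspace I) ?K = real (cvec.dim (f ` cspace I))"
    using cpair.rank_nullity[OF f subspace_cspace fdI] by (simp add: codim_def)
  have codim1: "codim (cspace I) K \<ge> 1" if "subspace_of K (cspace I)" "K \<noteq> cspace I" for K
  proof -
    have "cvec.dim K < cvec.dim (cspace I)"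
      using that cvec.findim_subspace_eq[OF fdI, of K] by (metis not_le subspace_of_def)
    then show ?thesis by (simp add: codim_def)
  qed
  have "?S ?K \<subseteq> {s \<in> cspace J. \<Phi> s = 0}"
  proof
    fix s assume "s \<in> ?S ?K"
    then obtain t where t: "t \<in> tensor_space ?K (cspace H)" "s = app (I \<times> H) d t" by blast
    have "\<Phi> (app (I \<times> H) d t) = 0"
      using t(1) unfolding tensor_space_def
    proof (rule cpair.linear_eq_0_on_span[OF clinear_compose[OF \<Phi> clinear_app], rotated])
      fix x assume "x \<in> {tensor u v |u v. u \<in> ?K \<and> v \<in> cspace H}"
      then obtain u v where x: "x = tensor u v" "u \<in> ?K" "v \<in> cspace H" by blast
      \<comment> \<open>The hypothesis \<open>kills\<close> concerns unit vectors only, so the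
        second factor is expanded.\<close>
      have "x = (\<lambda>i. \<Sum>l\<in>H. v l * tensor u (unit l) i)"
      proof
        fix i :: "'i \<times> 'c"
        obtain p j where i: "i = (p, j)" by (cases i)
        have "v j = (\<Sum>l\<in>H. v l * unit l j)"
          by (subst cspace_expand[OF fin(3) x(3)]) (simp add: sum_fun_apply)
        then have "u p * v j = u p * (\<Sum>l\<in>H. v l * unit l j)" by (rule arg_cong)
        also have "\<dots> = (\<Sum>l\<in>H. v l * tensor u (unit l) i)"
          by (simp add: tensor_def i sum_distrib_left mult.left_commute)
        finally show "x i = (\<Sum>l\<in>H. v l * tensor u (unit l) i)"
          by (simp add: x(1) i tensor_def)
      qed
      then have "\<Phi> (app (I \<times> H) d x) = (\<lambda>j. \<Sum>l\<in>H. v l * \<Phi> (app (I \<times> H) d (tensor u (unit l))) j)"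
        using clinear_comb[OF clinear_compose[OF \<Phi> clinear_app]] by simp
      then show "\<Phi> (app (I \<times> H) d x) = 0" using kills[of u] x(2) by (simp add: zero_fun_def)
    qed
    then show "s \<in> {s \<in> cspace J. \<Phi> s = 0}" using t app_in_cspace[OF d] by simp
  qed
  then have "cvec.dim (?S ?K) \<le> cvec.dim {s \<in> cspace J. \<Phi> s = 0}"
    by (rule cvec.findim_dim_mono[OF cvec.findim_subset[OF fdJ], rotated]) blast
  then have rk: "real (cvec.dim (\<Phi> ` cspace J)) \<le> codim (cspace J) (?S ?K)"
    using cpair.rank_nullity[OF \<Phi> subspace_cspace fdJ] by (simp add: codim_def)
  \<comment> \<open>A supremum of reals is an upper bound only for a set that is bounded above.
    Proper subspaces have codimension at least 1, so every ratio is at most the dimension of the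
    target.\<close>
  have bdd: "bdd_above (R)"
  proof (rule bdd_aboveI)
    fix x assume "x \<in> R"
    then obtain K where K: "subspace_of K (cspace I)" "K \<noteq> cspace I"
      "x = codim (cspace J) (?S K) / codim (cspace I) K" unfolding R_def by blast
    have "cvec.dim (?S K) \<le> cvec.dim (cspace J)"
      using app_in_cspace[OF d] by (intro cvec.findim_dim_mono[OF fdJ]) blast
    then have "0 \<le> codim (cspace J) (?S K)" "codim (cspace J) (?S K) \<le> real (cvec.dim (cspace J))"
      by (auto simp: codim_def)
    then show "x \<le> real (cvec.dim (cspace J))"
      unfolding K(3) using codim1[OF K(1,2)]
      by (smt (verit) div_by_1 frac_le)
  qed
  have "codim (cspace J) (?S ?K) / codim (cspace I) ?K \<in> R"
    unfolding R_def using K False P by (auto simp: subspace_of_def)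
  then have "codim (cspace J) (?S ?K) / codim (cspace I) ?K \<le> sup_ratio (R)"
    using cSup_upper[OF _ bdd] unfolding sup_ratio_def by auto
  moreover have "codim (cspace I) ?K \<ge> 1"
    using codim1 K False by (auto simp: subspace_of_def)
  ultimately show ?thesis using rk rf by (simp add: field_simps)
qed

section \<open>Maps on tensor products as families of maps\<close>

text \<open>In terms of tensors, \<open>blk\<close> assembles a map from its restrictions to the
  slices, \<open>slot a u\<close> is the pure tensor of u with the unit vector at a, and
  \<open>pmap p\<close> is p tensored with the identity.\<close>

definition blk :: "'a set \<Rightarrow> ('a \<Rightarrow> ('m \<Rightarrow> complex) \<Rightarrow> 'p \<Rightarrow> complex) \<Rightarrow> ('m \<times> 'a \<Rightarrow> complex) \<Rightarrow> 'p \<Rightarrow> complex" where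
  "blk A G t = (\<Sum>a\<in>A. G a (\<lambda>m. t (m, a)))"

definition slot :: "'a \<Rightarrow> ('m \<Rightarrow> complex) \<Rightarrow> 'm \<times> 'a \<Rightarrow> complex" where
  "slot a u = (\<lambda>(m, b). if b = a then u m else 0)"

definition pmap :: "(('m \<Rightarrow> complex) \<Rightarrow> 'm \<Rightarrow> complex) \<Rightarrow> ('m \<times> 'a \<Rightarrow> complex) \<Rightarrow> 'm \<times> 'a \<Rightarrow> complex" where
  "pmap p t = (\<lambda>(m, a). p (\<lambda>m. t (m, a)) m)"

text \<open>The identity tensored with the matrix X. For X = \<open>act_32 D l\<close> this is the
  pairing with the basis vector l of the dual of \<open>H\<^sub>1\<^sub>2\<close>; for X =
  \<open>mulA D a\<close> it is the multiplication by the basis vector a of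
  \<open>A\<^sub>2\<^sub>1\<close>.\<close>

definition contract :: "'a set \<Rightarrow> ('j \<times> 'a \<Rightarrow> complex) \<Rightarrow> ('m \<times> 'a \<Rightarrow> complex) \<Rightarrow> 'm \<times> 'j \<Rightarrow> complex" where
  "contract A X t = (\<lambda>(m, j). \<Sum>a\<in>A. X (j, a) * t (m, a))"

lemma slice_pmap: "(\<lambda>m. pmap p t (m, a)) = p (\<lambda>m. t (m, a))"
  by (simp add: pmap_def)

lemma slice_slot: "(\<lambda>m. slot a u (m, b)) = (if b = a then u else 0)"
  by (auto simp: slot_def)

lemma slice_contract: "(\<lambda>m. contract A X t (m, j)) = (\<lambda>m. \<Sum>a\<in>A. X (j, a) * t (m, a))"
  by (simp add: contract_def)

lemma clinear_blk:
  assumes "\<And>a. a \<in> A \<Longrightarrow> clinear (G a)"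
  shows "clinear (blk A G)"
  unfolding blk_def by (rule clinear_sum, rule clinear_compose[OF assms clinear_reindex])

lemma clinear_pmap: "clinear p \<Longrightarrow> clinear (pmap p)"
  by (auto simp: clinear_iff pmap_def fun_eq_iff plus_fun_def)

lemma blk_slot:
  assumes "finite A" "a \<in> A" "\<And>a. a \<in> A \<Longrightarrow> clinear (G a)"
  shows "blk A G (slot a u) = G a u"
proof -
  have "blk A G (slot a u) = (\<Sum>b\<in>A. if b = a then G b u else 0)"
    unfolding blk_def slice_slot using clinearD(3)[OF assms(3)] by (intro sum.cong) auto
  then show ?thesis using assms by simp
qed

lemma slot_in: "cvec.subspace U \<Longrightarrow> u \<in> U \<Longrightarrow> a \<in> A \<Longrightarrow> slot a u \<in> slices_in A U"
  unfolding slices_in_def by (auto simp: slice_slot cvec.subspace_0) (auto simp: slot_def)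

lemma slices_inD: "t \<in> slices_in A U \<Longrightarrow> a \<in> A \<Longrightarrow> (\<lambda>m. t (m, a)) \<in> U"
  by (auto simp: slices_in_def)

lemma slices_inI:
  "(\<And>a. a \<in> A \<Longrightarrow> (\<lambda>m. t (m, a)) \<in> U) \<Longrightarrow> (\<And>m a. a \<notin> A \<Longrightarrow> t (m, a) = 0) \<Longrightarrow> t \<in> slices_in A U"
  by (auto simp: slices_in_def)

lemma pmap_in:
  assumes "clinear p" "range p \<subseteq> F" "t \<in> slices_in A U"
  shows "pmap p t \<in> slices_in A F"
proof (rule slices_inI)
  fix m a assume "a \<notin> A"
  then have "(\<lambda>m. t (m, a)) = 0" using assms(3) by (auto simp: slices_in_def)
  then show "pmap p t (m, a) = 0" using clinearD(3)[OF assms(1)] by (simp add: pmap_def)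
qed (use assms in \<open>auto simp: slice_pmap\<close>)

lemma pmap_fixes:
  assumes "clinear p" "\<forall>v\<in>F. p v = v" "t \<in> slices_in A F"
  shows "pmap p t = t"
proof
  fix x :: "'a \<times> 'b"
  obtain m a where x: "x = (m, a)" by (cases x)
  show "pmap p t x = t x"
  proof (cases "a \<in> A")
    case True
    then show ?thesis using bspec[OF assms(2) slices_inD[OF assms(3) True]] by (simp add: pmap_def x)
  next
    case False
    then have "(\<lambda>m. t (m, a)) = 0" using assms(3) by (auto simp: slices_in_def)
    then show ?thesis using clinearD(3)[OF assms(1)] fun_cong[of "\<lambda>m. t (m, a)" 0 m]
      by (simp add: pmap_def x)
  qed
qed

lemma contract_pmap: "clinear p \<Longrightarrow> contract A X (pmap p t) = pmap p (contract A X t)"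
  by (auto simp: fun_eq_iff pmap_def contract_def clinear_comb[of p])

lemma contract_in:
  assumes "cvec.subspace U" "t \<in> slices_in A U" "\<And>j a. j \<notin> J \<Longrightarrow> X (j, a) = 0"
  shows "contract A X t \<in> slices_in J U"
proof (rule slices_inI)
  show "(\<lambda>m. contract A X t (m, j)) \<in> U" for j
    unfolding slice_contract using assms slices_inD by (intro subspace_comb) auto
  show "contract A X t (m, j) = 0" if "j \<notin> J" for m j
    using assms(3)[OF that] by (simp add: contract_def)
qed

text \<open>The first hypothesis is a factorization of \<Psi> after G through \<Phi>, one basis
  vector of A at a time. Interchanging two sums carries it over to tensors, the form in which it
  acts on kernels and images.\<close>

lemma blk_contract:
  assumes G: "\<And>a v. a \<in> A \<Longrightarrow> v \<in> U \<Longrightarrow> \<Psi> (G a v) = (\<lambda>n. \<Sum>j\<in>J. X (j, a) * \<Phi> j v n)"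
    and lin: "clinear \<Psi>" "\<And>j. j \<in> J \<Longrightarrow> clinear (\<Phi> j)" and t: "t \<in> slices_in A U"
  shows "blk J \<Phi> (contract A X t) = \<Psi> (blk A G t)"
proof -
  have "blk J \<Phi> (contract A X t) n = \<Psi> (blk A G t) n" for n
  proof -
    have "blk J \<Phi> (contract A X t) n = (\<Sum>j\<in>J. \<Sum>a\<in>A. X (j, a) * \<Phi> j (\<lambda>m. t (m, a)) n)"
      by (simp add: blk_def sum_fun_apply slice_contract clinear_comb[OF lin(2)])
    also have "\<dots> = (\<Sum>a\<in>A. \<Psi> (G a (\<lambda>m. t (m, a))) n)"
      using G slices_inD[OF t] by (subst sum.swap) simp
    also have "\<dots> = \<Psi> (blk A G t) n"
      by (simp add: blk_def clinearD(4)[OF lin(1)] sum_fun_apply)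
    finally show ?thesis .
  qed
  then show ?thesis by blast
qed

text \<open>The induced map is onto, so the unit vector at j is a combination of images of basis
  vectors, and \<open>\<Phi> j\<close> is the same combination of the sums in \<open>rel\<close>.
  This settles the case in which the kernel is everything, and it allows an identity to be tested
  after composition with \<open>A\<^sub>2\<^sub>1\<close> in \<open>relations_D\<close>.\<close>

lemma blk_dual_zero:
  assumes fin: "finite A" "finite L" "finite J"
    and surj: "surj_map (A \<times> L) J (dual_act X)" "X \<in> Hom (J \<times> A) L"
    and rel: "\<And>a l. a \<in> A \<Longrightarrow> l \<in> L \<Longrightarrow> (\<lambda>n. \<Sum>j\<in>J. X l (j, a) * \<Phi> j n) = 0"
    and j: "j \<in> J"
  shows "\<Phi> j = (0 :: 'n \<Rightarrow> complex)"
proof -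
  have dual: "dual_act X \<in> Hom (A \<times> L) J"
    using surj(2) by (auto simp: Hom_def dual_act_def)
  obtain R where R: "R \<in> Hom J (A \<times> L)" "comp_map (A \<times> L) (dual_act X) R = id_map J"
    using surj_right_inverse[OF _ fin(3) dual] surj(1) fin unfolding surj_map_def by auto
  have "\<Phi> j n = 0" for n
  proof -
    have "\<Phi> j n = (\<Sum>i\<in>J. id_map J i j * \<Phi> i n)"
    proof -
      have "(\<Sum>i\<in>J. id_map J i j * \<Phi> i n) = (\<Sum>i\<in>J. if i = j then \<Phi> i n else 0)"
        by (intro sum.cong) (auto simp: id_map_def)
      then show ?thesis using fin j by simp
    qed
    also have "\<dots> = (\<Sum>i\<in>J. \<Sum>s\<in>A \<times> L. R s j * (dual_act X i s * \<Phi> i n))"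
      unfolding R(2)[symmetric] comp_map_def sum_distrib_right
      by (intro sum.cong refl) (simp add: mult_ac)
    also have "\<dots> = (\<Sum>s\<in>A \<times> L. R s j * (\<Sum>i\<in>J. dual_act X i s * \<Phi> i n))"
      by (subst sum.swap) (simp add: sum_distrib_left)
    also have "\<dots> = 0"
    proof (intro sum.neutral ballI)
      fix s assume "s \<in> A \<times> L"
      then obtain a l where s: "s = (a, l)" "a \<in> A" "l \<in> L" by blast
      show "R s j * (\<Sum>i\<in>J. dual_act X i s * \<Phi> i n) = 0"
        using fun_cong[OF rel[OF s(2,3)], of n] by (simp add: s(1) dual_act_def)
    qed
    finally show ?thesis .
  qed
  then show ?thesis by (auto simp: fun_eq_iff)
qed

lemma app_tensor_unit:
  assumes "finite I" "finite H" "l \<in> H"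
  shows "app (I \<times> H) X (tensor t (unit l)) r = (\<Sum>p\<in>I. X r (p, l) * t p)"
proof -
  have "app (I \<times> H) X (tensor t (unit l)) r = (\<Sum>p\<in>I. \<Sum>l'\<in>H. X r (p, l') * (t p * unit l l'))"
    unfolding app_def tensor_def sum.cartesian_product by (intro sum.cong) auto
  also have "\<dots> = (\<Sum>p\<in>I. \<Sum>l'\<in>H. if l' = l then X r (p, l) * t p else 0)"
    by (intro sum.cong) (auto simp: unit_def)
  finally show ?thesis using assms by simp
qed

lemma sum_id_map_block:
  assumes "finite M" "t \<in> cspace (M \<times> A)"
  shows "(\<Sum>(m, a)\<in>M \<times> A. id_map M m' m * X a * t (m, a)) = (\<Sum>a\<in>A. X a * t (m', a))"
proof -
  have "(\<Sum>(m, a)\<in>M \<times> A. id_map M m' m * X a * t (m, a)) = (\<Sum>m\<in>M. \<Sum>a\<in>A. id_map M m' m * X a * t (m, a))"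
    by (simp add: sum.cartesian_product)
  also have "\<dots> = (\<Sum>m\<in>M. if m = m' then \<Sum>a\<in>A. X a * t (m', a) else 0)"
    by (intro sum.cong) (auto simp: id_map_def)
  also have "\<dots> = (\<Sum>a\<in>A. X a * t (m', a))"
    using assms by (auto simp: cspace_def)
  finally show ?thesis .
qed

text \<open>Rewrites the map in the definition of \<open>c3'\<close> as a contraction, to which
  \<open>blk_contract\<close> applies; \<open>app_delta1\<close> does the same for
  \<open>c1\<close>.\<close>

lemma app_tau:
  assumes "t \<in> cspace ({..<m3} \<times> {..<a32 D})" "l < h12 D"
  shows "app (({..<m3} \<times> {..<a32 D}) \<times> {..<h12 D}) (tau D m3) (tensor t (unit l))
    = contract {..<a32 D} (act_32 D l) t"
proof
  fix r :: "nat \<times> nat"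
  obtain m j where r: "r = (m, j)" by (cases r)
  have "app (({..<m3} \<times> {..<a32 D}) \<times> {..<h12 D}) (tau D m3) (tensor t (unit l)) r
      = (\<Sum>p\<in>{..<m3} \<times> {..<a32 D}. tau D m3 r (p, l) * t p)"
    using assms(2) by (intro app_tensor_unit) auto
  also have "\<dots> = (\<Sum>(m', a)\<in>{..<m3} \<times> {..<a32 D}. id_map {..<m3} m m' * act_32 D l (j, a) * t (m', a))"
    by (intro sum.cong) (auto simp: tau_def r dual_act_def)
  also have "\<dots> = contract {..<a32 D} (act_32 D l) t r"
    unfolding sum_id_map_block[OF finite_lessThan assms(1)] by (simp add: contract_def r)
  finally show "app (({..<m3} \<times> {..<a32 D}) \<times> {..<h12 D}) (tau D m3) (tensor t (unit l)) r
    = contract {..<a32 D} (act_32 D l) t r" .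
qed

lemma cspace_Plus:
  "t \<in> cspace (A <+> B) \<longleftrightarrow> (\<lambda>x. t (Inl x)) \<in> cspace A \<and> (\<lambda>x. t (Inr x)) \<in> cspace B"
  unfolding cspace_def mem_Collect_eq by (auto simp: split_sum_all)

lemma sum_space_iff:
  "t \<in> sum_space U V \<longleftrightarrow> (\<lambda>x. t (Inl x)) \<in> U \<and> (\<lambda>x. t (Inr x)) \<in> V"
proof -
  have "t = case_sum (\<lambda>x. t (Inl x)) (\<lambda>x. t (Inr x))"
    by (auto simp: fun_eq_iff split: sum.splits)
  then show ?thesis unfolding sum_space_def by force
qed

lemma app_delta1:
  assumes t: "t \<in> cspace ({..<k} \<times> {..<a21 D} <+> {..<m3} \<times> {..<a31 D})" and l: "l < h11 D"
  shows "app (({..<k} \<times> {..<a21 D} <+> {..<m3} \<times> {..<a31 D}) \<times> {..<h11 D}) (delta1 D k m3) (tensor t (unit l))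
    = case_sum (contract {..<a21 D} (act_21 D l) (\<lambda>x. t (Inl x))) (contract {..<a31 D} (act_31 D l) (\<lambda>x. t (Inr x)))"
    (is "app (?I \<times> ?H) _ _ = ?R")
proof
  fix r :: "nat \<times> nat + nat \<times> nat"
  have t': "(\<lambda>x. t (Inl x)) \<in> cspace ({..<k} \<times> {..<a21 D})" "(\<lambda>x. t (Inr x)) \<in> cspace ({..<m3} \<times> {..<a31 D})"
    using t by (simp_all add: cspace_Plus)
  have "app (?I \<times> ?H) (delta1 D k m3) (tensor t (unit l)) r = (\<Sum>p\<in>?I. delta1 D k m3 r (p, l) * t p)"
    using l by (intro app_tensor_unit) auto
  also have "\<dots> = (\<Sum>p\<in>{..<k} \<times> {..<a21 D}. delta1 D k m3 r (Inl p, l) * t (Inl p))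
      + (\<Sum>p\<in>{..<m3} \<times> {..<a31 D}. delta1 D k m3 r (Inr p, l) * t (Inr p))"
    by (subst sum.Plus) auto
  also have "\<dots> = ?R r"
  proof (cases r)
    case (Inl s)
    then obtain m j where r: "r = Inl (m, j)" by (cases s) auto
    have "(\<Sum>p\<in>{..<k} \<times> {..<a21 D}. delta1 D k m3 r (Inl p, l) * t (Inl p))
        = (\<Sum>(m', a)\<in>{..<k} \<times> {..<a21 D}. id_map {..<k} m m' * act_21 D l (j, a) * t (Inl (m', a)))"
      by (intro sum.cong) (auto simp: delta1_def r dual_act_def)
    also have "\<dots> = ?R r"
      unfolding sum_id_map_block[OF finite_lessThan t'(1)] by (simp add: contract_def r)
    moreover have "(\<Sum>p\<in>{..<m3} \<times> {..<a31 D}. delta1 D k m3 r (Inr p, l) * t (Inr p)) = 0"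
      by (intro sum.neutral) (auto simp: delta1_def r)
    ultimately show ?thesis by simp
  next
    case (Inr s)
    then obtain m j where r: "r = Inr (m, j)" by (cases s) auto
    have "(\<Sum>p\<in>{..<m3} \<times> {..<a31 D}. delta1 D k m3 r (Inr p, l) * t (Inr p))
        = (\<Sum>(m', a)\<in>{..<m3} \<times> {..<a31 D}. id_map {..<m3} m m' * act_31 D l (j, a) * t (Inr (m', a)))"
      by (intro sum.cong) (auto simp: delta1_def r dual_act_def)
    also have "\<dots> = ?R r"
      unfolding sum_id_map_block[OF finite_lessThan t'(2)] by (simp add: contract_def r)
    moreover have "(\<Sum>p\<in>{..<k} \<times> {..<a21 D}. delta1 D k m3 r (Inl p, l) * t (Inl p)) = 0"
      by (intro sum.neutral) (auto simp: delta1_def r)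
    ultimately show ?thesis by simp
  qed
  finally show "app (?I \<times> ?H) (delta1 D k m3) (tensor t (unit l)) r = ?R r" .
qed

lemma pmap_slot: "clinear p \<Longrightarrow> pmap p (slot a u) = slot a (p u)"
  by (auto simp: fun_eq_iff pmap_def slice_slot clinearD(3)) (auto simp: slot_def)

lemma blk_pmap: "blk A G (pmap p t) = blk A (\<lambda>a v. G a (p v)) t"
  by (simp add: blk_def slice_pmap)

lemma image_pmap:
  assumes "clinear p" "range p \<subseteq> F" "\<forall>v\<in>F. p v = v" "F \<subseteq> cspace I"
  shows "pmap p ` cspace (I \<times> A) = slices_in A F"
proof
  show "pmap p ` cspace (I \<times> A) \<subseteq> slices_in A F"
    unfolding slices_in_cspace[symmetric] using pmap_in[OF assms(1,2)] by blast
  show "slices_in A F \<subseteq> pmap p ` cspace (I \<times> A)"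
  proof
    fix t assume t: "t \<in> slices_in A F"
    then show "t \<in> pmap p ` cspace (I \<times> A)"
      using pmap_fixes[OF assms(1,3) t] slices_in_mono[OF assms(4), of A]
      unfolding slices_in_cspace by (metis image_eqI subsetD)
  qed
qed

text \<open>Every u splits into p u, which lies in F, and u - p u, which p kills.\<close>

lemma cspace_subset_of_projection:
  assumes p: "clinear p" "range p \<subseteq> F" "\<forall>v\<in>F. p v = v"
    and F: "F \<subseteq> cspace I" "F \<subseteq> U" and U: "cvec.subspace U"
    and ker: "\<And>v. v \<in> cspace I \<Longrightarrow> p v = 0 \<Longrightarrow> v \<in> U"
  shows "cspace I \<subseteq> U"
proof
  fix u assume u: "u \<in> cspace I"
  have pu: "p u \<in> F" using p(2) by blast
  then have "p u \<in> cspace I" using F(1) by blast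
  then have "u - p u \<in> U"
    using cvec.subspace_diff[OF subspace_cspace u] clinearD(5)[OF p(1)] bspec[OF p(3) pu] by (intro ker) auto
  moreover have "p u \<in> U" using pu F(2) by blast
  ultimately show "u \<in> U" using cvec.subspace_add[OF U, of "u - p u" "p u"] by simp
qed

text \<open>
  For a smaller space F in place of \<open>M\<^sub>3\<close>, the projection to F turns the restricted maps into
  maps on the whole space, with a kernel to which the definition of the constant applies.
\<close>

lemma c3'_bound:
  fixes G :: "nat \<Rightarrow> (nat \<Rightarrow> complex) \<Rightarrow> 'q \<Rightarrow> complex" and \<Phi> :: "nat \<Rightarrow> (nat \<Rightarrow> complex) \<Rightarrow> 'n \<Rightarrow> complex"
  assumes D: "composition_system D" "a32 D > 0"
    and lin: "\<And>a. clinear (G a)" "\<And>j. clinear (\<Psi> j)" "\<And>j. clinear (\<Phi> j)"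
    and rel: "\<And>a j v. a < a32 D \<Longrightarrow> j < h12 D \<Longrightarrow> v \<in> cspace {..<m3} \<Longrightarrow>
      \<Psi> j (G a v) = (\<lambda>n. \<Sum>i<h13 D. act_32 D j (i, a) * \<Phi> i v n)"
    and F: "cvec.subspace F" "F \<subseteq> cspace {..<m3}"
    and K0: "K0 \<subseteq> slices_in {..<a32 D} F" "\<And>t. t \<in> K0 \<Longrightarrow> blk {..<a32 D} G t = 0"
      "F \<subseteq> cvec.span {(\<lambda>m. t (m, a)) | t a. t \<in> K0 \<and> a < a32 D}"
  shows "real (cvec.dim (blk {..<h13 D} \<Phi> ` slices_in {..<h13 D} F))
    \<le> c3' D m3 * real (cvec.dim (blk {..<a32 D} G ` slices_in {..<a32 D} F))"
proof -
  let ?A = "{..<a32 D}" and ?J = "{..<h13 D}" and ?H = "{..<h12 D}"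
  let ?I = "{..<m3} \<times> ?A" and ?T = "{..<m3} \<times> ?J"
  obtain p where p: "clinear p" "range p \<subseteq> F" "\<forall>v\<in>F. p v = v"
    using cvec.exists_projection[OF F(1)] by blast
  define f where "f = (\<lambda>t. blk ?A G (pmap p t))"
  define g where "g = (\<lambda>t. blk ?J \<Phi> (pmap p t))"
  have act: "act_32 D \<in> Hom ({..<h13 D} \<times> {..<a32 D}) {..<h12 D}"
    "surj_map ({..<a32 D} \<times> {..<h12 D}) {..<h13 D} (dual_act (act_32 D))"
    using D unfolding composition_system_def by auto
  have linf: "clinear f" and ling: "clinear g"
    unfolding f_def g_def by (intro clinear_compose[OF clinear_blk[OF lin(1)] clinear_pmap[OF p(1)]]
      clinear_compose[OF clinear_blk[OF lin(3)] clinear_pmap[OF p(1)]])+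
  have fimage: "f ` cspace ?I = blk ?A G ` slices_in ?A F" and gimage: "g ` cspace ?T = blk ?J \<Phi> ` slices_in ?J F"
    using image_pmap[OF p F(2), of ?A] image_pmap[OF p F(2), of ?J]
    by (simp_all add: f_def g_def image_image flip: image_pmap[OF p F(2)])
  have pF: "p v \<in> F" for v using p(2) by blast
  have pc: "p v \<in> cspace {..<m3}" for v using p(2) F(2) by blast
  have "real (cvec.dim (g ` cspace ?T)) \<le> c3' D m3 * real (cvec.dim (f ` cspace ?I))"
    unfolding c3'_def Let_def
  proof (rule rank_le_sup_ratio[where \<Phi> = g and f = f])
    show "tau D m3 \<in> Hom (?I \<times> ?H) ?T"
      using HomD[OF act(1)] by (auto simp: Hom_def tau_def id_map_def dual_act_def)
  next
    fix v l assume v: "v \<in> cspace ?I" "f v = 0" "l \<in> ?H"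
    have "g (app (?I \<times> ?H) (tau D m3) (tensor v (unit l))) = blk ?J \<Phi> (contract ?A (act_32 D l) (pmap p v))"
      using v by (simp add: g_def app_tau contract_pmap[OF p(1)])
    also have "\<dots> = \<Psi> l (f v)"
      unfolding f_def
    proof (rule blk_contract[where U = "cspace {..<m3}"])
      show "pmap p v \<in> slices_in ?A (cspace {..<m3})"
        using v(1) pc unfolding slices_in_cspace[symmetric]
        by (intro pmap_in[OF p(1)]) auto
    qed (use rel v lin in auto)
    finally show "g (app (?I \<times> ?H) (tau D m3) (tensor v (unit l))) = 0"
      using v clinearD(3)[OF lin(2)] by simp
  next
    let ?K = "{v \<in> cspace ?I. f v = 0}"
    have "U = cspace {..<m3}" if U: "subspace_of U (cspace {..<m3})" "?K \<subseteq> tensor_space U (cspace ?A)" for U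
    proof -
      have Us: "cvec.subspace U" "U \<subseteq> cspace {..<m3}" using U(1) by (auto simp: subspace_of_def)
      have K: "?K \<subseteq> slices_in ?A U" using U(2) unfolding tensor_space_eq_slices_in[OF Us(1) finite_lessThan] .
      \<comment> \<open>The projection fixes tensors over F, so f agrees with the original map on
        K0.\<close>
      have "K0 \<subseteq> ?K"
      proof
        fix t assume t: "t \<in> K0"
        then have "pmap p t = t" using pmap_fixes[OF p(1,3)] K0(1) by blast
        moreover have "t \<in> cspace ?I"
          using t K0(1) slices_in_mono[OF F(2), of ?A] unfolding slices_in_cspace by blast
        ultimately show "t \<in> ?K" using K0(2)[OF t] by (simp add: f_def)
      qed
      then have "t \<in> slices_in ?A U" if "t \<in> K0" for t using K that by blast
      then have "{(\<lambda>m. t (m, a)) | t a. t \<in> K0 \<and> a < a32 D} \<subseteq> U"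
        using slices_inD[of _ ?A U] by auto
      then have FU: "F \<subseteq> U" using K0(3) cvec.span_minimal[OF _ Us(1)] by blast
      have "cspace {..<m3} \<subseteq> U"
      proof (rule cspace_subset_of_projection[OF p F(2) FU Us(1)])
        fix v assume v: "v \<in> cspace {..<m3}" "p v = 0"
        \<comment> \<open>The tensor of v with a basis vector of \<open>A\<^sub>3\<^sub>2\<close>
          lies in the kernel of f because p kills v. The index 0 is available since
          \<open>a32 D > 0\<close>.\<close>
        have "slot 0 v \<in> slices_in ?A (cspace {..<m3})" using slot_in[OF subspace_cspace v(1), of 0 ?A] D(2) by simp
        moreover have "f (slot 0 v) = 0"
          using D(2) blk_slot[of ?A 0 G] lin clinearD(3)[OF lin(1)] by (simp add: f_def pmap_slot[OF p(1)] v(2))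
        ultimately have "slot 0 v \<in> slices_in ?A U" using K by (auto simp: slices_in_cspace)
        then show "v \<in> U" using slices_inD[of "slot 0 v" ?A U 0] D(2) by (simp add: slice_slot)
      qed
      then show ?thesis using Us by blast
    qed
    then show "\<forall>U. subspace_of U (cspace {..<m3}) \<and> U \<noteq> cspace {..<m3} \<longrightarrow> \<not> ?K \<subseteq> tensor_space U (cspace ?A)"
      by blast
  next
    fix s assume f0: "\<And>v. v \<in> cspace ?I \<Longrightarrow> f v = 0" and s: "s \<in> cspace ?T"
    \<comment> \<open>Vanishing of f on pure tensors gives \<open>G a (p v) = 0\<close>; the
      relation and the surjectivity onto the dual of \<open>H\<^sub>1\<^sub>3\<close> then kill
      \<Phi>.\<close>
    have "\<Phi> j (p v) = 0" if "j < h13 D" "v \<in> cspace {..<m3}" for j v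
    proof (rule blk_dual_zero[OF _ _ _ act(2,1), of "\<lambda>j. \<Phi> j (p v)"])
      fix a l assume al: "a \<in> ?A" "l \<in> ?H"
      have "slot a v \<in> cspace ?I"
        using slot_in[OF subspace_cspace that(2) al(1)] by (simp add: slices_in_cspace)
      then have "G a (p v) = 0"
        using f0[of "slot a v"] al lin by (simp add: f_def pmap_slot[OF p(1)] blk_slot)
      then show "(\<lambda>n. \<Sum>j\<in>?J. act_32 D l (j, a) * \<Phi> j (p v) n) = 0"
        using rel[of a l "p v"] pc al clinearD(3)[OF lin(2)] by simp
    qed (use that in auto)
    moreover have "(\<lambda>m. s (m, j)) \<in> cspace {..<m3}" for j using s by (auto simp: cspace_def)
    ultimately show "g s = 0" unfolding g_def blk_def slice_pmap by simp
  qed (use linf ling in auto)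
  then show ?thesis unfolding fimage gimage .
qed

definition blk2 ::
    "'a set \<Rightarrow> ('a \<Rightarrow> ('m \<Rightarrow> complex) \<Rightarrow> 'p \<Rightarrow> complex) \<Rightarrow> 'b set \<Rightarrow> ('b \<Rightarrow> ('k \<Rightarrow> complex) \<Rightarrow> 'p \<Rightarrow> complex)
      \<Rightarrow> ('m \<times> 'a + 'k \<times> 'b \<Rightarrow> complex) \<Rightarrow> 'p \<Rightarrow> complex" where
  "blk2 A G B G' t = blk A G (\<lambda>x. t (Inl x)) + blk B G' (\<lambda>x. t (Inr x))"

lemma clinear_blk2:
  assumes "\<And>a. a \<in> A \<Longrightarrow> clinear (G a)" "\<And>b. b \<in> B \<Longrightarrow> clinear (G' b)"
  shows "clinear (blk2 A G B G')"
proof -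
  have "clinear (\<lambda>t. blk A G (\<lambda>x. t (Inl x)))"
    by (rule clinear_compose[OF clinear_blk[OF assms(1)] clinear_reindex])
  moreover have "clinear (\<lambda>t. blk B G' (\<lambda>x. t (Inr x)))"
    by (rule clinear_compose[OF clinear_blk[OF assms(2)] clinear_reindex])
  ultimately show ?thesis unfolding blk2_def by (rule clinear_add)
qed

text \<open>Compatibility with \<open>delta1\<close> in the shape produced by
  \<open>app_delta1\<close>. It shows that the map to \<open>N\<^sub>1\<close> kills what a kernel
  generates, and later that the families of subspaces are invariant.\<close>

lemma blk2_delta1:
  fixes G2 :: "nat \<Rightarrow> (nat \<Rightarrow> complex) \<Rightarrow> 'p \<Rightarrow> complex" and G3 :: "nat \<Rightarrow> (nat \<Rightarrow> complex) \<Rightarrow> 'p \<Rightarrow> complex"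
    and \<Phi>2 :: "nat \<Rightarrow> (nat \<Rightarrow> complex) \<Rightarrow> 'n \<Rightarrow> complex" and \<Phi>3 :: "nat \<Rightarrow> (nat \<Rightarrow> complex) \<Rightarrow> 'n \<Rightarrow> complex"
  assumes lin: "\<And>l. clinear (\<Psi> l)" "\<And>j. clinear (\<Phi>2 j)" "\<And>j. clinear (\<Phi>3 j)"
    and rel2: "\<And>a l v. a < a21 D \<Longrightarrow> l < h11 D \<Longrightarrow> v \<in> cspace {..<k} \<Longrightarrow>
      \<Psi> l (G2 a v) = (\<lambda>n. \<Sum>i<h12 D. act_21 D l (i, a) * \<Phi>2 i v n)"
    and rel3: "\<And>a l v. a < a31 D \<Longrightarrow> l < h11 D \<Longrightarrow> v \<in> cspace {..<m3} \<Longrightarrow>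
      \<Psi> l (G3 a v) = (\<lambda>n. \<Sum>i<h13 D. act_31 D l (i, a) * \<Phi>3 i v n)"
    and l: "l < h11 D" and t: "t \<in> cspace ({..<k} \<times> {..<a21 D} <+> {..<m3} \<times> {..<a31 D})"
  shows "blk2 {..<h12 D} \<Phi>2 {..<h13 D} \<Phi>3
      (case_sum (contract {..<a21 D} (act_21 D l) (\<lambda>x. t (Inl x))) (contract {..<a31 D} (act_31 D l) (\<lambda>x. t (Inr x))))
    = \<Psi> l (blk2 {..<a21 D} G2 {..<a31 D} G3 t)"
proof -
  have "blk {..<h12 D} \<Phi>2 (contract {..<a21 D} (act_21 D l) (\<lambda>x. t (Inl x))) = \<Psi> l (blk {..<a21 D} G2 (\<lambda>x. t (Inl x)))"
    using t l lin rel2 unfolding cspace_Plus slices_in_cspace[symmetric]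
    by (intro blk_contract[where U = "cspace {..<k}"]) auto
  moreover have "blk {..<h13 D} \<Phi>3 (contract {..<a31 D} (act_31 D l) (\<lambda>x. t (Inr x))) = \<Psi> l (blk {..<a31 D} G3 (\<lambda>x. t (Inr x)))"
    using t l lin rel3 unfolding cspace_Plus slices_in_cspace[symmetric]
    by (intro blk_contract[where U = "cspace {..<m3}"]) auto
  ultimately show ?thesis by (simp add: blk2_def clinearD(1)[OF lin(1)])
qed

text \<open>The argument of \<open>c3'_bound\<close> with two blocks. Projections p to F2 and q to
  F3 extend the restricted maps to the full spaces; tensors over the kernels of p and q enlarge the
  kernel so that no smaller pair of subspaces accommodates it.\<close>

lemma c1_bound:
  fixes G2 :: "nat \<Rightarrow> (nat \<Rightarrow> complex) \<Rightarrow> 'p \<Rightarrow> complex" and G3 :: "nat \<Rightarrow> (nat \<Rightarrow> complex) \<Rightarrow> 'p \<Rightarrow> complex"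
    and \<Phi>2 :: "nat \<Rightarrow> (nat \<Rightarrow> complex) \<Rightarrow> 'n \<Rightarrow> complex" and \<Phi>3 :: "nat \<Rightarrow> (nat \<Rightarrow> complex) \<Rightarrow> 'n \<Rightarrow> complex"
  assumes D: "composition_system D" "a21 D > 0" "a31 D > 0"
    and lin: "\<And>a. clinear (G2 a)" "\<And>a. clinear (G3 a)" "\<And>l. clinear (\<Psi> l)"
      "\<And>j. clinear (\<Phi>2 j)" "\<And>j. clinear (\<Phi>3 j)"
    and rel2: "\<And>a l v. a < a21 D \<Longrightarrow> l < h11 D \<Longrightarrow> v \<in> cspace {..<k} \<Longrightarrow>
      \<Psi> l (G2 a v) = (\<lambda>n. \<Sum>i<h12 D. act_21 D l (i, a) * \<Phi>2 i v n)"
    and rel3: "\<And>a l v. a < a31 D \<Longrightarrow> l < h11 D \<Longrightarrow> v \<in> cspace {..<m3} \<Longrightarrow>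
      \<Psi> l (G3 a v) = (\<lambda>n. \<Sum>i<h13 D. act_31 D l (i, a) * \<Phi>3 i v n)"
    and F2: "cvec.subspace F2" "F2 \<subseteq> cspace {..<k}"
    and F3: "cvec.subspace F3" "F3 \<subseteq> cspace {..<m3}"
    and K0: "K0 \<subseteq> sum_space (slices_in {..<a21 D} F2) (slices_in {..<a31 D} F3)"
      "\<And>t. t \<in> K0 \<Longrightarrow> blk2 {..<a21 D} G2 {..<a31 D} G3 t = 0"
      "F2 \<subseteq> cvec.span {(\<lambda>m. t (Inl (m, a))) | t a. t \<in> K0 \<and> a < a21 D}"
      "F3 \<subseteq> cvec.span {(\<lambda>m. t (Inr (m, a))) | t a. t \<in> K0 \<and> a < a31 D}"
  shows "real (cvec.dim (blk2 {..<h12 D} \<Phi>2 {..<h13 D} \<Phi>3 ` sum_space (slices_in {..<h12 D} F2) (slices_in {..<h13 D} F3)))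
    \<le> c1 D k m3 * real (cvec.dim (blk2 {..<a21 D} G2 {..<a31 D} G3 ` sum_space (slices_in {..<a21 D} F2) (slices_in {..<a31 D} F3)))"
proof -
  let ?A2 = "{..<a21 D}" and ?A3 = "{..<a31 D}" and ?J2 = "{..<h12 D}" and ?J3 = "{..<h13 D}" and ?H = "{..<h11 D}"
  let ?I = "{..<k} \<times> ?A2 <+> {..<m3} \<times> ?A3" and ?T = "{..<k} \<times> ?J2 <+> {..<m3} \<times> ?J3"
  obtain p where p: "clinear p" "range p \<subseteq> F2" "\<forall>v\<in>F2. p v = v"
    using cvec.exists_projection[OF F2(1)] by blast
  obtain q where q: "clinear q" "range q \<subseteq> F3" "\<forall>v\<in>F3. q v = v"
    using cvec.exists_projection[OF F3(1)] by blast
  define f where "f = blk2 ?A2 (\<lambda>a v. G2 a (p v)) ?A3 (\<lambda>a v. G3 a (q v))"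
  define g where "g = blk2 ?J2 (\<lambda>a v. \<Phi>2 a (p v)) ?J3 (\<lambda>a v. \<Phi>3 a (q v))"
  have act: "act_21 D \<in> Hom ({..<h12 D} \<times> ?A2) ?H" "act_31 D \<in> Hom ({..<h13 D} \<times> ?A3) ?H"
    "surj_map (?A2 \<times> ?H) ?J2 (dual_act (act_21 D))" "surj_map (?A3 \<times> ?H) ?J3 (dual_act (act_31 D))"
    using D unfolding composition_system_def by auto
  have linf: "clinear f" unfolding f_def
    by (intro clinear_blk2 clinear_compose[OF lin(1) p(1)] clinear_compose[OF lin(2) q(1)])
  have ling: "clinear g" unfolding g_def
    by (intro clinear_blk2 clinear_compose[OF lin(4) p(1)] clinear_compose[OF lin(5) q(1)])
  \<comment> \<open>The extension does not change the images: p and q map the full tensor spaces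
    onto the tensors over F2 and F3.\<close>
  have image: "blk2 A (\<lambda>a v. G a (p v)) B (\<lambda>a v. G' a (q v)) ` cspace ({..<k} \<times> A <+> {..<m3} \<times> B)
      = blk2 A G B G' ` sum_space (slices_in A F2) (slices_in B F3)"
    for A B :: "nat set" and G G' :: "nat \<Rightarrow> (nat \<Rightarrow> complex) \<Rightarrow> 'z \<Rightarrow> complex"
  proof -
    have eq: "blk2 A (\<lambda>a v. G a (p v)) B (\<lambda>a v. G' a (q v)) t
      = blk2 A G B G' (case_sum (pmap p (\<lambda>x. t (Inl x))) (pmap q (\<lambda>x. t (Inr x))))" for t
      by (simp add: blk2_def blk_pmap)
    have "sum_space (slices_in A F2) (slices_in B F3)
      = (\<lambda>t. case_sum (pmap p (\<lambda>x. t (Inl x))) (pmap q (\<lambda>x. t (Inr x)))) ` cspace ({..<k} \<times> A <+> {..<m3} \<times> B)"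
      (is "?L = ?h ` ?C")
    proof
      show "?h ` ?C \<subseteq> ?L"
        by (auto simp: sum_space_iff cspace_Plus pmap_in[OF p(1,2)] pmap_in[OF q(1,2)] simp flip: slices_in_cspace)
      show "?L \<subseteq> ?h ` ?C"
      proof
        fix t assume t: "t \<in> ?L"
        then have tF: "(\<lambda>x. t (Inl x)) \<in> slices_in A F2" "(\<lambda>x. t (Inr x)) \<in> slices_in B F3"
          by (simp_all add: sum_space_iff)
        have "?h t = t"
          unfolding pmap_fixes[OF p(1,3) tF(1)] pmap_fixes[OF q(1,3) tF(2)]
          by (auto simp: fun_eq_iff split: sum.splits)
        moreover have "t \<in> ?C"
          using t slices_in_mono[OF F2(2), of A] slices_in_mono[OF F3(2), of B]
          by (auto simp: sum_space_iff cspace_Plus slices_in_cspace)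
        ultimately show "t \<in> ?h ` ?C" by (intro image_eqI[of t ?h t]) (rule sym)
      qed
    qed
    then show ?thesis by (simp add: eq image_image)
  qed
  have pF: "p v \<in> F2" "p v \<in> cspace {..<k}" "q v \<in> F3" "q v \<in> cspace {..<m3}" for v
    using p(2) q(2) F2(2) F3(2) by blast+
  have "real (cvec.dim (g ` cspace ?T)) \<le> c1 D k m3 * real (cvec.dim (f ` cspace ?I))"
    unfolding c1_def Let_def
  proof (rule rank_le_sup_ratio[where \<Phi> = g and f = f])
    show "delta1 D k m3 \<in> Hom (?I \<times> ?H) ?T"
    proof -
      have z2: "\<not> (j < h12 D \<and> a < a21 D \<and> l < h11 D) \<Longrightarrow> act_21 D l (j, a) = 0" for l j a
        using act(1) by (auto simp: Hom_def)
      have z3: "\<not> (j < h13 D \<and> a < a31 D \<and> l < h11 D) \<Longrightarrow> act_31 D l (j, a) = 0" for l j a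
        using act(2) by (auto simp: Hom_def)
      show ?thesis
        unfolding Hom_def
        by (auto simp: delta1_def id_map_def dual_act_def z2 z3 split: sum.splits) (use z2 z3 in blast)+
    qed
  next
    fix v l assume v: "v \<in> cspace ?I" "f v = 0" "l \<in> ?H"
    have "g (app (?I \<times> ?H) (delta1 D k m3) (tensor v (unit l))) = \<Psi> l (f v)"
      unfolding app_delta1[OF v(1) v(3)[unfolded lessThan_iff]] g_def f_def
      using v rel2 rel3 pF lin
      by (intro blk2_delta1 clinear_compose[OF lin(4) p(1)] clinear_compose[OF lin(5) q(1)]) auto
    then show "g (app (?I \<times> ?H) (delta1 D k m3) (tensor v (unit l))) = 0"
      using v clinearD(3)[OF lin(3)] by simp
  next
    let ?K = "{v \<in> cspace ?I. f v = 0}"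
    have "U2 = cspace {..<k} \<and> U3 = cspace {..<m3}"
      if U: "subspace_of U2 (cspace {..<k})" "subspace_of U3 (cspace {..<m3})"
        "?K \<subseteq> sum_space (tensor_space U2 (cspace ?A2)) (tensor_space U3 (cspace ?A3))" for U2 U3
    proof -
      have Us: "cvec.subspace U2" "U2 \<subseteq> cspace {..<k}" "cvec.subspace U3" "U3 \<subseteq> cspace {..<m3}"
        using U(1,2) by (auto simp: subspace_of_def)
      have K: "?K \<subseteq> sum_space (slices_in ?A2 U2) (slices_in ?A3 U3)"
        using U(3) unfolding tensor_space_eq_slices_in[OF Us(1) finite_lessThan] tensor_space_eq_slices_in[OF Us(3) finite_lessThan] .
      have K0K: "K0 \<subseteq> ?K"
      proof
        fix t assume t: "t \<in> K0"
        then have tF: "(\<lambda>x. t (Inl x)) \<in> slices_in ?A2 F2" "(\<lambda>x. t (Inr x)) \<in> slices_in ?A3 F3"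
          using K0(1) by (auto simp: sum_space_iff)
        then have "f t = blk2 ?A2 G2 ?A3 G3 t"
          using pmap_fixes[OF p(1,3), of _ ?A2] pmap_fixes[OF q(1,3), of _ ?A3]
          by (simp add: f_def blk2_def blk_pmap[symmetric])
        then show "t \<in> ?K"
          using t tF K0(2) slices_in_mono[OF F2(2), of ?A2] slices_in_mono[OF F3(2), of ?A3]
          by (auto simp: cspace_Plus slices_in_cspace)
      qed
      have "{(\<lambda>m. t (Inl (m, a))) | t a. t \<in> K0 \<and> a < a21 D} \<subseteq> U2"
      proof clarify
        fix t a assume "t \<in> K0" "a < a21 D"
        then have "(\<lambda>x. t (Inl x)) \<in> slices_in ?A2 U2" using K K0K by (auto simp: sum_space_iff)
        then show "(\<lambda>m. t (Inl (m, a))) \<in> U2" using slices_inD \<open>a < a21 D\<close> by fastforce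
      qed
      then have FU2: "F2 \<subseteq> U2" using K0(3) cvec.span_minimal[OF _ Us(1)] by blast
      have "{(\<lambda>m. t (Inr (m, a))) | t a. t \<in> K0 \<and> a < a31 D} \<subseteq> U3"
      proof clarify
        fix t a assume "t \<in> K0" "a < a31 D"
        then have "(\<lambda>x. t (Inr x)) \<in> slices_in ?A3 U3" using K K0K by (auto simp: sum_space_iff)
        then show "(\<lambda>m. t (Inr (m, a))) \<in> U3" using slices_inD \<open>a < a31 D\<close> by fastforce
      qed
      then have FU3: "F3 \<subseteq> U3" using K0(4) cvec.span_minimal[OF _ Us(3)] by blast
      have "cspace {..<k} \<subseteq> U2"
      proof (rule cspace_subset_of_projection[OF p F2(2) FU2 Us(1)])
        fix v assume v: "v \<in> cspace {..<k}" "p v = 0"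
        let ?t = "case_sum (slot 0 v) (\<lambda>_. 0) :: nat \<times> nat + nat \<times> nat \<Rightarrow> complex"
        have "?t \<in> cspace ?I"
          using slot_in[OF subspace_cspace v(1), of 0 ?A2] D(2)
          by (simp add: cspace_Plus slices_in_cspace) (simp add: cspace_def)
        moreover have "f ?t = 0"
          using D(2) blk_slot[of ?A2 0 "\<lambda>a v. G2 a (p v)"] clinear_compose[OF lin(1) p(1)]
            clinearD(3)[OF lin(1)] clinearD(3)[OF clinear_blk, of ?A3 "\<lambda>a v. G3 a (q v)"]
            clinear_compose[OF lin(2) q(1)]
          by (simp add: f_def blk2_def v(2) zero_fun_def)
        ultimately have "?t \<in> sum_space (slices_in ?A2 U2) (slices_in ?A3 U3)" using K by blast
        then have "slot 0 v \<in> slices_in ?A2 U2" by (simp add: sum_space_iff)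
        then show "v \<in> U2" using slices_inD[of "slot 0 v" ?A2 U2 0] D(2) by (simp add: slice_slot)
      qed
      moreover have "cspace {..<m3} \<subseteq> U3"
      proof (rule cspace_subset_of_projection[OF q F3(2) FU3 Us(3)])
        fix v assume v: "v \<in> cspace {..<m3}" "q v = 0"
        let ?t = "case_sum (\<lambda>_. 0) (slot 0 v) :: nat \<times> nat + nat \<times> nat \<Rightarrow> complex"
        have "?t \<in> cspace ?I"
          using slot_in[OF subspace_cspace v(1), of 0 ?A3] D(3)
          by (simp add: cspace_Plus slices_in_cspace) (simp add: cspace_def)
        moreover have "f ?t = 0"
          using D(3) blk_slot[of ?A3 0 "\<lambda>a v. G3 a (q v)"] clinear_compose[OF lin(2) q(1)]
            clinearD(3)[OF lin(2)] clinearD(3)[OF clinear_blk, of ?A2 "\<lambda>a v. G2 a (p v)"]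
            clinear_compose[OF lin(1) p(1)]
          by (simp add: f_def blk2_def v(2) zero_fun_def)
        ultimately have "?t \<in> sum_space (slices_in ?A2 U2) (slices_in ?A3 U3)" using K by blast
        then have "slot 0 v \<in> slices_in ?A3 U3" by (simp add: sum_space_iff)
        then show "v \<in> U3" using slices_inD[of "slot 0 v" ?A3 U3 0] D(3) by (simp add: slice_slot)
      qed
      ultimately show ?thesis using Us by blast
    qed
    then show "\<forall>U2 U3. subspace_of U2 (cspace {..<k}) \<and> subspace_of U3 (cspace {..<m3}) \<and>
        (U2, U3) \<noteq> (cspace {..<k}, cspace {..<m3}) \<longrightarrow>
        \<not> ?K \<subseteq> sum_space (tensor_space U2 (cspace ?A2)) (tensor_space U3 (cspace ?A3))"
      by blast
  next
    fix s assume f0: "\<And>v. v \<in> cspace ?I \<Longrightarrow> f v = 0" and s: "s \<in> cspace ?T"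
    have "\<Phi>2 j (p v) = 0" if "j < h12 D" "v \<in> cspace {..<k}" for j v
    proof (rule blk_dual_zero[OF _ _ _ act(3,1), of "\<lambda>j. \<Phi>2 j (p v)"])
      fix a l assume al: "a \<in> ?A2" "l \<in> ?H"
      let ?t = "case_sum (slot a v) (\<lambda>_. 0) :: nat \<times> nat + nat \<times> nat \<Rightarrow> complex"
      have "?t \<in> cspace ?I"
        using slot_in[OF subspace_cspace that(2) al(1)]
        by (simp add: cspace_Plus slices_in_cspace) (simp add: cspace_def)
      then have "f ?t = 0" by (rule f0)
      then have "G2 a (p v) = 0"
        using al blk_slot[of ?A2 a "\<lambda>a v. G2 a (p v)"] clinear_compose[OF lin(1) p(1)]
          clinearD(3)[OF clinear_blk, of ?A3 "\<lambda>a v. G3 a (q v)"] clinear_compose[OF lin(2) q(1)]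
        by (simp add: f_def blk2_def zero_fun_def)
      then show "(\<lambda>n. \<Sum>j\<in>?J2. act_21 D l (j, a) * \<Phi>2 j (p v) n) = 0"
        using rel2[of a l "p v"] pF al clinearD(3)[OF lin(3)] by simp
    qed (use that in auto)
    moreover have "\<Phi>3 j (q v) = 0" if "j < h13 D" "v \<in> cspace {..<m3}" for j v
    proof (rule blk_dual_zero[OF _ _ _ act(4,2), of "\<lambda>j. \<Phi>3 j (q v)"])
      fix a l assume al: "a \<in> ?A3" "l \<in> ?H"
      let ?t = "case_sum (\<lambda>_. 0) (slot a v) :: nat \<times> nat + nat \<times> nat \<Rightarrow> complex"
      have "?t \<in> cspace ?I"
        using slot_in[OF subspace_cspace that(2) al(1)]
        by (simp add: cspace_Plus slices_in_cspace) (simp add: cspace_def)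
      then have "f ?t = 0" by (rule f0)
      then have "G3 a (q v) = 0"
        using al blk_slot[of ?A3 a "\<lambda>a v. G3 a (q v)"] clinear_compose[OF lin(1) p(1)]
          clinearD(3)[OF clinear_blk, of ?A2 "\<lambda>a v. G2 a (p v)"] clinear_compose[OF lin(2) q(1)]
        by (simp add: f_def blk2_def zero_fun_def)
      then show "(\<lambda>n. \<Sum>j\<in>?J3. act_31 D l (j, a) * \<Phi>3 j (q v) n) = 0"
        using rel3[of a l "q v"] pF al clinearD(3)[OF lin(3)] by simp
    qed (use that in auto)
    moreover have "(\<lambda>m. s (Inl (m, j))) \<in> cspace {..<k}" "(\<lambda>m. s (Inr (m, j))) \<in> cspace {..<m3}" for j
      using s unfolding cspace_Plus by (auto simp: cspace_def)
    ultimately show "g s = 0" unfolding g_def blk2_def blk_def by simp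
  qed (use linf ling in auto)
  then show ?thesis unfolding f_def g_def image .
qed

text \<open>As \<open>c3\<close> is \<open>c1\<close> with first space 0, this is
  \<open>c1_bound\<close> with zero maps and the zero subspace in the first block, and with K0
  placed in the second.\<close>

lemma c3_bound:
  fixes G :: "nat \<Rightarrow> (nat \<Rightarrow> complex) \<Rightarrow> 'p \<Rightarrow> complex" and \<Phi> :: "nat \<Rightarrow> (nat \<Rightarrow> complex) \<Rightarrow> 'n \<Rightarrow> complex"
  assumes D: "composition_system D" "a21 D > 0" "a31 D > 0"
    and lin: "\<And>a. clinear (G a)" "\<And>l. clinear (\<Psi> l)" "\<And>j. clinear (\<Phi> j)"
    and rel: "\<And>a l v. a < a31 D \<Longrightarrow> l < h11 D \<Longrightarrow> v \<in> cspace {..<m3} \<Longrightarrow>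
      \<Psi> l (G a v) = (\<lambda>n. \<Sum>i<h13 D. act_31 D l (i, a) * \<Phi> i v n)"
    and F: "cvec.subspace F" "F \<subseteq> cspace {..<m3}"
    and K0: "K0 \<subseteq> slices_in {..<a31 D} F" "\<And>t. t \<in> K0 \<Longrightarrow> blk {..<a31 D} G t = 0"
      "F \<subseteq> cvec.span {(\<lambda>m. t (m, a)) | t a. t \<in> K0 \<and> a < a31 D}"
  shows "real (cvec.dim (blk {..<h13 D} \<Phi> ` slices_in {..<h13 D} F))
    \<le> c3 D m3 * real (cvec.dim (blk {..<a31 D} G ` slices_in {..<a31 D} F))"
proof -
  let ?z = "case_sum (\<lambda>_ :: nat \<times> nat. 0 :: complex) :: (nat \<times> nat \<Rightarrow> complex) \<Rightarrow> _"
  have zero: "clinear (\<lambda>_. 0)" by (simp add: clinear_iff fun_eq_iff)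
  have s0: "slices_in A ({0} :: (nat \<Rightarrow> complex) set) = {0}" for A :: "nat set"
    by (auto simp: slices_in_def fun_eq_iff) (metis (full_types))
  have ss: "sum_space {0} S = ?z ` S" for S
    by (auto simp: sum_space_def zero_fun_def)
  have image: "blk2 A (\<lambda>_ _. 0) B G' ` sum_space (slices_in A ({0} :: (nat \<Rightarrow> complex) set)) S = blk B G' ` S"
    for A B :: "nat set" and G' :: "nat \<Rightarrow> (nat \<Rightarrow> complex) \<Rightarrow> 'z \<Rightarrow> complex" and S
    unfolding s0 ss image_image by (simp add: blk2_def) (simp add: blk_def)
  have "real (cvec.dim (blk2 {..<h12 D} (\<lambda>_ _. 0) {..<h13 D} \<Phi> ` sum_space (slices_in {..<h12 D} {0 :: nat \<Rightarrow> complex}) (slices_in {..<h13 D} F)))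
    \<le> c1 D 0 m3 * real (cvec.dim (blk2 {..<a21 D} (\<lambda>_ _. 0) {..<a31 D} G ` sum_space (slices_in {..<a21 D} {0 :: nat \<Rightarrow> complex}) (slices_in {..<a31 D} F)))"
  proof (rule c1_bound[where ?G2.0 = "\<lambda>_ _. 0" and ?\<Phi>2.0 = "\<lambda>_ _. 0" and \<Psi> = \<Psi> and ?K0.0 = "?z ` K0", OF D zero lin(1,2) zero lin(3)])
    show "?z ` K0 \<subseteq> sum_space (slices_in {..<a21 D} {0 :: nat \<Rightarrow> complex}) (slices_in {..<a31 D} F)"
      unfolding s0 ss using K0(1) by blast
    have "{(\<lambda>m. t (m, a)) | t a. t \<in> K0 \<and> a < a31 D} \<subseteq> {(\<lambda>m. t (Inr (m, a))) | t a. t \<in> ?z ` K0 \<and> a < a31 D}"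
    proof clarify
      fix t a assume "t \<in> K0" "a < a31 D"
      then show "\<exists>t' a'. (\<lambda>m. t (m, a)) = (\<lambda>m. t' (Inr (m, a'))) \<and> t' \<in> ?z ` K0 \<and> a' < a31 D"
        by (intro exI[of _ "?z t"] exI[of _ a]) simp
    qed
    then show "F \<subseteq> cvec.span {(\<lambda>m. t (Inr (m, a))) | t a. t \<in> ?z ` K0 \<and> a < a31 D}"
      using K0(3) cvec.span_mono by blast
    show "{0} \<subseteq> cvec.span X" for X :: "(nat \<Rightarrow> complex) set" using cvec.span_zero by auto
    show "{0} \<subseteq> cspace {..<0 :: nat}" by (simp add: cspace_def)
    show "\<And>t. t \<in> ?z ` K0 \<Longrightarrow> blk2 {..<a21 D} (\<lambda>_ _. 0) {..<a31 D} G t = 0"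
      using K0(2) by (auto simp: blk2_def) (auto simp: blk_def)
    show "\<And>a l v. \<Psi> l 0 = (\<lambda>n. \<Sum>i<h12 D. act_21 D l (i, a) * (0 :: 'n \<Rightarrow> complex) n)"
      using clinearD(3)[OF lin(2)] by (simp add: fun_eq_iff)
  qed (use rel F in simp_all)
  then show ?thesis unfolding image c3_def .
qed

lemma subspace_sum_space:
  assumes "cvec.subspace U" "cvec.subspace V"
  shows "cvec.subspace (sum_space U V)"
  using assms unfolding cvec.subspace_def by (auto simp: sum_space_iff plus_fun_def zero_fun_def)

lemma sum_space_cspace: "sum_space (cspace A) (cspace B) = cspace (A <+> B)"
  by (auto simp: sum_space_iff cspace_Plus)

lemma sum_space_mono: "U \<subseteq> U' \<Longrightarrow> V \<subseteq> V' \<Longrightarrow> sum_space U V \<subseteq> sum_space U' V'"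
  by (auto simp: sum_space_iff)

text \<open>Rank and nullity for the projection to the first summand, whose kernel is a copy of
  V.\<close>

lemma dim_sum_space:
  assumes U: "cvec.subspace U" "U \<subseteq> cspace A" "finite A" and V: "cvec.subspace V" "V \<subseteq> cspace B" "finite B"
  shows "cvec.dim (sum_space U V) = cvec.dim U + cvec.dim V"
proof -
  let ?f = "\<lambda>t x. t (Inl x)" and ?g = "\<lambda>v. case_sum (\<lambda>_ :: 'a. 0 :: complex) v"
  have fd: "cvec.findim (sum_space U V)"
    using cvec.findim_subset[OF findim_cspace, of "A <+> B" "sum_space U V"] U V sum_space_mono[OF U(2) V(2)]
    by (simp add: sum_space_cspace)
  have "?f ` sum_space U V = U"
  proof
    show "U \<subseteq> ?f ` sum_space U V"
    proof
      fix u assume "u \<in> U"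
      then have "case_sum u 0 \<in> sum_space U V" "u = ?f (case_sum u 0)"
        using cvec.subspace_0[OF V(1)] by (auto simp: sum_space_def)
      then show "u \<in> ?f ` sum_space U V" by blast
    qed
  qed (auto simp: sum_space_iff)
  moreover have "{t \<in> sum_space U V. ?f t = 0} = ?g ` V"
    using cvec.subspace_0[OF U(1)] by (auto simp: sum_space_def zero_fun_def)
  moreover have "cvec.dim (?g ` V) = cvec.dim V"
  proof (rule cpair.dim_image_inj)
    show "clinear ?g" by (auto simp: clinear_iff fun_eq_iff split: sum.splits)
    show "cvec.findim V" using cvec.findim_subset[OF findim_cspace[OF V(3)] V(2)] .
    show "v = 0" if "?g v = 0" for v
    proof
      fix x show "v x = 0 x" using fun_cong[OF that, of "Inr x"] by simp
    qed
  qed (rule V(1))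
  ultimately show ?thesis
    using cpair.rank_nullity[OF clinear_reindex subspace_sum_space[OF U(1) V(1)] fd, of Inl] by simp
qed

lemma rank_lt_of_kernel:
  assumes "clinear f" "cvec.subspace V" "cvec.findim V" "t \<in> V" "f t = 0" "t \<noteq> 0"
  shows "cvec.dim (f ` V) < cvec.dim V"
proof -
  have "cvec.dim {v \<in> V. f v = 0} \<noteq> 0"
    using cvec.findim_dim_zero[OF cvec.findim_subset[OF assms(3)], of "{v \<in> V. f v = 0}"] assms(4-6) by auto
  then show ?thesis using cpair.rank_nullity[OF assms(1-3)] by simp
qed

lemma findim_slices_in:
  fixes A :: "'j set"
  assumes "F \<subseteq> cspace I" "finite I" "finite A"
  shows "cvec.findim (slices_in A F)"
proof -
  have "slices_in A F \<subseteq> cspace (I \<times> A)" using slices_in_mono[OF assms(1), of A] slices_in_cspace by blast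
  then show ?thesis
    by (rule cvec.findim_subset[OF findim_cspace[OF finite_cartesian_product[OF assms(2,3)]]])
qed

section \<open>The numerical contradictions\<close>

text \<open>Here r1, r2, y and q are the dimensions of the invariant family in
  \<open>P\<^sub>1\<close>, \<open>P\<^sub>2\<close>, \<open>M\<^sub>3\<close> and
  \<open>N\<^sub>1\<close>, and k, k' stand for \<open>c3\<close>, \<open>c3'\<close>. In the first
  alternative the two bounds for q are combined with weights \<open>\<alpha>2 * k\<close> and
  \<open>\<alpha>1 * k'\<close>. Each of the others uses one bound; the term in the other dimension
  is dropped or, in the last alternative, estimated by \<open>r1 \<le> A21 * r2\<close>.\<close>

lemma numeric_step1:
  fixes r1 r2 q y k k' :: real
  assumes pos: "\<alpha>1 > 0" "\<alpha>2 > 0" "\<alpha>3 > 0" "\<mu> > 0" "y > 0" "r1 \<ge> 0" "r2 \<ge> 0" "q \<ge> 0"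
    "A21 > 0" "A31 > 0" "A31 \<le> A32 * A21"
    and ss: "\<alpha>1 * r1 + \<alpha>2 * r2 + \<alpha>3 * y - \<mu> * q \<le> 0"
    and bounds: "q \<le> k' * r2" "q \<le> k * r1" "r2 < A32 * y" "r1 < A31 * y" "r1 \<le> A21 * r2"
    and l3: "l3 = A31 * \<alpha>1 + A32 * \<alpha>2 + \<alpha>3"
    and cond: "\<alpha>2 * k + \<alpha>1 * k' \<ge> \<mu> * k * k' \<or> l3 \<ge> \<mu> * k' * A32 + A31 * \<alpha>1
      \<or> l3 \<ge> \<mu> * k * A31 + A32 * \<alpha>2 \<or> l3 \<ge> \<mu> * k * A32 * A21"
  shows False
proof -
  \<comment> \<open>The form is affine in r, positive at \<open>r = 0\<close> and nonnegative at
    \<open>r = z * y\<close>; hence it is positive for every r from 0 up to, but excluding,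
    \<open>z * y\<close>.\<close>
  have key: False if \<beta>: "\<beta> * r + \<gamma> * y \<le> 0" and "\<gamma> > 0" "0 \<le> r" "r < z * y" "\<beta> * z + \<gamma> \<ge> 0" for \<beta> r \<gamma> z
  proof (cases "\<beta> \<ge> 0")
    case True
    then have "\<beta> * r + \<gamma> * y > 0" using that pos by (simp add: add_nonneg_pos)
    then show False using \<beta> by simp
  next
    case False
    then have "\<beta> * r > \<beta> * (z * y)" using that(4) by (simp add: mult_strict_left_mono_neg)
    moreover have "(\<beta> * z + \<gamma>) * y \<ge> 0" using that(5) pos by simp
    ultimately show False using \<beta> by (simp add: algebra_simps)
  qed
  have a1: "\<alpha>1 * r1 \<ge> 0" and a2: "\<alpha>2 * r2 \<ge> 0" and a3: "\<alpha>3 * y > 0" using pos by auto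
  have q1: "\<mu> * q \<le> \<mu> * k * r1" and q2: "\<mu> * q \<le> \<mu> * k' * r2"
    using bounds(1,2) pos by (simp_all add: mult.assoc)
  have q0: "\<mu> * q > 0" using ss a1 a2 a3 by linarith
  from cond show False
  proof (elim disjE)
    assume c: "\<alpha>2 * k + \<alpha>1 * k' \<ge> \<mu> * k * k'"
    \<comment> \<open>Positivity of q forces k and k' to be positive, so that \<open>k * k'\<close>
      can be cancelled at the end.\<close>
    have "q > 0" using q0 pos by (simp add: zero_less_mult_iff)
    then have kp: "k > 0" "k' > 0"
      using bounds(1,2) pos by (metis less_le_trans mult_nonpos_nonneg not_le)+
    have "k * k' * (\<mu> * q) \<le> (\<alpha>2 * k + \<alpha>1 * k') * q"
      using mult_right_mono[OF c pos(8)] by (simp add: mult_ac)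
    also have "\<dots> = \<alpha>2 * k * q + \<alpha>1 * k' * q" by (simp add: algebra_simps)
    also have "\<dots> \<le> \<alpha>2 * k * (k' * r2) + \<alpha>1 * k' * (k * r1)"
      using bounds(1,2) pos kp by (intro add_mono mult_left_mono) auto
    also have "\<dots> = k * k' * (\<alpha>1 * r1 + \<alpha>2 * r2)" by (simp add: algebra_simps)
    finally have "\<mu> * q \<le> \<alpha>1 * r1 + \<alpha>2 * r2" using kp by simp
    then show False using ss a3 by linarith
  next
    assume c: "l3 \<ge> \<mu> * k' * A32 + A31 * \<alpha>1"
    show False
    proof (rule key)
      show "(\<alpha>2 - \<mu> * k') * r2 + \<alpha>3 * y \<le> 0" using ss a1 q2 by (simp add: algebra_simps)
      show "(\<alpha>2 - \<mu> * k') * A32 + \<alpha>3 \<ge> 0" using c l3 by (simp add: algebra_simps)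
    qed (use pos bounds in auto)
  next
    assume c: "l3 \<ge> \<mu> * k * A31 + A32 * \<alpha>2"
    show False
    proof (rule key)
      show "(\<alpha>1 - \<mu> * k) * r1 + \<alpha>3 * y \<le> 0" using ss a2 q1 by (simp add: algebra_simps)
      show "(\<alpha>1 - \<mu> * k) * A31 + \<alpha>3 \<ge> 0" using c l3 by (simp add: algebra_simps)
    qed (use pos bounds in auto)
  next
    assume c: "l3 \<ge> \<mu> * k * A32 * A21"
    have A32: "A32 > 0" using pos by (smt (verit) mult_nonpos_nonneg)
    show False
    proof (rule key)
      have "\<alpha>2 / A21 * r1 \<le> \<alpha>2 * r2"
        using bounds(5) pos by (simp add: field_simps)
      then show "(\<alpha>1 + \<alpha>2 / A21 - \<mu> * k) * r1 + \<alpha>3 * y \<le> 0" using ss q1 by (simp add: algebra_simps)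
      let ?s = "A31 / (A32 * A21)"
      have s: "0 \<le> ?s" "?s \<le> 1" using pos A32 by (auto simp: field_simps)
      have "?s * (\<mu> * k * A32 * A21) \<le> ?s * l3" using c s by (intro mult_left_mono) auto
      then have "\<mu> * k * A31 \<le> ?s * (A31 * \<alpha>1) + ?s * (A32 * \<alpha>2) + ?s * \<alpha>3"
        using pos A32 l3 by (simp add: algebra_simps)
      also have "\<dots> \<le> A31 * \<alpha>1 + ?s * (A32 * \<alpha>2) + \<alpha>3"
        using s pos by (intro add_mono mult_left_le_one_le) auto
      also have "?s * (A32 * \<alpha>2) = \<alpha>2 / A21 * A31" using pos A32 by (simp add: field_simps)
      finally show "(\<alpha>1 + \<alpha>2 / A21 - \<mu> * k) * A31 + \<alpha>3 \<ge> 0" by (simp add: algebra_simps)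
    qed (use pos bounds in auto)
  qed
qed

text \<open>Here x and y are the dimensions of \<open>M\<^sub>2'\<close> and
  \<open>M\<^sub>3'\<close>, and the family has its largest possible dimension
  \<open>x + A32 * y\<close> in \<open>P\<^sub>2\<close>. Semi-stability bounds a positive
  combination of x and y by \<open>(\<mu> * k - \<alpha>1) * r\<close>. If that coefficient is not
  positive, then x = y = 0, which contradicts the strict bound for r; otherwise inserting the strict
  bound contradicts \<open>cond\<close> coefficient by coefficient.\<close>

lemma numeric_step2:
  fixes r q x y k :: real
  assumes pos: "\<alpha>1 > 0" "\<alpha>2 > 0" "\<alpha>3 > 0" "\<mu> > 0" "x \<ge> 0" "y \<ge> 0" "r \<ge> 0" "A32 \<ge> 0"
    and ss: "\<alpha>1 * r + \<alpha>2 * (x + A32 * y) + \<alpha>3 * y - \<mu> * q \<le> 0"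
    and bounds: "q \<le> k * r" "r < A21 * x + A31 * y"
    and cond: "A21 * \<alpha>1 + \<alpha>2 \<ge> A21 * \<mu> * k" "A31 * \<alpha>1 + A32 * \<alpha>2 + \<alpha>3 \<ge> A31 * \<mu> * k"
  shows False
proof -
  have "\<mu> * q \<le> \<mu> * (k * r)" using bounds(1) pos by simp
  then have *: "\<alpha>2 * x + (A32 * \<alpha>2 + \<alpha>3) * y \<le> (\<mu> * k - \<alpha>1) * r"
    using ss by (simp add: algebra_simps)
  show False
  proof (cases "\<mu> * k - \<alpha>1 \<le> 0")
    case True
    then have "(\<mu> * k - \<alpha>1) * r \<le> 0" using pos by (simp add: mult_nonpos_nonneg)
    moreover have "\<alpha>2 * x \<ge> 0" "A32 * \<alpha>2 * y \<ge> 0" "\<alpha>3 * y \<ge> 0" using pos by auto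
    moreover have "(A32 * \<alpha>2 + \<alpha>3) * y = A32 * \<alpha>2 * y + \<alpha>3 * y" by (rule distrib_right)
    ultimately have "\<alpha>2 * x = 0" "\<alpha>3 * y = 0" using * by linarith+
    then show False using pos bounds by simp
  next
    case False
    then have "(\<mu> * k - \<alpha>1) * r < (\<mu> * k - \<alpha>1) * (A21 * x + A31 * y)" using bounds(2) by simp
    also have "\<dots> = ((\<mu> * k - \<alpha>1) * A21) * x + ((\<mu> * k - \<alpha>1) * A31) * y" by (simp add: algebra_simps)
    also have "\<dots> \<le> \<alpha>2 * x + (A32 * \<alpha>2 + \<alpha>3) * y"
      using pos cond by (intro add_mono mult_right_mono) (auto simp: algebra_simps)
    finally show False using * by simp
  qed
qed

lemma blk_in:
  assumes "\<And>a v. G a v \<in> cspace I"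
  shows "blk A G t \<in> cspace I"
  unfolding blk_def using assms by (intro cvec.subspace_sum[OF subspace_cspace])

lemma blk_closed:
  assumes "cvec.subspace S" "\<And>a. a \<in> A \<Longrightarrow> G a (\<lambda>m. t (m, a)) \<in> S"
  shows "blk A G t \<in> S"
  unfolding blk_def using assms by (intro cvec.subspace_sum)

section \<open>Semi-stable limits\<close>

text \<open>Multiplication \<open>A\<^sub>3\<^sub>2 \<rightarrow> A\<^sub>3\<^sub>1\<close> by the
  basis vector a of \<open>A\<^sub>2\<^sub>1\<close>, with its indices arranged for
  \<open>contract\<close>.\<close>

definition mulA :: "comp_data \<Rightarrow> nat \<Rightarrow> nat \<times> nat \<Rightarrow> complex" where
  "mulA D a = (\<lambda>(c, b). comp_A D c (b, a))"

text \<open>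
  The equations satisfied by the limits of points of Z. Maps on a tensor product with
  \<open>A\<^sub>j\<^sub>i\<close> or \<open>H\<^sub>1\<^sub>i\<^sup>*\<close> are written as families of maps, indexed by the
  basis of the second factor; E, Psi2 and Phi3 are the induced maps on
  \<open>M\<^sub>3 \<otimes> A\<^sub>3\<^sub>1\<close>, \<open>P\<^sub>2 \<otimes> H\<^sub>1\<^sub>2\<^sup>*\<close> and \<open>M\<^sub>3 \<otimes> H\<^sub>1\<^sub>3\<^sup>*\<close>.
\<close>

locale limit_point =
  fixes D :: comp_data and m3 n1 :: nat and I1 :: "'p set" and I2 :: "'q set"
    and X2 :: "nat \<Rightarrow> ('q \<Rightarrow> complex) \<Rightarrow> 'p \<Rightarrow> complex" and X3 :: "nat \<Rightarrow> (nat \<Rightarrow> complex) \<Rightarrow> 'q \<Rightarrow> complex"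
    and Psi :: "nat \<Rightarrow> ('p \<Rightarrow> complex) \<Rightarrow> nat \<Rightarrow> complex"
    and E :: "nat \<Rightarrow> (nat \<Rightarrow> complex) \<Rightarrow> 'p \<Rightarrow> complex"
    and Psi2 :: "nat \<Rightarrow> ('q \<Rightarrow> complex) \<Rightarrow> nat \<Rightarrow> complex"
    and Phi3 :: "nat \<Rightarrow> (nat \<Rightarrow> complex) \<Rightarrow> nat \<Rightarrow> complex"
    and \<alpha>1 \<alpha>2 \<alpha>3 \<mu> :: real
  assumes D: "composition_system D"
    and fin: "finite I1" "finite I2"
    and lin: "\<And>a. clinear (X2 a)" "\<And>b. clinear (X3 b)" "\<And>l. clinear (Psi l)"
      "\<And>c. clinear (E c)" "\<And>k. clinear (Psi2 k)" "\<And>k. clinear (Phi3 k)"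
    and into: "\<And>a v. X2 a v \<in> cspace I1" "\<And>b v. X3 b v \<in> cspace I2" "\<And>c v. E c v \<in> cspace I1"
      "\<And>k v. Psi2 k v \<in> cspace {..<n1}" "\<And>k v. Phi3 k v \<in> cspace {..<n1}"
    and relA: "\<And>a b v. a < a21 D \<Longrightarrow> b < a32 D \<Longrightarrow> v \<in> cspace {..<m3} \<Longrightarrow>
      X2 a (X3 b v) = (\<lambda>i. \<Sum>c<a31 D. comp_A D c (b, a) * E c v i)"
    and relB: "\<And>a l v. a < a21 D \<Longrightarrow> l < h11 D \<Longrightarrow> v \<in> cspace I2 \<Longrightarrow>
      Psi l (X2 a v) = (\<lambda>n. \<Sum>k<h12 D. act_21 D l (k, a) * Psi2 k v n)"
    and relC: "\<And>c l v. c < a31 D \<Longrightarrow> l < h11 D \<Longrightarrow> v \<in> cspace {..<m3} \<Longrightarrow>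
      Psi l (E c v) = (\<lambda>n. \<Sum>k<h13 D. act_31 D l (k, c) * Phi3 k v n)"
    and relD: "\<And>b j v. b < a32 D \<Longrightarrow> j < h12 D \<Longrightarrow> v \<in> cspace {..<m3} \<Longrightarrow>
      Psi2 j (X3 b v) = (\<lambda>n. \<Sum>k<h13 D. act_32 D j (k, b) * Phi3 k v n)"
    and A_pos: "a21 D > 0" "a31 D > 0" "a32 D > 0"
    and pos: "\<alpha>1 > 0" "\<alpha>2 > 0" "\<alpha>3 > 0" "\<mu> > 0"
    and semistable: "\<And>U1 U2 U3 Q. subspace_of U1 (cspace I1) \<Longrightarrow> subspace_of U2 (cspace I2) \<Longrightarrow>
      subspace_of U3 (cspace {..<m3}) \<Longrightarrow> subspace_of Q (cspace {..<n1}) \<Longrightarrow>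
      cvec.dim U2 > 0 \<or> cvec.dim U3 > 0 \<Longrightarrow>
      (\<And>a. a < a21 D \<Longrightarrow> X2 a ` U2 \<subseteq> U1) \<Longrightarrow> (\<And>b. b < a32 D \<Longrightarrow> X3 b ` U3 \<subseteq> U2) \<Longrightarrow>
      (\<And>l. l < h11 D \<Longrightarrow> Psi l ` U1 \<subseteq> Q) \<Longrightarrow>
      \<alpha>1 * real (cvec.dim U1) + \<alpha>2 * real (cvec.dim U2) + \<alpha>3 * real (cvec.dim U3)
        - \<mu> * real (cvec.dim Q) \<le> 0"
begin

abbreviation "A2 \<equiv> {..<a21 D}"
abbreviation "A3 \<equiv> {..<a31 D}"
abbreviation "A32 \<equiv> {..<a32 D}"
abbreviation "M3 \<equiv> {..<m3}"

lemma compA_zero: "c \<ge> a31 D \<Longrightarrow> comp_A D c s = 0"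
  using D by (cases s) (auto simp: composition_system_def Hom_def)

lemma act_zero: "k \<ge> h12 D \<Longrightarrow> act_21 D l (k, a) = 0" "k \<ge> h13 D \<Longrightarrow> act_31 D l (k, a) = 0"
  using D by (auto simp: composition_system_def Hom_def)

lemma contract_mulA:
  "cvec.subspace U \<Longrightarrow> t \<in> slices_in A32 U \<Longrightarrow> contract A32 (mulA D a) t \<in> slices_in A3 U"
  by (rule contract_in) (auto simp: mulA_def compA_zero)

lemma X2_blk_X3:
  assumes "a < a21 D" "t \<in> slices_in A32 (cspace M3)"
  shows "X2 a (blk A32 X3 t) = blk A3 E (contract A32 (mulA D a) t)"
  using assms relA lin
  by (intro blk_contract[where U = "cspace M3", symmetric]) (auto simp: mulA_def)

text \<open>The composition maps \<open>A\<^sub>3\<^sub>2 \<otimes> A\<^sub>2\<^sub>1\<close> onto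
  \<open>A\<^sub>3\<^sub>1\<close>, so \<open>E c v\<close> is a combination of the vectors
  \<open>X2 a (X3 b v)\<close>.\<close>

lemma E_in_X2_X3:
  assumes S: "cvec.subspace S" and mem: "\<And>a b. a < a21 D \<Longrightarrow> b < a32 D \<Longrightarrow> X2 a (X3 b v) \<in> S"
    and c: "c < a31 D" and v: "v \<in> cspace M3"
  shows "E c v \<in> S"
proof -
  have "comp_A D \<in> Hom (A32 \<times> A2) A3" "cspace A3 \<subseteq> app (A32 \<times> A2) (comp_A D) ` cspace (A32 \<times> A2)"
    using D by (auto simp: composition_system_def surj_map_def)
  then obtain R where R: "comp_map (A32 \<times> A2) (comp_A D) R = id_map A3"
    using surj_right_inverse[of "A32 \<times> A2" A3 "comp_A D"] by auto
  have "E c v = (\<lambda>i. \<Sum>s\<in>A32 \<times> A2. R s c * X2 (snd s) (X3 (fst s) v) i)"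
  proof
    fix i
    have "(\<Sum>s\<in>A32 \<times> A2. R s c * X2 (snd s) (X3 (fst s) v) i)
        = (\<Sum>s\<in>A32 \<times> A2. \<Sum>d\<in>A3. (comp_A D d s * R s c) * E d v i)"
      using relA v by (intro sum.cong) (auto simp: sum_distrib_left mult_ac)
    also have "\<dots> = (\<Sum>d\<in>A3. comp_map (A32 \<times> A2) (comp_A D) R d c * E d v i)"
      by (subst sum.swap) (simp add: comp_map_def sum_distrib_right)
    also have "\<dots> = (\<Sum>d\<in>A3. if d = c then E d v i else 0)"
      unfolding R by (intro sum.cong) (auto simp: id_map_def)
    also have "\<dots> = E c v i" using c by simp
    finally show "E c v i = (\<Sum>s\<in>A32 \<times> A2. R s c * X2 (snd s) (X3 (fst s) v) i)" by simp
  qed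
  then show ?thesis using mem subspace_comb[OF S, of "A32 \<times> A2" "\<lambda>s. X2 (snd s) (X3 (fst s) v)"]
    by auto
qed

text \<open>
  The degenerate tensors in the kernel of \<open>A\<^sub>3\<^sub>2 \<rightarrow> Hom(A\<^sub>2\<^sub>1, A\<^sub>3\<^sub>1)\<close> are excluded here;
  if there are any, the closure of Z has no semistable point at all.
\<close>

lemma X3_injective:
  assumes nondeg: "\<And>w. w \<in> cspace A32 \<Longrightarrow>
      (\<And>a c. a < a21 D \<Longrightarrow> c < a31 D \<Longrightarrow> (\<Sum>b<a32 D. comp_A D c (b, a) * w b) = 0) \<Longrightarrow> w = 0"
    and lambda3: "l3 = real (a31 D) * \<alpha>1 + real (a32 D) * \<alpha>2 + \<alpha>3"
    and cond: "\<alpha>2 * c3 D m3 + \<alpha>1 * c3' D m3 \<ge> \<mu> * c3 D m3 * c3' D m3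
       \<or> l3 \<ge> \<mu> * c3' D m3 * real (a32 D) + real (a31 D) * \<alpha>1
       \<or> l3 \<ge> \<mu> * c3 D m3 * real (a31 D) + real (a32 D) * \<alpha>2
       \<or> l3 \<ge> \<mu> * c3 D m3 * real (a32 D) * real (a21 D)"
    and t0: "t0 \<in> cspace (M3 \<times> A32)" "blk A32 X3 t0 = 0"
  shows "t0 = 0"
proof (rule ccontr)
  assume "t0 \<noteq> 0"
  define L where "L = {t \<in> cspace (M3 \<times> A32). blk A32 X3 t = 0}"
  define F where "F = cvec.span {(\<lambda>m. t (m, b)) | t b. t \<in> L \<and> b < a32 D}"
  have L_slice: "(\<lambda>m. t (m, b)) \<in> cspace M3" if "t \<in> L" for t b
    using that by (auto simp: L_def cspace_def)
  have F: "cvec.subspace F" "F \<subseteq> cspace M3"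
    unfolding F_def using L_slice by (intro cvec.subspace_span, intro cvec.span_minimal[OF _ subspace_cspace]) blast
  have LF: "L \<subseteq> slices_in A32 F"
  proof
    fix t assume t: "t \<in> L"
    show "t \<in> slices_in A32 F"
    proof (rule slices_inI)
      show "(\<lambda>m. t (m, b)) \<in> F" if "b \<in> A32" for b
        unfolding F_def using t that by (intro cvec.span_base) auto
    qed (use t in \<open>auto simp: L_def cspace_def\<close>)
  qed
  have t0L: "t0 \<in> L" using t0 by (simp add: L_def)
  \<comment> \<open>The family generated by F: E and \<open>Phi3\<close> replace the iterated
    applications of the three given maps, so each member is the image of one tensor space over
    F.\<close>
  define U1 where "U1 = blk A3 E ` slices_in A3 F"
  define U2 where "U2 = blk A32 X3 ` slices_in A32 F"
  define Q where "Q = blk {..<h13 D} Phi3 ` slices_in {..<h13 D} F"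
  let ?y = "cvec.dim F"
  have linE: "clinear (blk A3 E)" and linX3: "clinear (blk A32 X3)" and linP: "clinear (blk {..<h13 D} Phi3)"
    and linX2: "clinear (blk A2 X2)"
    using clinear_blk[of A3 E] clinear_blk[of A32 X3] clinear_blk[of "{..<h13 D}" Phi3] clinear_blk[of A2 X2] lin by blast+
  have sub: "cvec.subspace (slices_in A F)" for A :: "nat set" by (rule subspace_slices_in[OF F(1)])
  have fdF: "cvec.findim (slices_in A F)" if "finite A" for A :: "nat set"
    by (rule findim_slices_in[OF F(2) finite_lessThan that])
  have dimF: "cvec.dim (slices_in A F) = card A * ?y" if "finite A" for A :: "nat set"
    by (rule dim_slices_in[OF F finite_lessThan that])
  have U2: "cvec.subspace U2" "U2 \<subseteq> cspace I2"
    unfolding U2_def using cpair.linear_subspace_image[OF linX3 sub] blk_in[of X3 I2] into(2) by auto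
  have U1: "cvec.subspace U1" "U1 \<subseteq> cspace I1"
    unfolding U1_def using cpair.linear_subspace_image[OF linE sub] blk_in[of E I1] into(3) by auto
  have Q: "cvec.subspace Q" "Q \<subseteq> cspace {..<n1}"
    unfolding Q_def using cpair.linear_subspace_image[OF linP sub] blk_in[of Phi3 "{..<n1}"] into(5) by auto
  have r2: "cvec.dim U2 < a32 D * ?y"
    using rank_lt_of_kernel[OF linX3 sub fdF, of A32 t0] t0 t0L LF \<open>t0 \<noteq> 0\<close> dimF[of A32]
    unfolding U2_def by auto
  have q2: "real (cvec.dim Q) \<le> c3' D m3 * real (cvec.dim U2)"
    unfolding Q_def U2_def
  proof (rule c3'_bound[where \<Psi> = Psi2 and ?K0.0 = L])
    show "F \<subseteq> cvec.span {\<lambda>m. t (m, a) |t a. t \<in> L \<and> a < a32 D}" unfolding F_def by simp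
  qed (use D A_pos lin relD F LF in \<open>auto simp: L_def\<close>)
  \<comment> \<open>Elements of the kernel of E, obtained by multiplying L by the basis vectors of
    \<open>A\<^sub>2\<^sub>1\<close>. They are the input for the estimate with
    \<open>c3\<close>.\<close>
  define K0 where "K0 = {contract A32 (mulA D a) t | a t. a < a21 D \<and> t \<in> L}"
  have K0F: "K0 \<subseteq> slices_in A3 F" using contract_mulA[OF F(1)] LF by (auto simp: K0_def)
  have K0ker: "blk A3 E t = 0" if tK: "t \<in> K0" for t
  proof -
    obtain a s where s: "t = contract A32 (mulA D a) s" "a < a21 D" "s \<in> L"
      using tK unfolding K0_def by blast
    then have "blk A3 E t = X2 a (blk A32 X3 s)"
      using X2_blk_X3[of a s] unfolding slices_in_cspace by (simp add: L_def)
    then show ?thesis using s clinearD(3)[OF lin(1)] by (simp add: L_def)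
  qed
  \<comment> \<open>Here \<open>nondeg\<close> enters. For a projection p to ?S and t in L, every
    multiplication annihilates \<open>t - pmap p t\<close>; each row of this difference is then a
    degenerate element of \<open>A\<^sub>3\<^sub>2\<close>, hence 0, and the slices of t lie in
    ?S.\<close>
  have K0span: "F \<subseteq> cvec.span {(\<lambda>m. t (m, c)) | t c. t \<in> K0 \<and> c < a31 D}" (is "F \<subseteq> ?S")
  proof -
    obtain p where p: "clinear p" "range p \<subseteq> ?S" "\<forall>v\<in>?S. p v = v"
      using cvec.exists_projection[OF cvec.subspace_span] by blast
    have fixed: "(\<lambda>m. t (m, b)) \<in> ?S" if t: "t \<in> L" and b: "b < a32 D" for t b
    proof -
      let ?d = "t - pmap p t"
      have contr: "(\<lambda>m. \<Sum>b<a32 D. comp_A D c (b, a) * ?d (m, b)) = 0" if ac: "a < a21 D" "c < a31 D" for a c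
      proof -
        have "contract A32 (mulA D a) t \<in> K0" using t ac by (auto simp: K0_def)
        then have "(\<lambda>m. contract A32 (mulA D a) t (m, c)) \<in> ?S" using ac by (intro cvec.span_base) blast
        then have "p (\<lambda>m. contract A32 (mulA D a) t (m, c)) = (\<lambda>m. contract A32 (mulA D a) t (m, c))"
          using p(3) by blast
        moreover have "contract A32 (mulA D a) (pmap p t) = pmap p (contract A32 (mulA D a) t)"
          by (rule contract_pmap[OF p(1)])
        ultimately have "contract A32 (mulA D a) (pmap p t) (m, c) = contract A32 (mulA D a) t (m, c)" for m
          by (simp add: pmap_def)
        then show ?thesis
          by (simp add: fun_eq_iff contract_def mulA_def right_diff_distrib sum_subtractf)
      qed
      have "t (m, b) = pmap p t (m, b)" for m
      proof -
        have "(\<lambda>b. if b < a32 D then ?d (m, b) else 0) = 0"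
        proof (rule nondeg)
          show "(\<lambda>b. if b < a32 D then ?d (m, b) else 0) \<in> cspace A32" by (auto simp: cspace_def)
          show "(\<Sum>b<a32 D. comp_A D c (b, a) * (if b < a32 D then ?d (m, b) else 0)) = 0"
            if "a < a21 D" "c < a31 D" for a c
            using fun_cong[OF contr[OF that], of m] by simp
        qed
        then show ?thesis using fun_cong[of _ _ b] b by fastforce
      qed
      then have "(\<lambda>m. t (m, b)) = (\<lambda>m. pmap p t (m, b))" by (rule ext)
      moreover have "(\<lambda>m. pmap p t (m, b)) \<in> ?S" unfolding slice_pmap using p(2) by blast
      ultimately show ?thesis by (simp only:)
    qed
    then show ?thesis unfolding F_def by (intro cvec.span_minimal[OF _ cvec.subspace_span]) auto
  qed
  have q1: "real (cvec.dim Q) \<le> c3 D m3 * real (cvec.dim U1)"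
    unfolding Q_def U1_def
  proof (rule c3_bound[where \<Psi> = Psi and ?K0.0 = K0])
    show "F \<subseteq> cvec.span {\<lambda>m. t (m, a) |t a. t \<in> K0 \<and> a < a31 D}" by (rule K0span)
  qed (use D A_pos lin relC F K0F K0ker in auto)
  have "F \<noteq> {0}"
  proof
    assume "F = {0}"
    then have "slices_in A32 F = {0}"
      using dimF[of A32] cvec.findim_dim_zero[OF fdF[of A32]] cvec.subspace_0[OF sub] by (auto simp: cvec.dim_zero_space)
    then show False using t0L LF \<open>t0 \<noteq> 0\<close> by auto
  qed
  then have y: "?y > 0"
    using cvec.findim_dim_zero[OF cvec.findim_subset[OF findim_cspace F(2)]] cvec.subspace_0[OF F(1)] by auto
  \<comment> \<open>The slices of K0 span at least the nonzero space F, so K0 has a nonzero element,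
    and the rank of E on tensors over F drops.\<close>
  have r1: "cvec.dim U1 < a31 D * ?y"
  proof -
    have "\<exists>t\<in>K0. t \<noteq> 0"
    proof (rule ccontr)
      assume "\<not> (\<exists>t\<in>K0. t \<noteq> 0)"
      then have "{(\<lambda>m. t (m, c)) | t c. t \<in> K0 \<and> c < a31 D} \<subseteq> {0}" by (auto simp: fun_eq_iff)
      then have "F \<subseteq> {0}" using K0span cvec.span_minimal[OF _ cvec.subspace_single_0] by blast
      then show False using \<open>F \<noteq> {0}\<close> cvec.subspace_0[OF F(1)] by blast
    qed
    then obtain t where "t \<in> K0" "t \<noteq> 0" by blast
    then show ?thesis
      using rank_lt_of_kernel[OF linE sub fdF, of A3 t] K0F K0ker dimF[of A3] unfolding U1_def by auto
  qed
  \<comment> \<open>U1 lies in the image of \<open>U2 \<otimes> A\<^sub>2\<^sub>1\<close>, as E is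
    made of compositions of \<open>X3\<close> and \<open>X2\<close>. The last alternative of
    \<open>cond\<close> relies on this.\<close>
  have r12: "cvec.dim U1 \<le> a21 D * cvec.dim U2"
  proof -
    have subU2: "cvec.subspace (slices_in A2 U2)" by (rule subspace_slices_in[OF U2(1)])
    have fdU2: "cvec.findim (slices_in A2 U2)" by (rule findim_slices_in[OF U2(2) fin(2) finite_lessThan])
    have "U1 \<subseteq> blk A2 X2 ` slices_in A2 U2"
      unfolding U1_def
    proof clarify
      fix t assume t: "t \<in> slices_in A3 F"
      have S: "cvec.subspace (blk A2 X2 ` slices_in A2 U2)" by (rule cpair.linear_subspace_image[OF linX2 subU2])
      show "blk A3 E t \<in> blk A2 X2 ` slices_in A2 U2"
      proof (rule blk_closed[OF S], rule E_in_X2_X3[OF S])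
        fix c assume c: "c \<in> A3"
        show "c < a31 D" using c by simp
        have tF: "(\<lambda>m. t (m, c)) \<in> F" using slices_inD[OF t c] .
        then show "(\<lambda>m. t (m, c)) \<in> cspace M3" using F(2) by blast
        fix a b assume ab: "a < a21 D" "b < a32 D"
        have "X3 b (\<lambda>m. t (m, c)) \<in> U2"
          unfolding U2_def using ab lin slot_in[OF F(1) tF, of b A32]
          by (intro image_eqI[of _ _ "slot b (\<lambda>m. t (m, c))"]) (simp_all add: blk_slot)
        then have "slot a (X3 b (\<lambda>m. t (m, c))) \<in> slices_in A2 U2" using slot_in[OF U2(1), of _ a A2] ab by simp
        then show "X2 a (X3 b (\<lambda>m. t (m, c))) \<in> blk A2 X2 ` slices_in A2 U2"
          using ab lin by (intro image_eqI[of _ _ "slot a (X3 b (\<lambda>m. t (m, c)))"]) (simp_all add: blk_slot)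
      qed
    qed
    then have "cvec.dim U1 \<le> cvec.dim (blk A2 X2 ` slices_in A2 U2)"
      by (rule cvec.findim_dim_mono[OF cpair.findim_image[OF linX2 fdU2]])
    also have "\<dots> \<le> cvec.dim (slices_in A2 U2)" by (rule cpair.dim_image_le[OF linX2 subU2 fdU2])
    also have "\<dots> = a21 D * cvec.dim U2" using dim_slices_in[OF U2 fin(2), of A2] by simp
    finally show ?thesis .
  qed
  have a31: "a31 D \<le> a32 D * a21 D"
  proof -
    have "cspace A3 = app (A32 \<times> A2) (comp_A D) ` cspace (A32 \<times> A2)"
      using D by (auto simp: composition_system_def surj_map_def)
    then have "cvec.dim (cspace A3) \<le> cvec.dim (cspace (A32 \<times> A2))"
      using cpair.dim_image_le[OF clinear_app subspace_cspace findim_cspace, of "A32 \<times> A2" "A32 \<times> A2" "comp_A D"] by simp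
    then show ?thesis by (simp add: dim_cspace)
  qed
  have ineq: "\<alpha>1 * real (cvec.dim U1) + \<alpha>2 * real (cvec.dim U2) + \<alpha>3 * real ?y - \<mu> * real (cvec.dim Q) \<le> 0"
  proof (rule semistable)
    show "X2 a ` U2 \<subseteq> U1" if "a < a21 D" for a
    proof clarify
      fix u assume "u \<in> U2"
      then obtain t where t: "t \<in> slices_in A32 F" "u = blk A32 X3 t" by (auto simp: U2_def)
      then have "X2 a u = blk A3 E (contract A32 (mulA D a) t)"
        using X2_blk_X3[OF that] slices_in_mono[OF F(2), of A32] by blast
      then show "X2 a u \<in> U1" using contract_mulA[OF F(1) t(1)] by (simp add: U1_def)
    qed
    show "X3 b ` F \<subseteq> U2" if "b < a32 D" for b
    proof clarify
      fix v assume "v \<in> F"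
      then have "slot b v \<in> slices_in A32 F" using slot_in[OF F(1), of v b A32] that by simp
      then show "X3 b v \<in> U2"
        unfolding U2_def using that lin by (intro image_eqI[of _ _ "slot b v"]) (simp_all add: blk_slot)
    qed
    show "Psi l ` U1 \<subseteq> Q" if "l < h11 D" for l
    proof clarify
      fix u assume "u \<in> U1"
      then obtain t where t: "t \<in> slices_in A3 F" "u = blk A3 E t" by (auto simp: U1_def)
      have "t \<in> slices_in A3 (cspace M3)" using t slices_in_mono[OF F(2)] by blast
      then have "blk {..<h13 D} Phi3 (contract A3 (act_31 D l) t) = Psi l u"
        unfolding t(2) using relC lin that by (intro blk_contract[where U = "cspace M3"]) auto
      moreover have "contract A3 (act_31 D l) t \<in> slices_in {..<h13 D} F"
        using act_zero(2) by (intro contract_in[OF F(1) t(1)]) auto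
      ultimately show "Psi l u \<in> Q" unfolding Q_def by (intro image_eqI[OF sym])
    qed
  qed (use U1 U2 F Q y in \<open>auto simp: subspace_of_def\<close>)
  show False
    by (rule numeric_step1[OF pos _ _ _ _ _ _ _ ineq q2 q1 _ _ _ lambda3 cond])
      (use y r1 r2 r12 a31 A_pos in \<open>simp_all flip: of_nat_mult\<close>)
qed

text \<open>Here iota embeds \<open>M\<^sub>2\<close> as a complement to the image of
  \<open>M\<^sub>3 \<otimes> A\<^sub>3\<^sub>2\<close>. By \<open>inj\<close> the subspace generated
  in \<open>P\<^sub>2\<close> by F2 and F3 has its largest possible dimension, while the kernel
  lowers the dimension in \<open>P\<^sub>1\<close>; \<open>c1\<close> limits the dimension in
  \<open>N\<^sub>1\<close> accordingly.\<close>

lemma pencil_injective: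
  fixes m2 :: nat and iota :: "(nat \<Rightarrow> complex) \<Rightarrow> 'q \<Rightarrow> complex"
  assumes iota: "clinear iota" "\<And>v. iota v \<in> cspace I2"
    and inj: "\<And>t. t \<in> cspace ({..<m2} <+> M3 \<times> A32) \<Longrightarrow>
      iota (\<lambda>m. t (Inl m)) + blk A32 X3 (\<lambda>x. t (Inr x)) = 0 \<Longrightarrow> t = 0"
    and cond: "real (a21 D) * \<alpha>1 + \<alpha>2 \<ge> real (a21 D) * \<mu> * c1 D m2 m3"
      "real (a31 D) * \<alpha>1 + real (a32 D) * \<alpha>2 + \<alpha>3 \<ge> real (a31 D) * \<mu> * c1 D m2 m3"
    and t0: "t0 \<in> cspace ({..<m2} \<times> A2 <+> M3 \<times> A3)" "blk2 A2 (\<lambda>a v. X2 a (iota v)) A3 E t0 = 0"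
  shows "t0 = 0"
proof (rule ccontr)
  assume t0_nz: "t0 \<noteq> 0"
  let ?f = "blk2 A2 (\<lambda>a v. X2 a (iota v)) A3 E"
  let ?J2 = "{..<h12 D}" and ?J3 = "{..<h13 D}"
  let ?\<Phi> = "blk2 ?J2 (\<lambda>k v. Psi2 k (iota v)) ?J3 Phi3"
  let ?j = "\<lambda>t. iota (\<lambda>m. t (Inl m)) + blk A32 X3 (\<lambda>x. t (Inr x))"
  define K where "K = {t \<in> cspace ({..<m2} \<times> A2 <+> M3 \<times> A3). ?f t = 0}"
  define F2 where "F2 = cvec.span {(\<lambda>m. t (Inl (m, a))) | t a. t \<in> K \<and> a < a21 D}"
  define F3 where "F3 = cvec.span {(\<lambda>m. t (Inr (m, a))) | t a. t \<in> K \<and> a < a31 D}"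
  have K_slices: "(\<lambda>x. t (Inl x)) \<in> cspace ({..<m2} \<times> A2)" "(\<lambda>x. t (Inr x)) \<in> cspace (M3 \<times> A3)" if "t \<in> K" for t
    using that by (auto simp: K_def cspace_Plus)
  have K_slice: "(\<lambda>m. t (Inl (m, a))) \<in> cspace {..<m2}" "(\<lambda>m. t (Inr (m, a))) \<in> cspace M3" if "t \<in> K" for t a
    using K_slices[OF that] by (auto simp: cspace_def)
  have F2: "cvec.subspace F2" "F2 \<subseteq> cspace {..<m2}"
    unfolding F2_def using K_slice by (intro cvec.subspace_span, intro cvec.span_minimal[OF _ subspace_cspace]) blast
  have F3: "cvec.subspace F3" "F3 \<subseteq> cspace M3"
    unfolding F3_def using K_slice by (intro cvec.subspace_span, intro cvec.span_minimal[OF _ subspace_cspace]) blast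
  let ?V = "\<lambda>A B. sum_space (slices_in A F2) (slices_in B F3)"
  have KV: "K \<subseteq> ?V A2 A3"
  proof
    fix t assume t: "t \<in> K"
    have "(\<lambda>x. t (Inl x)) \<in> slices_in A2 F2"
    proof (rule slices_inI)
      show "(\<lambda>m. t (Inl (m, b))) \<in> F2" if "b \<in> A2" for b
        unfolding F2_def using t that by (intro cvec.span_base) auto
    qed (use K_slices[OF t] in \<open>auto simp: cspace_def\<close>)
    moreover have "(\<lambda>x. t (Inr x)) \<in> slices_in A3 F3"
    proof (rule slices_inI)
      show "(\<lambda>m. t (Inr (m, b))) \<in> F3" if "b \<in> A3" for b
        unfolding F3_def using t that by (intro cvec.span_base) auto
    qed (use K_slices[OF t] in \<open>auto simp: cspace_def\<close>)
    ultimately show "t \<in> ?V A2 A3" by (simp add: sum_space_iff)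
  qed
  have VC: "?V A B \<subseteq> cspace ({..<m2} \<times> A <+> M3 \<times> B)" for A B :: "nat set"
    using sum_space_mono[OF slices_in_mono[OF F2(2), of A] slices_in_mono[OF F3(2), of B]]
    by (simp add: slices_in_cspace sum_space_cspace)
  define U1 where "U1 = ?f ` ?V A2 A3"
  define U2 where "U2 = ?j ` sum_space F2 (slices_in A32 F3)"
  define Q where "Q = ?\<Phi> ` ?V ?J2 ?J3"
  have lini: "clinear (\<lambda>v. X2 a (iota v))" "clinear (\<lambda>v. Psi2 k (iota v))" for a k
    using clinear_compose[OF lin(1) iota(1)] clinear_compose[OF lin(5) iota(1)] by auto
  have linf: "clinear ?f" by (rule clinear_blk2[OF lini(1) lin(4)])
  have linP: "clinear ?\<Phi>" by (rule clinear_blk2[OF lini(2) lin(6)])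
  have linj: "clinear ?j"
    by (rule clinear_add[OF clinear_compose[OF iota(1) clinear_reindex] clinear_compose[OF clinear_blk[OF lin(2)] clinear_reindex]])
  have subV: "cvec.subspace (?V A B)" for A B :: "nat set"
    by (rule subspace_sum_space[OF subspace_slices_in[OF F2(1)] subspace_slices_in[OF F3(1)]])
  have fdV: "cvec.findim (?V A B)" if "finite A" "finite B" for A B :: "nat set"
    using cvec.findim_subset[OF findim_cspace VC, of A B] that by simp
  have subj: "cvec.subspace (sum_space F2 (slices_in A32 F3))"
    by (rule subspace_sum_space[OF F2(1) subspace_slices_in[OF F3(1)]])
  have jC: "sum_space F2 (slices_in A32 F3) \<subseteq> cspace ({..<m2} <+> M3 \<times> A32)"
    using sum_space_mono[OF F2(2) slices_in_mono[OF F3(2), of A32]]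
    by (simp add: slices_in_cspace sum_space_cspace)
  have U1: "cvec.subspace U1" "U1 \<subseteq> cspace I1"
  proof -
    show "cvec.subspace U1" unfolding U1_def by (rule cpair.linear_subspace_image[OF linf subV])
    have "?f t \<in> cspace I1" for t
      unfolding blk2_def using into by (intro cvec.subspace_add[OF subspace_cspace] blk_in)
    then show "U1 \<subseteq> cspace I1" by (auto simp: U1_def)
  qed
  have U2: "cvec.subspace U2" "U2 \<subseteq> cspace I2"
  proof -
    show "cvec.subspace U2" unfolding U2_def by (rule cpair.linear_subspace_image[OF linj subj])
    have "?j t \<in> cspace I2" for t
      using into(2) iota(2) by (intro cvec.subspace_add[OF subspace_cspace] blk_in)
    then show "U2 \<subseteq> cspace I2" by (auto simp: U2_def)
  qed
  have Q: "cvec.subspace Q" "Q \<subseteq> cspace {..<n1}"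
  proof -
    show "cvec.subspace Q" unfolding Q_def by (rule cpair.linear_subspace_image[OF linP subV])
    have "?\<Phi> t \<in> cspace {..<n1}" for t
      unfolding blk2_def using into by (intro cvec.subspace_add[OF subspace_cspace] blk_in)
    then show "Q \<subseteq> cspace {..<n1}" by (auto simp: Q_def)
  qed
  let ?x = "cvec.dim F2" and ?y = "cvec.dim F3"
  have dimU2: "cvec.dim U2 = ?x + a32 D * ?y"
  proof -
    have "cvec.dim U2 = cvec.dim (sum_space F2 (slices_in A32 F3))"
      unfolding U2_def
    proof (rule cpair.dim_image_inj[OF linj subj])
      show "cvec.findim (sum_space F2 (slices_in A32 F3))"
        using cvec.findim_subset[OF findim_cspace jC] by simp
    qed (use inj jC in blast)
    also have "\<dots> = ?x + cvec.dim (slices_in A32 F3)"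
      using slices_in_mono[OF F3(2), of A32] subspace_slices_in[OF F3(1)]
      by (intro dim_sum_space[OF F2 finite_lessThan, of _ "M3 \<times> A32"]) (auto simp: slices_in_cspace)
    finally show ?thesis using dim_slices_in[OF F3 finite_lessThan, of A32] by simp
  qed
  have dimV: "cvec.dim (?V A2 A3) = a21 D * ?x + a31 D * ?y"
  proof -
    have "cvec.dim (?V A2 A3) = cvec.dim (slices_in A2 F2) + cvec.dim (slices_in A3 F3)"
      using slices_in_mono[OF F3(2), of A3] subspace_slices_in[OF F3(1)]
        slices_in_mono[OF F2(2), of A2] subspace_slices_in[OF F2(1)]
      by (intro dim_sum_space[of _ "{..<m2} \<times> A2" _ "M3 \<times> A3"]) (auto simp: slices_in_cspace)
    then show ?thesis using dim_slices_in[OF F3 finite_lessThan, of A3] dim_slices_in[OF F2 finite_lessThan, of A2] by simp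
  qed
  have r: "cvec.dim U1 < a21 D * ?x + a31 D * ?y"
    using rank_lt_of_kernel[OF linf subV fdV, of A2 A3 t0] t0 t0_nz KV dimV unfolding U1_def by (auto simp: K_def)
  have q: "real (cvec.dim Q) \<le> c1 D m2 m3 * real (cvec.dim U1)"
    unfolding Q_def U1_def
  proof (rule c1_bound[where \<Psi> = Psi and ?K0.0 = K, OF D A_pos(1,2) lini(1) lin(4,3) lini(2) lin(6)])
    show "F2 \<subseteq> cvec.span {\<lambda>m. t (Inl (m, a)) |t a. t \<in> K \<and> a < a21 D}" unfolding F2_def by simp
    show "F3 \<subseteq> cvec.span {\<lambda>m. t (Inr (m, a)) |t a. t \<in> K \<and> a < a31 D}" unfolding F3_def by simp
  qed (use relB[OF _ _ iota(2)] relC F2 F3 KV in \<open>auto simp: K_def\<close>)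
  \<comment> \<open>The strict bound excludes F2 = F3 = 0, so the family to be tested is not
    zero.\<close>
  have "0 < a21 D * ?x + a31 D * ?y" using r by linarith
  then have "?x > 0 \<or> ?y > 0" by (cases ?x; cases ?y) auto
  then have nz: "cvec.dim U2 > 0 \<or> ?y > 0" using dimU2 by auto
  have ineq: "\<alpha>1 * real (cvec.dim U1) + \<alpha>2 * real (cvec.dim U2) + \<alpha>3 * real ?y - \<mu> * real (cvec.dim Q) \<le> 0"
  proof (rule semistable)
    show "X2 a ` U2 \<subseteq> U1" if a: "a < a21 D" for a
    proof clarify
      fix u assume "u \<in> U2"
      then obtain t where t: "t \<in> sum_space F2 (slices_in A32 F3)" "u = ?j t" unfolding U2_def by blast
      then have t': "(\<lambda>m. t (Inl m)) \<in> F2" "(\<lambda>x. t (Inr x)) \<in> slices_in A32 F3" by (simp_all add: sum_space_iff)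
      \<comment> \<open>Multiplication by a lifted to tensors: the part in F2 is placed in slot a,
        the part over F3 is multiplied into \<open>A\<^sub>3\<^sub>1\<close>.\<close>
      let ?s = "case_sum (slot a (\<lambda>m. t (Inl m))) (contract A32 (mulA D a) (\<lambda>x. t (Inr x)))"
      have "(\<lambda>x. t (Inr x)) \<in> slices_in A32 (cspace M3)" using t'(2) slices_in_mono[OF F3(2), of A32] by blast
      then have "X2 a u = ?f ?s"
        using X2_blk_X3[OF a] blk_slot[of A2 a "\<lambda>a v. X2 a (iota v)"] a lini
        by (simp add: t(2) blk2_def clinearD(1)[OF lin(1)])
      moreover have "?s \<in> ?V A2 A3"
        using slot_in[OF F2(1) t'(1), of a A2] contract_mulA[OF F3(1) t'(2)] a by (simp add: sum_space_iff)
      ultimately show "X2 a u \<in> U1" by (simp add: U1_def)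
    qed
    show "X3 b ` F3 \<subseteq> U2" if b: "b < a32 D" for b
    proof clarify
      fix v assume v: "v \<in> F3"
      let ?s = "case_sum (\<lambda>_. 0) (slot b v)"
      have "?s \<in> sum_space F2 (slices_in A32 F3)"
        using slot_in[OF F3(1) v, of b A32] b cvec.subspace_0[OF F2(1)] by (simp add: sum_space_iff zero_fun_def)
      moreover have "?j ?s = X3 b v"
        using blk_slot[of A32 b X3] b lin clinearD(3)[OF iota(1)] by (simp add: zero_fun_def)
      ultimately show "X3 b v \<in> U2" unfolding U2_def by (intro image_eqI[OF sym])
    qed
    show "Psi l ` U1 \<subseteq> Q" if l: "l < h11 D" for l
    proof clarify
      fix u assume "u \<in> U1"
      then obtain t where t: "t \<in> ?V A2 A3" "u = ?f t" unfolding U1_def by blast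
      then have t': "(\<lambda>x. t (Inl x)) \<in> slices_in A2 F2" "(\<lambda>x. t (Inr x)) \<in> slices_in A3 F3" by (simp_all add: sum_space_iff)
      let ?s = "case_sum (contract A2 (act_21 D l) (\<lambda>x. t (Inl x))) (contract A3 (act_31 D l) (\<lambda>x. t (Inr x)))"
      have "?\<Phi> ?s = Psi l u"
        unfolding t(2) using relB[OF _ _ iota(2)] relC lini lin l subsetD[OF VC t(1)]
        by (intro blk2_delta1[where k = m2]) auto
      moreover have "?s \<in> ?V ?J2 ?J3"
        using contract_in[OF F2(1) t'(1), of ?J2 "act_21 D l"] contract_in[OF F3(1) t'(2), of ?J3 "act_31 D l"] act_zero
        by (auto simp: sum_space_iff)
      ultimately show "Psi l u \<in> Q" unfolding Q_def by (intro image_eqI[OF sym])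
    qed
  qed (use U1 U2 F3 Q nz in \<open>auto simp: subspace_of_def\<close>)
  show False
  proof (rule numeric_step2[OF pos])
    show "\<alpha>1 * real (cvec.dim U1) + \<alpha>2 * (real ?x + real (a32 D) * real ?y) + \<alpha>3 * real ?y - \<mu> * real (cvec.dim Q) \<le> 0"
      using ineq dimU2 by simp
    show "real (cvec.dim U1) < real (a21 D) * real ?x + real (a31 D) * real ?y"
      using r by (simp flip: of_nat_mult of_nat_add)
  qed (use q cond in auto)
qed

end

section \<open>Z and its closure\<close>

lemma app_cong: "(\<And>j i. i \<in> I \<Longrightarrow> X j i = Y j i) \<Longrightarrow> app I X v = app I Y v"
  by (simp add: app_def)

lemma clinear_eq_on_units:
  assumes "clinear f" "clinear g" "finite I" "\<And>i. i \<in> I \<Longrightarrow> f (unit i) = g (unit i)" "v \<in> cspace I"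
  shows "f v = g v"
  using cpair.linear_eq_on[OF assms(1,2), of v "unit ` I"] assms(3-5) span_units by blast

lemma app_units:
  assumes "clinear F" "finite I" "v \<in> cspace I"
  shows "app I (\<lambda>n m. F (unit m) n) v = F v"
  by (rule clinear_eq_on_units[OF clinear_app assms(1,2) _ assms(3)]) (simp add: app_unit assms(2))

lemma app_GL_inverse:
  assumes "finite I" "g \<in> GL I"
  obtains g' where "g' \<in> Hom I I" "\<And>v. v \<in> cspace I \<Longrightarrow> app I g (app I g' v) = v"
    "\<And>v. v \<in> cspace I \<Longrightarrow> app I g' (app I g v) = v"
proof -
  obtain g' where "is_inverse I g g'" using assms by (auto simp: GL_def)
  then show thesis
    using that[of g'] assms by (auto simp: is_inverse_def app_comp_map[symmetric] app_id_map)
qed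

lemma app_Plus:
  assumes "finite A" "finite B"
  shows "app (A <+> B) X t = app A (\<lambda>j i. X j (Inl i)) (\<lambda>i. t (Inl i)) + app B (\<lambda>j i. X j (Inr i)) (\<lambda>i. t (Inr i))"
  using assms by (auto simp: app_def fun_eq_iff sum.Plus)

lemma app_Times: "app (M \<times> A) X t = blk A (\<lambda>a. app M (\<lambda>j i. X j (i, a))) t"
proof
  fix j
  have "app (M \<times> A) X t j = (\<Sum>m\<in>M. \<Sum>a\<in>A. X j (m, a) * t (m, a))"
    unfolding app_def sum.cartesian_product by (intro sum.cong) auto
  also have "\<dots> = (\<Sum>a\<in>A. \<Sum>m\<in>M. X j (m, a) * t (m, a))" by (rule sum.swap)
  finally show "app (M \<times> A) X t j = blk A (\<lambda>a. app M (\<lambda>j i. X j (i, a))) t j"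
    by (simp add: blk_def app_def sum_fun_apply)
qed

lemma contract_slot:
  assumes "finite A" "a \<in> A"
  shows "contract A X (slot a v) = (\<lambda>(m, j). X (j, a) * v m)"
proof -
  have "(\<Sum>b\<in>A. X (j, b) * slot a v (m, b)) = (\<Sum>b\<in>A. if b = a then X (j, a) * v m else 0)" for j m
    by (intro sum.cong) (auto simp: slot_def)
  then show ?thesis using assms by (auto simp: contract_def fun_eq_iff)
qed

section \<open>Polynomial functions of a point and determinants of matrices of such
  functions\<close>

lemma polyfuns_sum:
  "(\<And>i. i \<in> S \<Longrightarrow> f i \<in> polyfuns L) \<Longrightarrow> (\<lambda>x. \<Sum>i\<in>S. f i x) \<in> polyfuns L"
  by (induction S rule: infinite_finite_induct) (auto intro: polyfuns.intros)

lemma polyfuns_prod: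
  "(\<And>i. i \<in> S \<Longrightarrow> f i \<in> polyfuns L) \<Longrightarrow> (\<lambda>x. \<Prod>i\<in>S. f i x) \<in> polyfuns L"
  by (induction S rule: infinite_finite_induct) (auto intro: polyfuns.intros)

lemma polyfuns_cmult: "f \<in> polyfuns L \<Longrightarrow> (\<lambda>x. c * f x) \<in> polyfuns L"
  by (rule polyfuns.mult[OF polyfuns.const])

lemma polyfuns_diff:
  assumes "f \<in> polyfuns L" "g \<in> polyfuns L"
  shows "(\<lambda>x. f x - g x) \<in> polyfuns L"
  using polyfuns.add[OF assms(1) polyfuns_cmult[OF assms(2), of "- 1"]] by simp

lemma polyfuns_pt_coords:
  "(\<lambda>x. fst x r s) \<in> polyfuns pt_coords" "(\<lambda>x. fst (snd x) r' s') \<in> polyfuns pt_coords"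
  "(\<lambda>x. snd (snd x) r'' s'') \<in> polyfuns pt_coords"
proof -
  have eq: "(\<lambda>x. fst x r s) = (\<lambda>(x2, x3, psi). x2 r s)" "(\<lambda>x. fst (snd x) r' s') = (\<lambda>(x2, x3, psi). x3 r' s')"
    "(\<lambda>x. snd (snd x) r'' s'') = (\<lambda>(x2, x3, psi). psi r'' s'')" by auto
  show "(\<lambda>x. fst x r s) \<in> polyfuns pt_coords" "(\<lambda>x. fst (snd x) r' s') \<in> polyfuns pt_coords"
    "(\<lambda>x. snd (snd x) r'' s'') \<in> polyfuns pt_coords"
    unfolding eq pt_coords_def by (rule polyfuns.coordinate, blast)+
qed

lemma polyfuns_app:
  assumes "\<And>j i. (\<lambda>x. X x j i) \<in> polyfuns L" "\<And>i. (\<lambda>x. u x i) \<in> polyfuns L"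
  shows "(\<lambda>x. app I (X x) (u x) j) \<in> polyfuns L"
  unfolding app_def using assms by (intro polyfuns_sum polyfuns.mult)

text \<open>Y arises from e by the transpose of C, and the transpose of R undoes this. The factors
  in a factorization through a surjection are thus unique, and given by a formula linear in
  Y.\<close>

lemma right_inverse_determines:
  assumes fin: "finite S" "finite T" and R: "comp_map S C R = id_map T"
    and Y: "\<And>s. s \<in> S \<Longrightarrow> Y s = (\<Sum>t\<in>T. C t s * e t)" and t: "t \<in> T"
  shows "(\<Sum>s\<in>S. R s t * Y s) = e t"
proof -
  have "(\<Sum>s\<in>S. R s t * Y s) = (\<Sum>s\<in>S. \<Sum>t'\<in>T. (C t' s * R s t) * e t')"
    using Y by (intro sum.cong) (auto simp: sum_distrib_left mult_ac)
  also have "\<dots> = (\<Sum>t'\<in>T. comp_map S C R t' t * e t')"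
    by (subst sum.swap) (simp add: comp_map_def sum_distrib_right)
  also have "\<dots> = (\<Sum>t'\<in>T. if t' = t then e t' else 0)"
    unfolding R by (intro sum.cong) (auto simp: id_map_def)
  finally show ?thesis using fin t by simp
qed

lemma app_zero: "app I X 0 = 0"
  by (simp add: app_def fun_eq_iff)

lemma surj_map_domain_nonempty:
  assumes "surj_map S T X" "T \<noteq> {}"
  shows "S \<noteq> {}"
proof
  assume "S = {}"
  obtain t where t: "t \<in> T" using assms(2) by blast
  then have "unit t \<in> app S X ` cspace S" using assms(1) unit_in_cspace[OF t] unfolding surj_map_def by simp
  then have "unit t t = 0" by (auto simp: \<open>S = {}\<close> app_def)
  then show False by (simp add: unit_def)
qed

text \<open>d is the determinant of the matrix \<open>f i j\<close>, polynomial by the Leibniz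
  formula. The enumeration e passes from I to the numbers that index matrices. Only the vanishing on
  singular matrices and the value at the identity matter later.\<close>

lemma polyfuns_det:
  fixes f :: "'i \<Rightarrow> 'i \<Rightarrow> 'x \<Rightarrow> complex"
  assumes I: "finite I" and f: "\<And>i j. f i j \<in> polyfuns L"
  obtains d where "d \<in> polyfuns L"
    "\<And>x v. (\<And>i. i \<in> I \<Longrightarrow> (\<Sum>j\<in>I. f i j x * v j) = 0) \<Longrightarrow> (\<exists>i\<in>I. v i \<noteq> 0) \<Longrightarrow> d x = 0"
    "\<And>x. (\<And>i j. i \<in> I \<Longrightarrow> j \<in> I \<Longrightarrow> f i j x = (if i = j then 1 else 0)) \<Longrightarrow> d x = 1"
proof -
  define n where "n = card I"
  obtain e where e: "bij_betw e {0..<n} I" using ex_bij_betw_nat_finite[OF I] n_def by blast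
  then have eI: "e i \<in> I" if "i < n" for i using that by (auto simp: bij_betw_def)
  define A where "A = (\<lambda>x. mat n n (\<lambda>(i, j). f (e i) (e j) x))"
  have A: "A x \<in> carrier_mat n n" for x by (simp add: A_def)
  have "(\<lambda>x. det (A x)) \<in> polyfuns L"
  proof -
    have "det (A x) = (\<Sum>p\<in>{p. p permutes {0..<n}}. signof p * (\<Prod>i = 0..<n. f (e i) (e (p i)) x))" for x
      unfolding det_def'[OF A]
    proof (intro sum.cong refl arg_cong2[of _ _ _ _ "(*)"] prod.cong)
      fix p i assume "p \<in> {p. p permutes {0..<n}}" "i \<in> {0..<n}"
      then show "A x $$ (i, p i) = f (e i) (e (p i)) x"
        using permutes_in_image[of p "{0..<n}" i] by (auto simp: A_def)
    qed
    then show ?thesis using f by (simp add: polyfuns_sum polyfuns_cmult polyfuns_prod)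
  qed
  moreover have "det (A x) = 0"
    if v: "\<And>i. i \<in> I \<Longrightarrow> (\<Sum>j\<in>I. f i j x * v j) = 0" "\<exists>i\<in>I. v i \<noteq> 0" for x v
  proof -
    let ?v = "vec n (\<lambda>i. v (e i))"
    have "A x *\<^sub>v ?v = 0\<^sub>v n"
    proof (rule eq_vecI)
      fix i assume "i < dim_vec (0\<^sub>v n :: complex vec)"
      then have i: "i < n" by simp
      have "(A x *\<^sub>v ?v) $ i = (\<Sum>j = 0..<n. f (e i) (e j) x * v (e j))"
        using i by (simp add: A_def scalar_prod_def)
      also have "\<dots> = (\<Sum>j\<in>I. f (e i) j x * v j)"
        by (rule sum.reindex_bij_betw[OF e])
      finally show "(A x *\<^sub>v ?v) $ i = 0\<^sub>v n $ i" using v(1)[OF eI[OF i]] i by simp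
    qed (simp add: A_def)
    moreover have "?v \<noteq> 0\<^sub>v n"
    proof -
      obtain i where "i < n" "v (e i) \<noteq> 0" using v(2) e by (auto simp: bij_betw_def)
      then have "?v $ i \<noteq> 0\<^sub>v n $ i" by simp
      then show ?thesis by metis
    qed
    ultimately show ?thesis using det_0_iff_vec_prod_zero_field[OF A, of x] by (metis vec_carrier)
  qed
  moreover have "det (A x) = 1"
    if x: "\<And>i j. i \<in> I \<Longrightarrow> j \<in> I \<Longrightarrow> f i j x = (if i = j then 1 else 0)" for x
  proof -
    have "e i = e j \<longleftrightarrow> i = j" if "i < n" "j < n" for i j
      using e that by (auto simp: bij_betw_def inj_on_def)
    then have "A x = 1\<^sub>m n" using x eI by (intro eq_matI) (auto simp: A_def)
    then show ?thesis by simp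
  qed
  ultimately show thesis using that[of "\<lambda>x. det (A x)"] by blast
qed


locale setting =
  fixes D :: comp_data and m1 m2 m3 n1 :: nat
  assumes D: "composition_system D"
begin

abbreviation "A2 \<equiv> {..<a21 D}"
abbreviation "A3 \<equiv> {..<a31 D}"
abbreviation "A32 \<equiv> {..<a32 D}"
abbreviation "H1 \<equiv> {..<h11 D}"
abbreviation "H2 \<equiv> {..<h12 D}"
abbreviation "H3 \<equiv> {..<h13 D}"
abbreviation "M3 \<equiv> {..<m3}"
abbreviation "I1 \<equiv> P1 D m1 m2 m3"
abbreviation "I2 \<equiv> P2 D m2 m3"

definition X2 :: "pt \<Rightarrow> nat \<Rightarrow> (ix2 \<Rightarrow> complex) \<Rightarrow> ix1 \<Rightarrow> complex" where
  "X2 x a = app I2 (sl (fst x) a)"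
definition X3 :: "pt \<Rightarrow> nat \<Rightarrow> (nat \<Rightarrow> complex) \<Rightarrow> ix2 \<Rightarrow> complex" where
  "X3 x b = app M3 (sl (fst (snd x)) b)"
definition Psi :: "pt \<Rightarrow> nat \<Rightarrow> (ix1 \<Rightarrow> complex) \<Rightarrow> nat \<Rightarrow> complex" where
  "Psi x l = app I1 (sl (snd (snd x)) l)"

lemma finite_I: "finite I1" "finite I2"
  by (auto simp: P1_def P2_def)

lemma D_Hom: "comp_A D \<in> Hom (A32 \<times> A2) A3" "act_21 D \<in> Hom (H2 \<times> A2) H1"
  "act_31 D \<in> Hom (H3 \<times> A3) H1" "act_32 D \<in> Hom (H3 \<times> A32) H2"
  using D by (auto simp: composition_system_def)

lemma D_surj: "surj_map (A32 \<times> A2) A3 (comp_A D)" "surj_map (H3 \<times> A3) H1 (act_31 D)"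
  "surj_map (H2 \<times> A2) H1 (act_21 D)"
  "surj_map (A2 \<times> H1) H2 (dual_act (act_21 D))" "surj_map (A3 \<times> H1) H3 (dual_act (act_31 D))"
  using D by (auto simp: composition_system_def)

lemma app_tensor_units:
  assumes "i \<in> I" "j \<in> J" "finite I" "finite J"
  shows "app (I \<times> J) X (tensor (unit i) (unit j)) = (\<lambda>k. X k (i, j))"
proof -
  have "tensor (unit i) (unit j) = unit (i, j)"
    by (auto simp: tensor_def unit_def fun_eq_iff)
  then show ?thesis using app_unit[of "I \<times> J" "(i, j)" X] assms by simp
qed

text \<open>The associativity axiom evaluated at unit vectors.\<close>

lemma assoc:
  assumes "l < h11 D" "k < h13 D" "b < a32 D" "a < a21 D"
  shows "(\<Sum>j<h12 D. act_21 D l (j, a) * act_32 D j (k, b)) = (\<Sum>c<a31 D. act_31 D l (k, c) * comp_A D c (b, a))"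
proof -
  have eq: "app (H2 \<times> A2) (act_21 D) (tensor (app (H3 \<times> A32) (act_32 D) (tensor (unit k) (unit b))) (unit a))
    = app (H3 \<times> A3) (act_31 D) (tensor (unit k) (app (A32 \<times> A2) (comp_A D) (tensor (unit b) (unit a))))"
    using D assms unit_in_cspace[of k H3] unit_in_cspace[of b A32] unit_in_cspace[of a A2]
    unfolding composition_system_def by simp
  have "app (H2 \<times> A2) (act_21 D) (tensor (\<lambda>j. act_32 D j (k, b)) (unit a)) l
      = (\<Sum>j<h12 D. act_21 D l (j, a) * act_32 D j (k, b))"
    using assms by (subst app_tensor_unit) auto
  moreover have "app (H3 \<times> A3) (act_31 D) (tensor (unit k) (\<lambda>c. comp_A D c (b, a))) l
      = (\<Sum>c<a31 D. act_31 D l (k, c) * comp_A D c (b, a))"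
  proof -
    have "app (H3 \<times> A3) (act_31 D) (tensor (unit k) (\<lambda>c. comp_A D c (b, a))) l
        = (\<Sum>j\<in>H3. \<Sum>c\<in>A3. act_31 D l (j, c) * (unit k j * comp_A D c (b, a)))"
      unfolding app_def tensor_def sum.cartesian_product by (intro sum.cong) auto
    also have "\<dots> = (\<Sum>j\<in>H3. if j = k then \<Sum>c\<in>A3. act_31 D l (k, c) * comp_A D c (b, a) else 0)"
      by (intro sum.cong) (auto simp: unit_def)
    finally show ?thesis using assms by simp
  qed
  ultimately show ?thesis
    using fun_cong[OF eq, of l] assms by (simp add: app_tensor_units)
qed

section \<open>The point \<open>zeta\<close> in slices, and membership in Z\<close>

text \<open>\<open>Xi3 b\<close>, \<open>Xi2 a\<close> and \<open>Gam w l\<close> are the slices of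
  the three components of \<open>zeta\<close> at basis vectors (\<open>app_xi3\<close>,
  \<open>app_xi2\<close>, \<open>app_gamma\<close>), written with tensor operations so that their
  compositions can be computed.\<close>

definition Xi3 :: "nat \<Rightarrow> (nat \<Rightarrow> complex) \<Rightarrow> ix2 \<Rightarrow> complex" where
  "Xi3 b v = case_sum (\<lambda>_. 0) (slot b v)"
definition Xi2 :: "nat \<Rightarrow> (ix2 \<Rightarrow> complex) \<Rightarrow> ix1 \<Rightarrow> complex" where
  "Xi2 a u = case_sum (\<lambda>_. 0) (case_sum (slot a (\<lambda>m. u (Inl m))) (contract A32 (mulA D a) (\<lambda>s. u (Inr s))))"
definition \<phi>1 :: "wpt \<Rightarrow> nat \<Rightarrow> (nat \<Rightarrow> complex) \<Rightarrow> nat \<Rightarrow> complex" where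
  "\<phi>1 w l = app {..<m1} (\<lambda>n m. fst w (n, l) m)"
definition \<phi>2 :: "wpt \<Rightarrow> nat \<Rightarrow> (nat \<Rightarrow> complex) \<Rightarrow> nat \<Rightarrow> complex" where
  "\<phi>2 w k = app {..<m2} (\<lambda>n m. fst (snd w) (n, k) m)"
definition \<phi>3 :: "wpt \<Rightarrow> nat \<Rightarrow> (nat \<Rightarrow> complex) \<Rightarrow> nat \<Rightarrow> complex" where
  "\<phi>3 w k = app {..<m3} (\<lambda>n m. snd (snd w) (n, k) m)"
definition Gam :: "wpt \<Rightarrow> nat \<Rightarrow> (ix1 \<Rightarrow> complex) \<Rightarrow> nat \<Rightarrow> complex" where
  "Gam w l r = \<phi>1 w l (\<lambda>m. r (Inl m)) + blk2 H2 (\<phi>2 w) H3 (\<phi>3 w)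
    (case_sum (contract A2 (act_21 D l) (\<lambda>s. r (Inr (Inl s)))) (contract A3 (act_31 D l) (\<lambda>s. r (Inr (Inr s)))))"

lemma app_xi3:
  assumes "b < a32 D" "v \<in> cspace M3"
  shows "app M3 (sl (xi3 D m3) b) v = Xi3 b v"
proof
  fix p :: ix2
  show "app M3 (sl (xi3 D m3) b) v p = Xi3 b v p"
  proof (cases p)
    case (Inl m)
    then show ?thesis by (simp add: app_def xi3_def Xi3_def)
  next
    case (Inr s)
    obtain m b' where s: "s = (m, b')" by (cases s)
    have "(\<Sum>i\<in>M3. id_map (M3 \<times> A32) (m, b') (i, b) * v i) = (\<Sum>i\<in>M3. if i = m then (if b' = b then v m else 0) else 0)"
      using assms by (intro sum.cong) (auto simp: id_map_def)
    then show ?thesis using assms(2) by (auto simp: Inr s app_def xi3_def Xi3_def slot_def cspace_def)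
  qed
qed

lemma app_xi2:
  assumes "a < a21 D" "u \<in> cspace I2"
  shows "app I2 (sl (xi2 D m2 m3) a) u = Xi2 a u"
proof
  fix r :: ix1
  have u: "(\<lambda>m. u (Inl m)) \<in> cspace {..<m2}" "(\<lambda>s. u (Inr s)) \<in> cspace (M3 \<times> A32)"
    using assms(2) by (simp_all add: P2_def cspace_Plus)
  have split: "app I2 (sl (xi2 D m2 m3) a) u r = (\<Sum>m<m2. xi2 D m2 m3 r (Inl m, a) * u (Inl m))
      + (\<Sum>s\<in>M3 \<times> A32. xi2 D m2 m3 r (Inr s, a) * u (Inr s))"
    by (simp add: P2_def app_Plus) (simp add: app_def)
  consider m where "r = Inl m" | m a' where "r = Inr (Inl (m, a'))" | m c where "r = Inr (Inr (m, c))"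
    by (metis old.prod.exhaust sum.exhaust)
  then show "app I2 (sl (xi2 D m2 m3) a) u r = Xi2 a u r"
  proof cases
    case 1
    then show ?thesis unfolding split by (simp add: xi2_def Xi2_def)
  next
    case (2 m a')
    have "(\<Sum>i<m2. xi2 D m2 m3 r (Inl i, a) * u (Inl i)) = (\<Sum>i<m2. if i = m then (if a' = a then u (Inl m) else 0) else 0)"
      using assms(1) by (intro sum.cong) (auto simp: 2 xi2_def id_map_def)
    moreover have "(\<Sum>s\<in>M3 \<times> A32. xi2 D m2 m3 r (Inr s, a) * u (Inr s)) = 0"
      by (intro sum.neutral) (auto simp: 2 xi2_def)
    ultimately show ?thesis unfolding split using u(1) by (auto simp: 2 Xi2_def slot_def cspace_def)
  next
    case (3 m c)
    have "(\<Sum>s\<in>M3 \<times> A32. xi2 D m2 m3 r (Inr s, a) * u (Inr s))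
        = (\<Sum>(m', b)\<in>M3 \<times> A32. id_map M3 m m' * comp_A D c (b, a) * u (Inr (m', b)))"
      by (intro sum.cong) (auto simp: 3 xi2_def)
    also have "\<dots> = (\<Sum>b\<in>A32. comp_A D c (b, a) * u (Inr (m, b)))"
      by (rule sum_id_map_block[OF finite_lessThan u(2)])
    finally show ?thesis unfolding split by (simp add: 3 xi2_def Xi2_def contract_def mulA_def)
  qed
qed

lemma blk_phi_contract:
  "(\<Sum>(m, a)\<in>M \<times> A. (\<Sum>k<h. F (n, k) m * X (k, a)) * t (m, a))
    = blk {..<h} (\<lambda>k. app M (\<lambda>n m. F (n, k) m)) (contract A X t) n"
proof -
  have "(\<Sum>(m, a)\<in>M \<times> A. (\<Sum>k<h. F (n, k) m * X (k, a)) * t (m, a))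
      = (\<Sum>m\<in>M. \<Sum>a\<in>A. \<Sum>k<h. F (n, k) m * (X (k, a) * t (m, a)))"
    by (simp add: sum.cartesian_product[symmetric] sum_distrib_right mult.assoc)
  also have "\<dots> = (\<Sum>m\<in>M. \<Sum>k<h. F (n, k) m * (\<Sum>a\<in>A. X (k, a) * t (m, a)))"
    by (simp add: sum_distrib_left sum.swap[of _ A "{..<h}"])
  also have "\<dots> = (\<Sum>k<h. \<Sum>m\<in>M. F (n, k) m * (\<Sum>a\<in>A. X (k, a) * t (m, a)))"
    by (rule sum.swap)
  finally show ?thesis by (simp add: blk_def sum_fun_apply app_def contract_def)
qed

lemma app_gamma:
  "app I1 (\<lambda>n p. gamma D w (n, l) p) r = Gam w l r"
proof
  fix n
  obtain f1 f2 f3 where w: "w = (f1, f2, f3)" by (cases w)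
  have "app I1 (\<lambda>n p. gamma D w (n, l) p) r n = (\<Sum>m<m1. f1 (n, l) m * r (Inl m))
      + ((\<Sum>(m, a)\<in>{..<m2} \<times> A2. (\<Sum>k<h12 D. f2 (n, k) m * act_21 D l (k, a)) * r (Inr (Inl (m, a))))
      + (\<Sum>(m, a)\<in>M3 \<times> A3. (\<Sum>k<h13 D. f3 (n, k) m * act_31 D l (k, a)) * r (Inr (Inr (m, a)))))"
    unfolding P1_def w
    by (simp add: app_Plus) (auto simp: app_def gamma_def intro!: arg_cong2[of _ _ _ _ "(+)"] sum.cong)
  then show "app I1 (\<lambda>n p. gamma D w (n, l) p) r n = Gam w l r n"
    unfolding blk_phi_contract[where F = f2 and X = "act_21 D l" and t = "\<lambda>s. r (Inr (Inl s))"]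
      blk_phi_contract[where F = f3 and X = "act_31 D l" and t = "\<lambda>s. r (Inr (Inr s))"]
    by (simp add: Gam_def blk2_def \<phi>1_def \<phi>2_def[abs_def] \<phi>3_def[abs_def] w) (simp add: app_def)
qed

lemma xi_gamma_Hom:
  assumes "w \<in> smallW D m1 m2 m3 n1"
  shows "xi2 D m2 m3 \<in> Hom (I2 \<times> A2) I1" "xi3 D m3 \<in> Hom (M3 \<times> A32) I2"
    "(\<lambda>n (p, l). gamma D w (n, l) p) \<in> Hom (I1 \<times> H1) {..<n1}"
proof -
  have z: "\<not> (c < a31 D \<and> b < a32 D \<and> a < a21 D) \<Longrightarrow> comp_A D c (b, a) = 0" for a b c
    using D_Hom(1) by (auto simp: Hom_def)
  have z2: "\<not> (j < h12 D \<and> a < a21 D \<and> l < h11 D) \<Longrightarrow> act_21 D l (j, a) = 0" for l j a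
    using D_Hom(2) by (auto simp: Hom_def)
  have z3: "\<not> (j < h13 D \<and> a < a31 D \<and> l < h11 D) \<Longrightarrow> act_31 D l (j, a) = 0" for l j a
    using D_Hom(3) by (auto simp: Hom_def)
  show "xi3 D m3 \<in> Hom (M3 \<times> A32) I2"
    by (auto simp: Hom_def xi3_def id_map_def P2_def split: sum.splits)
  show "xi2 D m2 m3 \<in> Hom (I2 \<times> A2) I1"
    unfolding Hom_def P1_def P2_def mem_Collect_eq
    by (auto simp: xi2_def id_map_def z split: sum.splits) (use z in blast)+
  obtain f1 f2 f3 where w: "w = (f1, f2, f3)" by (cases w)
  have f: "f1 \<in> Hom {..<m1} ({..<n1} \<times> H1)" "f2 \<in> Hom {..<m2} ({..<n1} \<times> H2)" "f3 \<in> Hom {..<m3} ({..<n1} \<times> H3)"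
    using assms by (auto simp: w smallW_def)
  have "gamma D w (n, l) p = 0" if "\<not> (n < n1 \<and> p \<in> I1 \<and> l < h11 D)" for n l p
  proof -
    consider m where "p = Inl m" | m a where "p = Inr (Inl (m, a))" | m a where "p = Inr (Inr (m, a))"
      by (metis old.prod.exhaust sum.exhaust)
    then show ?thesis
    proof cases
      case 1
      then show ?thesis using that f(1) by (auto simp: w gamma_def Hom_def P1_def)
    next
      case (2 m a)
      then have "f2 (n, k) m = 0 \<or> act_21 D l (k, a) = 0" for k
        using that f(2) z2[of k a l] by (auto simp: Hom_def P1_def)
      then show ?thesis by (auto simp: 2 w gamma_def intro!: sum.neutral)
    next
      case (3 m a)
      then have "f3 (n, k) m = 0 \<or> act_31 D l (k, a) = 0" for k
        using that f(3) z3[of k a l] by (auto simp: Hom_def P1_def)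
      then show ?thesis by (auto simp: 3 w gamma_def intro!: sum.neutral)
    qed
  qed
  then show "(\<lambda>n (p, l). gamma D w (n, l) p) \<in> Hom (I1 \<times> H1) {..<n1}" by (auto simp: Hom_def)
qed

lemma comp_eq_iff_app:
  assumes "finite I" "g \<in> Hom I I" "g' \<in> Hom J J" "x \<in> Hom I J" "y \<in> Hom I J"
  shows "comp_map I x g = comp_map J g' y \<longleftrightarrow> (\<forall>v\<in>cspace I. app I x (app I g v) = app J g' (app I y v))"
proof
  show "comp_map I x g = comp_map J g' y" if "\<forall>v\<in>cspace I. app I x (app I g v) = app J g' (app I y v)"
    using that by (intro Hom_eqI[OF assms(1) comp_map_Hom[OF assms(4,2)] comp_map_Hom[OF assms(3,5)]])
      (auto simp: app_comp_map)
qed (simp add: app_comp_map[symmetric])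

text \<open>The equation between x and the image of \<open>zeta\<close> under g, with all inverses
  moved to the other side and read slice by slice.\<close>

definition transports :: "pt \<Rightarrow> grp \<Rightarrow> wpt \<Rightarrow> bool" where
  "transports x = (\<lambda>(g1, g2, g3, h) w.
      (\<forall>a<a21 D. \<forall>u\<in>cspace I2. X2 x a (app I2 g2 u) = app I1 g1 (Xi2 a u)) \<and>
      (\<forall>b<a32 D. \<forall>v\<in>cspace M3. X3 x b (app M3 g3 v) = app I2 g2 (Xi3 b v)) \<and>
      (\<forall>l<h11 D. \<forall>r\<in>cspace I1. Psi x l (app I1 g1 r) = app {..<n1} h (Gam w l r)))"

text \<open>\<open>eq_comp_inv_iff\<close> for each of the three components, followed by the passage
  from matrices to the maps that they define.\<close>

lemma Zset_iff:
  "x \<in> Zset D m1 m2 m3 n1 \<longleftrightarrow> x \<in> bigW D m1 m2 m3 n1 \<and>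
    (\<exists>g\<in>bigG D m1 m2 m3 n1. \<exists>w\<in>smallW D m1 m2 m3 n1. transports x g w)"
proof -
  have slHom: "sl y a \<in> Hom I J" if "y \<in> Hom (I \<times> A) J" for y :: "'b \<Rightarrow> 'i \<times> nat \<Rightarrow> complex" and I A J a
    using that by (auto simp: Hom_def)
  have *: "x = bigG_act D m1 m2 m3 n1 (g1, g2, g3, h) (zeta D m2 m3 w) \<longleftrightarrow> x \<in> bigW D m1 m2 m3 n1 \<and> transports x (g1, g2, g3, h) w"
    if g: "g1 \<in> GL I1" "g2 \<in> GL I2" "g3 \<in> GL M3" "h \<in> GL {..<n1}" and w: "w \<in> smallW D m1 m2 m3 n1" for g1 g2 g3 h w
  proof -
    obtain x2 x3 psi where x: "x = (x2, x3, psi)" by (cases x)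
    have gH: "g1 \<in> Hom I1 I1" "g2 \<in> Hom I2 I2" "g3 \<in> Hom M3 M3" "h \<in> Hom {..<n1} {..<n1}"
      using g by (auto simp: GL_def)
    note xiH = xi_gamma_Hom[OF w]
    let ?ga = "\<lambda>n (p, l). gamma D w (n, l) p"
    have 2: "x2 = comp_map (I2 \<times> A2) (comp_map I1 g1 (xi2 D m2 m3)) (inv_map (I2 \<times> A2) (tensor_map g2 (id_map A2)))
        \<longleftrightarrow> x2 \<in> Hom (I2 \<times> A2) I1 \<and> (\<forall>a<a21 D. \<forall>u\<in>cspace I2. X2 x a (app I2 g2 u) = app I1 g1 (Xi2 a u))"
      (is "?L \<longleftrightarrow> ?H \<and> ?R")
    proof -
      have "?L \<longleftrightarrow> ?H \<and> (\<forall>a\<in>A2. comp_map I2 (sl x2 a) g2 = sl (comp_map I1 g1 (xi2 D m2 m3)) a)"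
        by (rule eq_comp_inv_iff[OF finite_I(2) finite_lessThan g(2) comp_map_Hom[OF gH(1) xiH(1)]])
      also have "\<dots> \<longleftrightarrow> ?H \<and> (\<forall>a\<in>A2. comp_map I2 (sl x2 a) g2 = comp_map I1 g1 (sl (xi2 D m2 m3) a))"
        by (simp add: comp_map_def)
      also have "\<dots> \<longleftrightarrow> ?H \<and> ?R"
        using comp_eq_iff_app[OF finite_I(2) gH(2,1) slHom slHom[OF xiH(1)], of x2 A2]
        by (auto simp: X2_def x app_xi2)
      finally show ?thesis .
    qed
    have 3: "x3 = comp_map (M3 \<times> A32) (comp_map I2 g2 (xi3 D m3)) (inv_map (M3 \<times> A32) (tensor_map g3 (id_map A32)))
        \<longleftrightarrow> x3 \<in> Hom (M3 \<times> A32) I2 \<and> (\<forall>b<a32 D. \<forall>v\<in>cspace M3. X3 x b (app M3 g3 v) = app I2 g2 (Xi3 b v))"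
      (is "?L \<longleftrightarrow> ?H \<and> ?R")
    proof -
      have "?L \<longleftrightarrow> ?H \<and> (\<forall>a\<in>A32. comp_map M3 (sl x3 a) g3 = sl (comp_map I2 g2 (xi3 D m3)) a)"
        by (rule eq_comp_inv_iff[OF finite_lessThan finite_lessThan g(3) comp_map_Hom[OF gH(2) xiH(2)]])
      also have "\<dots> \<longleftrightarrow> ?H \<and> (\<forall>a\<in>A32. comp_map M3 (sl x3 a) g3 = comp_map I2 g2 (sl (xi3 D m3) a))"
        by (simp add: comp_map_def)
      also have "\<dots> \<longleftrightarrow> ?H \<and> ?R"
        using comp_eq_iff_app[OF finite_lessThan gH(3,2) slHom slHom[OF xiH(2)], of x3 A32]
        by (auto simp: X3_def x app_xi3)
      finally show ?thesis .
    qed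
    have 1: "psi = comp_map (I1 \<times> H1) (comp_map {..<n1} h ?ga) (inv_map (I1 \<times> H1) (tensor_map g1 (id_map H1)))
        \<longleftrightarrow> psi \<in> Hom (I1 \<times> H1) {..<n1} \<and> (\<forall>l<h11 D. \<forall>r\<in>cspace I1. Psi x l (app I1 g1 r) = app {..<n1} h (Gam w l r))"
      (is "?L \<longleftrightarrow> ?H \<and> ?R")
    proof -
      have "?L \<longleftrightarrow> ?H \<and> (\<forall>a\<in>H1. comp_map I1 (sl psi a) g1 = sl (comp_map {..<n1} h ?ga) a)"
        by (rule eq_comp_inv_iff[OF finite_I(1) finite_lessThan g(1) comp_map_Hom[OF gH(4) xiH(3)]])
      also have "\<dots> \<longleftrightarrow> ?H \<and> (\<forall>a\<in>H1. comp_map I1 (sl psi a) g1 = comp_map {..<n1} h (sl ?ga a))"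
        by (simp add: comp_map_def)
      also have "\<dots> \<longleftrightarrow> ?H \<and> ?R"
        using comp_eq_iff_app[OF finite_I(1) gH(1,4) slHom slHom[OF xiH(3)], of psi H1]
        by (auto simp: Psi_def x app_gamma)
      finally show ?thesis .
    qed
    show ?thesis
      unfolding bigG_act_def zeta_def Let_def x prod.case prod.inject bigW_def mem_Times_iff fst_conv snd_conv
      using 1 2 3 by (auto simp: x transports_def)
  qed
  have "x \<in> Zset D m1 m2 m3 n1 \<longleftrightarrow> (\<exists>g\<in>bigG D m1 m2 m3 n1. \<exists>w\<in>smallW D m1 m2 m3 n1.
      x = bigG_act D m1 m2 m3 n1 g (zeta D m2 m3 w))"
    unfolding Zset_def by blast
  also have "\<dots> \<longleftrightarrow> (\<exists>g\<in>bigG D m1 m2 m3 n1. \<exists>w\<in>smallW D m1 m2 m3 n1.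
      x \<in> bigW D m1 m2 m3 n1 \<and> transports x g w)"
  proof (intro bex_cong refl)
    fix g w assume "g \<in> bigG D m1 m2 m3 n1" "w \<in> smallW D m1 m2 m3 n1"
    then show "x = bigG_act D m1 m2 m3 n1 g (zeta D m2 m3 w) \<longleftrightarrow> x \<in> bigW D m1 m2 m3 n1 \<and> transports x g w"
      by (cases g) (simp add: bigG_def *)
  qed
  finally show ?thesis by blast
qed

section \<open>Relations on Z and on its closure\<close>

text \<open>These right inverses are chosen once for the system D and do not depend on the
  point.\<close>

definition R32 where "R32 = (SOME R. comp_map (A32 \<times> A2) (comp_A D) R = id_map A3)"
definition R21 where "R21 = (SOME R. comp_map (A2 \<times> H1) (dual_act (act_21 D)) R = id_map H2)"
definition R31 where "R31 = (SOME R. comp_map (A3 \<times> H1) (dual_act (act_31 D)) R = id_map H3)"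

lemma R_props:
  "comp_map (A32 \<times> A2) (comp_A D) R32 = id_map A3"
  "comp_map (A2 \<times> H1) (dual_act (act_21 D)) R21 = id_map H2"
  "comp_map (A3 \<times> H1) (dual_act (act_31 D)) R31 = id_map H3"
proof -
  have *: "\<exists>R. comp_map S C R = id_map T" if "finite S" "finite T" "C \<in> Hom S T" "surj_map S T C"
    for S :: "(nat \<times> nat) set" and T :: "nat set" and C
    using surj_right_inverse[OF that(1-3)] that(4) unfolding surj_map_def by (metis subset_refl)
  have "dual_act (act_21 D) \<in> Hom (A2 \<times> H1) H2" "dual_act (act_31 D) \<in> Hom (A3 \<times> H1) H3"
    using D_Hom(2,3) by (auto simp: Hom_def dual_act_def)
  note dual = this
  show "comp_map (A32 \<times> A2) (comp_A D) R32 = id_map A3"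
    unfolding R32_def
    by (rule someI_ex[where P = "\<lambda>R. comp_map (A32 \<times> A2) (comp_A D) R = id_map A3"], rule *)
      (use D_Hom(1) D_surj in simp_all)
  show "comp_map (A2 \<times> H1) (dual_act (act_21 D)) R21 = id_map H2"
    unfolding R21_def
    by (rule someI_ex[where P = "\<lambda>R. comp_map (A2 \<times> H1) (dual_act (act_21 D)) R = id_map H2"], rule *)
      (use dual D_surj in simp_all)
  show "comp_map (A3 \<times> H1) (dual_act (act_31 D)) R31 = id_map H3"
    unfolding R31_def
    by (rule someI_ex[where P = "\<lambda>R. comp_map (A3 \<times> H1) (dual_act (act_31 D)) R = id_map H3"], rule *)
      (use dual D_surj in simp_all)
qed

text \<open>
  The induced maps, written with right inverses of the compositions. In this form they are
  defined for every point of \<open>\<^bold>W\<close> and depend on it polynomially.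
\<close>

definition E :: "pt \<Rightarrow> nat \<Rightarrow> (nat \<Rightarrow> complex) \<Rightarrow> ix1 \<Rightarrow> complex" where
  "E x c v = (\<lambda>p. \<Sum>s\<in>A32 \<times> A2. R32 s c * X2 x (snd s) (X3 x (fst s) v) p)"
definition Psi2 :: "pt \<Rightarrow> nat \<Rightarrow> (ix2 \<Rightarrow> complex) \<Rightarrow> nat \<Rightarrow> complex" where
  "Psi2 x k u = (\<lambda>n. \<Sum>s\<in>A2 \<times> H1. R21 s k * Psi x (snd s) (X2 x (fst s) u) n)"
definition Phi3 :: "pt \<Rightarrow> nat \<Rightarrow> (nat \<Rightarrow> complex) \<Rightarrow> nat \<Rightarrow> complex" where
  "Phi3 x k v = (\<lambda>n. \<Sum>s\<in>A3 \<times> H1. R31 s k * Psi x (snd s) (E x (fst s) v) n)"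

text \<open>The equations \<open>relA\<close>, \<open>relB\<close> and \<open>relC\<close> of
  \<open>limit_point\<close>; the equation \<open>relD\<close> follows from them and associativity
  in \<open>relations_D\<close>.\<close>

definition relations :: "pt \<Rightarrow> bool" where
  "relations x \<longleftrightarrow>
    (\<forall>a b v. a < a21 D \<longrightarrow> b < a32 D \<longrightarrow> v \<in> cspace M3 \<longrightarrow>
      X2 x a (X3 x b v) = (\<lambda>i. \<Sum>c<a31 D. comp_A D c (b, a) * E x c v i)) \<and>
    (\<forall>a l u. a < a21 D \<longrightarrow> l < h11 D \<longrightarrow> u \<in> cspace I2 \<longrightarrow>
      Psi x l (X2 x a u) = (\<lambda>n. \<Sum>k<h12 D. act_21 D l (k, a) * Psi2 x k u n)) \<and>
    (\<forall>c l v. c < a31 D \<longrightarrow> l < h11 D \<longrightarrow> v \<in> cspace M3 \<longrightarrow>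
      Psi x l (E x c v) = (\<lambda>n. \<Sum>k<h13 D. act_31 D l (k, c) * Phi3 x k v n))"

text \<open>Any factorization will do: by \<open>right_inverse_determines\<close> its factors agree
  with \<open>E\<close>, \<open>Psi2\<close> and \<open>Phi3\<close> on the vectors
  concerned.\<close>

lemma relationsI:
  assumes A: "\<And>a b v. a < a21 D \<Longrightarrow> b < a32 D \<Longrightarrow> v \<in> cspace M3 \<Longrightarrow>
      X2 x a (X3 x b v) = (\<lambda>i. \<Sum>c<a31 D. comp_A D c (b, a) * E' c v i)"
    and B: "\<And>a l u. a < a21 D \<Longrightarrow> l < h11 D \<Longrightarrow> u \<in> cspace I2 \<Longrightarrow>
      Psi x l (X2 x a u) = (\<lambda>n. \<Sum>k<h12 D. act_21 D l (k, a) * Psi2' k u n)"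
    and C: "\<And>c l v. c < a31 D \<Longrightarrow> l < h11 D \<Longrightarrow> v \<in> cspace M3 \<Longrightarrow>
      Psi x l (E' c v) = (\<lambda>n. \<Sum>k<h13 D. act_31 D l (k, c) * Phi3' k v n)"
  shows "relations x"
proof -
  have E: "E x c v = E' c v" if "c < a31 D" "v \<in> cspace M3" for c v
    unfolding E_def using that A
    by (intro ext right_inverse_determines[OF _ _ R_props(1)]) auto
  have P2: "Psi2 x k u = Psi2' k u" if "k < h12 D" "u \<in> cspace I2" for k u
    unfolding Psi2_def using that B
    by (intro ext right_inverse_determines[OF _ _ R_props(2)]) (auto simp: dual_act_def)
  have P3: "Phi3 x k v = Phi3' k v" if "k < h13 D" "v \<in> cspace M3" for k v
    unfolding Phi3_def using that C
    by (intro ext right_inverse_determines[OF _ _ R_props(3)]) (auto simp: dual_act_def E)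
  show ?thesis unfolding relations_def using A B C by (auto simp: E P2 P3)
qed

lemma Xi2_in: assumes "u \<in> cspace I2" "a < a21 D" shows "Xi2 a u \<in> cspace I1"
proof -
  have u: "(\<lambda>m. u (Inl m)) \<in> cspace {..<m2}" "(\<lambda>s. u (Inr s)) \<in> slices_in A32 (cspace M3)"
    using assms(1) by (simp_all add: P2_def cspace_Plus slices_in_cspace)
  have "contract A32 (mulA D a) (\<lambda>s. u (Inr s)) \<in> slices_in A3 (cspace M3)"
    using D_Hom(1) by (intro contract_in[OF subspace_cspace u(2)]) (auto simp: Hom_def mulA_def)
  moreover have "slot a (\<lambda>m. u (Inl m)) \<in> slices_in A2 (cspace {..<m2})"
    using assms(2) by (intro slot_in[OF subspace_cspace u(1)]) simp
  ultimately show ?thesis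
    unfolding Xi2_def P1_def cspace_Plus sum.case slices_in_cspace by (simp add: cspace_def)
qed

lemma Xi3_in: assumes "v \<in> cspace M3" "b < a32 D" shows "Xi3 b v \<in> cspace I2"
proof -
  have "slot b v \<in> slices_in A32 (cspace M3)" using assms by (intro slot_in[OF subspace_cspace]) auto
  then show ?thesis unfolding Xi3_def P2_def cspace_Plus sum.case slices_in_cspace by (simp add: cspace_def)
qed

definition inj3 :: "nat \<Rightarrow> (nat \<Rightarrow> complex) \<Rightarrow> ix1 \<Rightarrow> complex" where
  "inj3 c v = case_sum (\<lambda>_. 0) (case_sum (\<lambda>_. 0) (slot c v))"

lemma inj3_in: assumes "v \<in> cspace M3" "c < a31 D" shows "inj3 c v \<in> cspace I1"
proof -
  have "slot c v \<in> slices_in A3 (cspace M3)" using assms by (intro slot_in[OF subspace_cspace]) auto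
  then show ?thesis unfolding inj3_def P1_def cspace_Plus sum.case slices_in_cspace by (simp add: cspace_def)
qed

text \<open>The first relation at \<open>zeta\<close>, where the inclusion \<open>inj3\<close> of
  \<open>M\<^sub>3 \<otimes> A\<^sub>3\<^sub>1\<close> in \<open>P\<^sub>1\<close> plays the role of
  \<open>E\<close>.\<close>

lemma Xi2_Xi3:
  assumes "a < a21 D" "b < a32 D"
  shows "Xi2 a (Xi3 b v) = (\<lambda>i. \<Sum>c<a31 D. comp_A D c (b, a) * inj3 c v i)"
proof
  fix i :: ix1
  consider m where "i = Inl m" | s where "i = Inr (Inl s)" | m c where "i = Inr (Inr (m, c))"
    by (metis old.prod.exhaust sum.exhaust)
  then show "Xi2 a (Xi3 b v) i = (\<Sum>c<a31 D. comp_A D c (b, a) * inj3 c v i)"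
  proof cases
    case (3 m c)
    have "(\<Sum>d<a31 D. comp_A D d (b, a) * inj3 d v i) = (\<Sum>d<a31 D. if d = c then comp_A D c (b, a) * v m else 0)"
      by (intro sum.cong) (auto simp: 3 inj3_def slot_def)
    also have "\<dots> = comp_A D c (b, a) * v m"
      using D_Hom(1) by (auto simp: Hom_def)
    finally show ?thesis
      using assms contract_slot[of A32 b "mulA D a" v] by (simp add: 3 Xi2_def Xi3_def mulA_def)
  qed (auto simp: Xi2_def Xi3_def inj3_def slot_def)
qed

lemma clinear_phi: "clinear (\<phi>1 w l)" "clinear (\<phi>2 w k)" "clinear (\<phi>3 w k)"
  unfolding \<phi>1_def \<phi>2_def \<phi>3_def by (rule clinear_app)+

lemma contract_zero: "contract A X (\<lambda>_. 0) = (\<lambda>_. 0)"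
  by (simp add: contract_def case_prod_beta')

lemma blk_zero: "(\<And>a. a \<in> A \<Longrightarrow> clinear (G a)) \<Longrightarrow> blk A G (\<lambda>_. 0) = 0"
  using clinearD(3)[OF clinear_blk, of A G] by (simp add: zero_fun_def)

lemma blk_contract_slot:
  assumes "finite A" "a \<in> A" "\<And>k. clinear (F k)"
  shows "blk J F (contract A X (slot a v)) = (\<lambda>n. \<Sum>k\<in>J. X (k, a) * F k v n)"
proof
  fix n
  show "blk J F (contract A X (slot a v)) n = (\<Sum>k\<in>J. X (k, a) * F k v n)"
    using clinearD(2)[OF assms(3)]
    by (simp add: contract_slot[OF assms(1,2)] blk_def sum_fun_apply)
qed

lemma Gam_inj3:
  assumes "c < a31 D"
  shows "Gam w l (inj3 c v) = (\<lambda>n. \<Sum>k<h13 D. act_31 D l (k, c) * \<phi>3 w k v n)"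
proof -
  have "blk H3 (\<phi>3 w) (contract A3 (act_31 D l) (slot c v)) = (\<lambda>n. \<Sum>k<h13 D. act_31 D l (k, c) * \<phi>3 w k v n)"
    using assms clinear_phi by (intro blk_contract_slot) auto
  moreover have "\<phi>1 w l (\<lambda>_. 0) = 0" using clinearD(3)[OF clinear_phi(1)] by (simp add: zero_fun_def)
  moreover have "blk H2 (\<phi>2 w) (\<lambda>_. 0) = 0" by (rule blk_zero[OF clinear_phi(2)])
  ultimately show ?thesis by (simp add: Gam_def inj3_def blk2_def contract_zero)
qed

text \<open>The role of \<open>Psi2\<close> at \<open>zeta\<close>: \<open>\<phi>2\<close> on
  \<open>M\<^sub>2\<close>, and on \<open>M\<^sub>3 \<otimes> A\<^sub>3\<^sub>2\<close> the pairing
  with the dual of \<open>H\<^sub>1\<^sub>2\<close> followed by \<open>\<phi>3\<close>.\<close>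

definition theta2 :: "wpt \<Rightarrow> nat \<Rightarrow> (ix2 \<Rightarrow> complex) \<Rightarrow> nat \<Rightarrow> complex" where
  "theta2 w j u = \<phi>2 w j (\<lambda>m. u (Inl m)) + blk H3 (\<phi>3 w) (contract A32 (act_32 D j) (\<lambda>s. u (Inr s)))"

lemma contract_contract:
  assumes "a < a21 D" "l < h11 D" "k < h13 D"
  shows "contract A3 (act_31 D l) (contract A32 (mulA D a) t) (m, k)
    = (\<Sum>j<h12 D. act_21 D l (j, a) * contract A32 (act_32 D j) t (m, k))"
proof -
  have "contract A3 (act_31 D l) (contract A32 (mulA D a) t) (m, k)
      = (\<Sum>b<a32 D. (\<Sum>c<a31 D. act_31 D l (k, c) * comp_A D c (b, a)) * t (m, b))"
    by (simp add: contract_def mulA_def sum_distrib_left sum_distrib_right mult.assoc sum.swap[of _ A3 A32])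
  also have "\<dots> = (\<Sum>b<a32 D. (\<Sum>j<h12 D. act_21 D l (j, a) * act_32 D j (k, b)) * t (m, b))"
    using assms by (simp add: assoc)
  also have "\<dots> = (\<Sum>j<h12 D. act_21 D l (j, a) * contract A32 (act_32 D j) t (m, k))"
    by (simp add: contract_def sum_distrib_left sum_distrib_right mult.assoc sum.swap[of _ A32 H2])
  finally show ?thesis .
qed

text \<open>On the part \<open>M\<^sub>3 \<otimes> A\<^sub>3\<^sub>2\<close>, associativity
  exchanges a product in \<open>A\<^sub>3\<^sub>1\<close> for two successive actions
  (\<open>contract_contract\<close>).\<close>

lemma Gam_Xi2:
  assumes "a < a21 D" "l < h11 D"
  shows "Gam w l (Xi2 a u) = (\<lambda>n. \<Sum>j<h12 D. act_21 D l (j, a) * theta2 w j u n)"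
proof -
  let ?u1 = "\<lambda>m. u (Inl m)" and ?u2 = "\<lambda>s. u (Inr s)"
  have 1: "blk H2 (\<phi>2 w) (contract A2 (act_21 D l) (slot a ?u1)) = (\<lambda>n. \<Sum>j<h12 D. act_21 D l (j, a) * \<phi>2 w j ?u1 n)"
    using assms clinear_phi by (intro blk_contract_slot) auto
  have 2: "blk H3 (\<phi>3 w) (contract A3 (act_31 D l) (contract A32 (mulA D a) ?u2))
      = (\<lambda>n. \<Sum>j<h12 D. act_21 D l (j, a) * blk H3 (\<phi>3 w) (contract A32 (act_32 D j) ?u2) n)"
  proof -
    have "blk H3 (\<phi>3 w) (contract A3 (act_31 D l) (contract A32 (mulA D a) ?u2))
        = blk H3 (\<phi>3 w) (\<lambda>s. \<Sum>j<h12 D. act_21 D l (j, a) * contract A32 (act_32 D j) ?u2 s)"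
      unfolding blk_def using assms by (intro sum.cong refl) (simp add: contract_contract)
    then show ?thesis
      by (simp add: clinear_comb[OF clinear_blk[OF clinear_phi(3)]])
  qed
  have "\<phi>1 w l (\<lambda>_. 0) = 0" using clinearD(3)[OF clinear_phi(1)] by (simp add: zero_fun_def)
  then show ?thesis
    by (simp add: Gam_def Xi2_def blk2_def 1 2 theta2_def fun_eq_iff distrib_left sum.distrib)
qed

text \<open>At \<open>zeta\<close> the factors are \<open>inj3\<close>, \<open>theta2\<close> and
  \<open>\<phi>3\<close>. The group element transports them, with the inverses k2 and k3 applied to
  the arguments.\<close>

lemma Zset_relations:
  assumes "x \<in> Zset D m1 m2 m3 n1"
  shows "relations x"
proof -
  obtain g1 g2 g3 h w where *: "(g1, g2, g3, h) \<in> bigG D m1 m2 m3 n1" "transports x (g1, g2, g3, h) w"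
    using assms unfolding Zset_iff by auto
  then have g: "g2 \<in> GL I2" "g3 \<in> GL M3"
    and x2: "\<And>a u. a < a21 D \<Longrightarrow> u \<in> cspace I2 \<Longrightarrow> X2 x a (app I2 g2 u) = app I1 g1 (Xi2 a u)"
    and x3: "\<And>b v. b < a32 D \<Longrightarrow> v \<in> cspace M3 \<Longrightarrow> X3 x b (app M3 g3 v) = app I2 g2 (Xi3 b v)"
    and psi: "\<And>l r. l < h11 D \<Longrightarrow> r \<in> cspace I1 \<Longrightarrow> Psi x l (app I1 g1 r) = app {..<n1} h (Gam w l r)"
    by (simp_all add: bigG_def transports_def)
  obtain k2 where k2: "k2 \<in> Hom I2 I2" "\<And>v. v \<in> cspace I2 \<Longrightarrow> app I2 g2 (app I2 k2 v) = v"
    using app_GL_inverse[OF finite_I(2) g(1)] by metis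
  obtain k3 where k3: "k3 \<in> Hom M3 M3" "\<And>v. v \<in> cspace M3 \<Longrightarrow> app M3 g3 (app M3 k3 v) = v"
    using app_GL_inverse[OF finite_lessThan g(2)] by metis
  show ?thesis
  proof (rule relationsI[where E' = "\<lambda>c v. app I1 g1 (inj3 c (app M3 k3 v))"
        and Psi2' = "\<lambda>k u. app {..<n1} h (theta2 w k (app I2 k2 u))"
        and Phi3' = "\<lambda>k v. app {..<n1} h (\<phi>3 w k (app M3 k3 v))"])
    fix a b v assume *: "a < a21 D" "b < a32 D" "v \<in> cspace M3"
    let ?v = "app M3 k3 v"
    have v: "?v \<in> cspace M3" by (rule app_in_cspace[OF k3(1)])
    have "X2 x a (X3 x b v) = X2 x a (X3 x b (app M3 g3 ?v))" using k3(2) * by simp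
    also have "\<dots> = app I1 g1 (Xi2 a (Xi3 b ?v))" using * v by (simp add: x3 x2 Xi3_in)
    also have "\<dots> = (\<lambda>i. \<Sum>c<a31 D. comp_A D c (b, a) * app I1 g1 (inj3 c ?v) i)"
      using * by (simp add: Xi2_Xi3 clinear_comb[OF clinear_app])
    finally show "X2 x a (X3 x b v) = (\<lambda>i. \<Sum>c<a31 D. comp_A D c (b, a) * app I1 g1 (inj3 c ?v) i)" .
  next
    fix a l u assume *: "a < a21 D" "l < h11 D" "u \<in> cspace I2"
    let ?u = "app I2 k2 u"
    have u: "?u \<in> cspace I2" by (rule app_in_cspace[OF k2(1)])
    have "Psi x l (X2 x a u) = Psi x l (X2 x a (app I2 g2 ?u))" using k2(2) * by simp
    also have "\<dots> = app {..<n1} h (Gam w l (Xi2 a ?u))" using * u by (simp add: x2 psi Xi2_in)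
    also have "\<dots> = (\<lambda>n. \<Sum>k<h12 D. act_21 D l (k, a) * app {..<n1} h (theta2 w k ?u) n)"
      using * by (simp add: Gam_Xi2 clinear_comb[OF clinear_app])
    finally show "Psi x l (X2 x a u) = (\<lambda>n. \<Sum>k<h12 D. act_21 D l (k, a) * app {..<n1} h (theta2 w k ?u) n)" .
  next
    fix c l v assume *: "c < a31 D" "l < h11 D" "v \<in> cspace M3"
    let ?v = "app M3 k3 v"
    have v: "?v \<in> cspace M3" by (rule app_in_cspace[OF k3(1)])
    show "Psi x l (app I1 g1 (inj3 c ?v)) = (\<lambda>n. \<Sum>k<h13 D. act_31 D l (k, c) * app {..<n1} h (\<phi>3 w k ?v) n)"
      using * v by (simp add: psi inj3_in Gam_inj3 clinear_comb[OF clinear_app])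
  qed
qed

lemma polyfuns_X2: "(\<And>i. (\<lambda>x. u x i) \<in> polyfuns pt_coords) \<Longrightarrow> (\<lambda>x. X2 x a (u x) i) \<in> polyfuns pt_coords"
  unfolding X2_def by (rule polyfuns_app[OF polyfuns_pt_coords(1)])

lemma polyfuns_X3: "(\<And>i. (\<lambda>x. v x i) \<in> polyfuns pt_coords) \<Longrightarrow> (\<lambda>x. X3 x b (v x) i) \<in> polyfuns pt_coords"
  unfolding X3_def by (rule polyfuns_app[OF polyfuns_pt_coords(2)])

lemma polyfuns_Psi: "(\<And>i. (\<lambda>x. r x i) \<in> polyfuns pt_coords) \<Longrightarrow> (\<lambda>x. Psi x l (r x) n) \<in> polyfuns pt_coords"
  unfolding Psi_def by (rule polyfuns_app[OF polyfuns_pt_coords(3)])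

lemmas polyfuns_X = polyfuns_X2 polyfuns_X3 polyfuns_Psi

lemma polyfuns_E: "(\<lambda>x. E x c v p) \<in> polyfuns pt_coords"
  unfolding E_def by (intro polyfuns_sum polyfuns_cmult polyfuns_X polyfuns.const)

lemma polyfuns_Psi2: "(\<lambda>x. Psi2 x k u n) \<in> polyfuns pt_coords"
  unfolding Psi2_def by (intro polyfuns_sum polyfuns_cmult polyfuns_X polyfuns.const)

lemma polyfuns_Phi3: "(\<lambda>x. Phi3 x k v n) \<in> polyfuns pt_coords"
  unfolding Phi3_def by (intro polyfuns_sum polyfuns_cmult polyfuns_X polyfuns_E)

abbreviation "Zbar \<equiv> zariski_closure pt_coords (bigW D m1 m2 m3 n1) (Zset D m1 m2 m3 n1)"

text \<open>The difference of f and g is a polynomial that vanishes on Z.\<close>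

lemma closure_eq:
  assumes "x \<in> Zbar" "f \<in> polyfuns pt_coords" "g \<in> polyfuns pt_coords"
    "\<And>z. z \<in> Zset D m1 m2 m3 n1 \<Longrightarrow> f z = g z"
  shows "f x = g x"
proof -
  have "\<forall>f\<in>polyfuns pt_coords. (\<forall>s\<in>Zset D m1 m2 m3 n1. f s = 0) \<longrightarrow> f x = 0"
    using assms(1) by (simp add: zariski_closure_def)
  from bspec[OF this polyfuns_diff[OF assms(2,3)]] show ?thesis using assms(4) by simp
qed

lemma closure_relations:
  assumes x: "x \<in> Zbar"
  shows "relations x"
  unfolding relations_def
proof (intro conjI allI impI ext)
  fix a b v i assume *: "a < a21 D" "b < a32 D" "v \<in> cspace M3"
  show "X2 x a (X3 x b v) i = (\<Sum>c<a31 D. comp_A D c (b, a) * E x c v i)"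
  proof (rule closure_eq[OF x, where f = "\<lambda>x. X2 x a (X3 x b v) i"
        and g = "\<lambda>x. \<Sum>c<a31 D. comp_A D c (b, a) * E x c v i"])
    show "(\<lambda>x. X2 x a (X3 x b v) i) \<in> polyfuns pt_coords" by (intro polyfuns_X polyfuns.const)
    show "(\<lambda>x. \<Sum>c<a31 D. comp_A D c (b, a) * E x c v i) \<in> polyfuns pt_coords"
      by (intro polyfuns_sum polyfuns_cmult polyfuns_E)
  qed (use * Zset_relations in \<open>simp add: relations_def\<close>)
next
  fix a l u n assume *: "a < a21 D" "l < h11 D" "u \<in> cspace I2"
  show "Psi x l (X2 x a u) n = (\<Sum>k<h12 D. act_21 D l (k, a) * Psi2 x k u n)"
  proof (rule closure_eq[OF x, where f = "\<lambda>x. Psi x l (X2 x a u) n"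
        and g = "\<lambda>x. \<Sum>k<h12 D. act_21 D l (k, a) * Psi2 x k u n"])
    show "(\<lambda>x. Psi x l (X2 x a u) n) \<in> polyfuns pt_coords" by (intro polyfuns_X polyfuns.const)
    show "(\<lambda>x. \<Sum>k<h12 D. act_21 D l (k, a) * Psi2 x k u n) \<in> polyfuns pt_coords"
      by (intro polyfuns_sum polyfuns_cmult polyfuns_Psi2)
  qed (use * Zset_relations in \<open>simp add: relations_def\<close>)
next
  fix c l v n assume *: "c < a31 D" "l < h11 D" "v \<in> cspace M3"
  show "Psi x l (E x c v) n = (\<Sum>k<h13 D. act_31 D l (k, c) * Phi3 x k v n)"
  proof (rule closure_eq[OF x, where f = "\<lambda>x. Psi x l (E x c v) n"
        and g = "\<lambda>x. \<Sum>k<h13 D. act_31 D l (k, c) * Phi3 x k v n"])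
    show "(\<lambda>x. Psi x l (E x c v) n) \<in> polyfuns pt_coords" by (intro polyfuns_X polyfuns_E)
    show "(\<lambda>x. \<Sum>k<h13 D. act_31 D l (k, c) * Phi3 x k v n) \<in> polyfuns pt_coords"
      by (intro polyfuns_sum polyfuns_cmult polyfuns_Phi3)
  qed (use * Zset_relations in \<open>simp add: relations_def\<close>)
qed

lemma X_in:
  assumes "x \<in> bigW D m1 m2 m3 n1"
  shows "X2 x a v \<in> cspace I1" "X3 x b u \<in> cspace I2" "Psi x l r \<in> cspace {..<n1}"
proof -
  obtain x2 x3 psi where x: "x = (x2, x3, psi)" by (cases x)
  have "sl x2 a \<in> Hom I2 I1" "sl x3 b \<in> Hom M3 I2" "sl psi l \<in> Hom I1 {..<n1}"
    using assms by (auto simp: x bigW_def Hom_def)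
  then show "X2 x a v \<in> cspace I1" "X3 x b u \<in> cspace I2" "Psi x l r \<in> cspace {..<n1}"
    unfolding X2_def X3_def Psi_def x by (auto intro!: app_in_cspace)
qed

lemma clinear_X: "clinear (X2 x a)" "clinear (X3 x b)" "clinear (Psi x l)"
  "clinear (E x c)" "clinear (Psi2 x k)" "clinear (Phi3 x k)"
proof -
  show X: "clinear (X2 x a)" "clinear (X3 x b)" "clinear (Psi x l)" for a b l
    unfolding X2_def X3_def Psi_def by (rule clinear_app)+
  show E: "clinear (E x c)" for c
    unfolding E_def
    by (rule clinear_weighted_sum[where f = "\<lambda>s v. X2 x (snd s) (X3 x (fst s) v)"])
      (rule clinear_compose[OF X(1,2)])
  show "clinear (Psi2 x k)"
    unfolding Psi2_def
    by (rule clinear_weighted_sum[where f = "\<lambda>s v. Psi x (snd s) (X2 x (fst s) v)"])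
      (rule clinear_compose[OF X(3,1)])
  show "clinear (Phi3 x k)"
    unfolding Phi3_def
    by (rule clinear_weighted_sum[where f = "\<lambda>s v. Psi x (snd s) (E x (fst s) v)"])
      (rule clinear_compose[OF X(3) E])
qed

lemma E_in:
  assumes "x \<in> bigW D m1 m2 m3 n1"
  shows "E x c v \<in> cspace I1" "Psi2 x k u \<in> cspace {..<n1}" "Phi3 x k v \<in> cspace {..<n1}"
proof -
  show "E x c v \<in> cspace I1"
    unfolding E_def by (rule subspace_comb[OF subspace_cspace X_in(1)[OF assms]])
  show "Psi2 x k u \<in> cspace {..<n1}"
    unfolding Psi2_def by (rule subspace_comb[OF subspace_cspace X_in(3)[OF assms]])
  show "Phi3 x k v \<in> cspace {..<n1}"
    unfolding Phi3_def by (rule subspace_comb[OF subspace_cspace X_in(3)[OF assms]])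
qed

text \<open>By \<open>blk_dual_zero\<close> the difference may be tested after
  \<open>act_21\<close>. There both sides become \<open>Psi x l (X2 x a (X3 x b v))\<close>,
  evaluated once through \<open>Psi2\<close> and once through \<open>E\<close> and
  \<open>Phi3\<close>; associativity matches the coefficients.\<close>

lemma relations_D:
  assumes "relations x" "b < a32 D" "j < h12 D" "v \<in> cspace M3" "x \<in> bigW D m1 m2 m3 n1"
  shows "Psi2 x j (X3 x b v) = (\<lambda>n. \<Sum>k<h13 D. act_32 D j (k, b) * Phi3 x k v n)"
proof -
  let ?F = "\<lambda>j n. Psi2 x j (X3 x b v) n - (\<Sum>k<h13 D. act_32 D j (k, b) * Phi3 x k v n)"
  have "?F j = 0"
  proof (rule blk_dual_zero[OF _ _ _ D_surj(4) D_Hom(2), of ?F])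
    fix a l assume al: "a \<in> A2" "l \<in> H1"
    have rA: "X2 x a (X3 x b v) = (\<lambda>i. \<Sum>c<a31 D. comp_A D c (b, a) * E x c v i)"
      and rB: "Psi x l (X2 x a (X3 x b v)) = (\<lambda>n. \<Sum>k<h12 D. act_21 D l (k, a) * Psi2 x k (X3 x b v) n)"
      and rC: "\<And>c. c < a31 D \<Longrightarrow> Psi x l (E x c v) = (\<lambda>n. \<Sum>k<h13 D. act_31 D l (k, c) * Phi3 x k v n)"
      using assms(1,2,4) al X_in(2)[OF assms(5)] unfolding relations_def by blast+
    show "(\<lambda>n. \<Sum>j\<in>H2. act_21 D l (j, a) * ?F j n) = 0"
    proof
      fix n
      have "(\<Sum>j\<in>H2. act_21 D l (j, a) * Psi2 x j (X3 x b v) n) = Psi x l (X2 x a (X3 x b v)) n"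
        unfolding rB by simp
      also have "\<dots> = (\<Sum>c<a31 D. comp_A D c (b, a) * Psi x l (E x c v) n)"
        unfolding rA clinear_comb[OF clinear_X(3)] by simp
      also have "\<dots> = (\<Sum>c<a31 D. \<Sum>k<h13 D. (act_31 D l (k, c) * comp_A D c (b, a)) * Phi3 x k v n)"
        by (simp add: rC sum_distrib_left mult_ac)
      also have "\<dots> = (\<Sum>k<h13 D. (\<Sum>j\<in>H2. act_21 D l (j, a) * act_32 D j (k, b)) * Phi3 x k v n)"
        using assms al by (subst sum.swap) (simp add: assoc sum_distrib_right)
      also have "\<dots> = (\<Sum>j\<in>H2. act_21 D l (j, a) * (\<Sum>k<h13 D. act_32 D j (k, b) * Phi3 x k v n))"
        by (simp add: sum_distrib_left sum_distrib_right mult.assoc sum.swap[of _ H2 H3])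
      finally show "(\<Sum>j\<in>H2. act_21 D l (j, a) * ?F j n) = 0 n"
        by (simp add: right_diff_distrib sum_subtractf)
    qed
  qed (use assms in auto)
  then show ?thesis by (simp add: fun_eq_iff)
qed

section \<open>Degenerate elements of \<open>A\<^sub>3\<^sub>2\<close>\<close>

text \<open>At \<open>zeta\<close> the tensor of the first basis vector of \<open>M\<^sub>3\<close>
  with w is killed by every \<open>Xi2 a\<close>, and g2 moves it to the vector sought. The first
  basis vector exists because \<open>m3 > 0\<close>.\<close>

lemma Zset_kernel:
  assumes z: "z \<in> Zset D m1 m2 m3 n1" and m3: "m3 > 0"
    and w: "w \<in> cspace A32" "w \<noteq> 0"
      "\<And>a c. a < a21 D \<Longrightarrow> c < a31 D \<Longrightarrow> (\<Sum>b<a32 D. comp_A D c (b, a) * w b) = 0"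
  obtains u where "u \<in> cspace I2" "u \<noteq> 0" "\<And>a. a < a21 D \<Longrightarrow> X2 z a u = 0"
proof -
  obtain g1 g2 g3 h w' where "(g1, g2, g3, h) \<in> bigG D m1 m2 m3 n1" "transports z (g1, g2, g3, h) w'"
    using z unfolding Zset_iff by auto
  then have g2: "g2 \<in> GL I2"
    and x2: "\<And>a u. a < a21 D \<Longrightarrow> u \<in> cspace I2 \<Longrightarrow> X2 z a (app I2 g2 u) = app I1 g1 (Xi2 a u)"
    by (simp_all add: bigG_def transports_def)
  obtain k2 where k2: "\<And>v. v \<in> cspace I2 \<Longrightarrow> app I2 k2 (app I2 g2 v) = v"
    using app_GL_inverse[OF finite_I(2) g2] by metis
  define t where "t = (\<lambda>(m :: nat, b). if m = 0 then w b else 0)"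
  define u where "u = case_sum (\<lambda>_ :: nat. 0) t"
  have u: "u \<in> cspace I2"
    using w(1) m3 unfolding u_def P2_def cspace_Plus sum.case by (auto simp: cspace_def t_def)
  have "contract A32 (mulA D a) t = (\<lambda>_. 0)" if "a < a21 D" for a
  proof
    fix s :: "nat \<times> nat"
    obtain m c where s: "s = (m, c)" by (cases s)
    show "contract A32 (mulA D a) t s = 0"
    proof (cases "c < a31 D")
      case True
      then show ?thesis using w(3)[OF that True] by (cases "m = 0") (auto simp: s contract_def mulA_def t_def)
    next
      case False
      then show ?thesis using D_Hom(1) by (auto simp: s contract_def mulA_def Hom_def intro!: sum.neutral)
    qed
  qed
  then have "Xi2 a u = 0" if "a < a21 D" for a
    using that by (auto simp: Xi2_def u_def slot_def fun_eq_iff split: sum.splits)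
  then have "X2 z a (app I2 g2 u) = 0" if "a < a21 D" for a
    using x2[OF that u] that by (simp add: app_zero)
  moreover have "app I2 g2 u \<noteq> 0"
  proof
    assume "app I2 g2 u = 0"
    then have "u = 0" using k2[OF u] by (simp add: app_zero)
    then have "u (Inr (0, b)) = 0" for b by simp
    then have "w b = 0" for b by (simp add: u_def t_def)
    then show False using w(2) by (simp add: fun_eq_iff)
  qed
  moreover have "app I2 g2 u \<in> cspace I2" using g2 by (auto simp: GL_def intro: app_in_cspace)
  ultimately show thesis using that by blast
qed

text \<open>
  A left inverse of \<open>P\<^sub>2 \<rightarrow> Hom(A\<^sub>2\<^sub>1, P\<^sub>1)\<close> at x, composed with this map at a variable point,
  has a determinant which vanishes on Z but not at x.
\<close>

lemma closure_kernel:
  assumes x: "x \<in> Zbar" and m3: "m3 > 0"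
    and w: "w \<in> cspace A32" "w \<noteq> 0"
      "\<And>a c. a < a21 D \<Longrightarrow> c < a31 D \<Longrightarrow> (\<Sum>b<a32 D. comp_A D c (b, a) * w b) = 0"
  shows "\<exists>u\<in>cspace I2. u \<noteq> 0 \<and> (\<forall>a<a21 D. X2 x a u = 0)"
proof (rule ccontr)
  assume contra: "\<not> ?thesis"
  have xW: "x \<in> bigW D m1 m2 m3 n1" using x by (simp add: zariski_closure_def)
  \<comment> \<open>The map \<open>P\<^sub>2 \<rightarrow> Hom(A\<^sub>2\<^sub>1, P\<^sub>1)\<close>
    at x. The assumption made for contradiction is its injectivity.\<close>
  define T where "T = (\<lambda>u (p, a). if a < a21 D then X2 x a u p else 0)"
  have T: "clinear T"
    using clinearD[OF clinear_X(1)[of x]] by (auto simp: clinear_iff T_def fun_eq_iff)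
  have "inj_on T (cspace I2)"
  proof (subst cpair.linear_inj_on_iff_eq_0[OF T subspace_cspace], intro ballI impI)
    fix u assume u: "u \<in> cspace I2" "T u = 0"
    have "X2 x a u = 0" if "a < a21 D" for a
    proof
      fix p show "X2 x a u p = 0 p" using fun_cong[OF u(2), of "(p, a)"] that by (simp add: T_def)
    qed
    then show "u = 0" using contra u(1) by blast
  qed
  then obtain G where G: "clinear G" "\<And>v. v \<in> cspace I2 \<Longrightarrow> G (T v) = v"
    using cpair.linear_exists_left_inverse_on[OF T subspace_cspace] by metis
  \<comment> \<open>The left inverse G stays fixed and only \<open>X2 z\<close> varies, so every
    entry is linear in the coordinates of z.\<close>
  define f where "f = (\<lambda>i j z. \<Sum>s\<in>I1 \<times> A2. G (unit s) i * X2 z (snd s) (unit j) (fst s))"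
  have f: "f i j \<in> polyfuns pt_coords" for i j
    unfolding f_def by (intro polyfuns_sum polyfuns_cmult polyfuns_X polyfuns.const)
  obtain d where d: "d \<in> polyfuns pt_coords"
    "\<And>z v. (\<And>i. i \<in> I2 \<Longrightarrow> (\<Sum>j\<in>I2. f i j z * v j) = 0) \<Longrightarrow> (\<exists>i\<in>I2. v i \<noteq> 0) \<Longrightarrow> d z = 0"
    "\<And>z. (\<And>i j. i \<in> I2 \<Longrightarrow> j \<in> I2 \<Longrightarrow> f i j z = (if i = j then 1 else 0)) \<Longrightarrow> d z = 1"
    using polyfuns_det[OF finite_I(2), of f pt_coords] f by blast
  have "d z = 0" if z: "z \<in> Zset D m1 m2 m3 n1" for z
  proof -
    obtain u where u: "u \<in> cspace I2" "u \<noteq> 0" "\<And>a. a < a21 D \<Longrightarrow> X2 z a u = 0"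
      using Zset_kernel[OF z m3 w] by blast
    show ?thesis
    proof (rule d(2))
      fix i
      have "(\<Sum>j\<in>I2. f i j z * u j) = (\<Sum>s\<in>I1 \<times> A2. G (unit s) i * (\<Sum>j\<in>I2. u j * X2 z (snd s) (unit j) (fst s)))"
        unfolding f_def sum_distrib_right by (subst sum.swap) (simp add: sum_distrib_left mult_ac)
      also have "\<dots> = (\<Sum>s\<in>I1 \<times> A2. G (unit s) i * X2 z (snd s) u (fst s))"
      proof (intro sum.cong refl arg_cong2[of _ _ _ _ "(*)"])
        fix s :: "ix1 \<times> nat"
        have "u = (\<lambda>k. \<Sum>j\<in>I2. u j * unit j k)"
          by (subst cspace_expand[OF finite_I(2) u(1)]) (simp add: fun_eq_iff sum_fun_apply)
        then have "X2 z (snd s) u = (\<lambda>k. \<Sum>j\<in>I2. u j * X2 z (snd s) (unit j) k)"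
          using clinear_comb[OF clinear_X(1), of z "snd s" u unit I2] by simp
        then show "(\<Sum>j\<in>I2. u j * X2 z (snd s) (unit j) (fst s)) = X2 z (snd s) u (fst s)" by simp
      qed
      also have "\<dots> = 0" using u(3) by (intro sum.neutral) auto
      finally show "(\<Sum>j\<in>I2. f i j z * u j) = 0" .
    next
      show "\<exists>i\<in>I2. u i \<noteq> 0" using u(1,2) by (auto simp: cspace_def fun_eq_iff)
    qed
  qed
  then have "d x = 0" using closure_eq[OF x d(1) polyfuns.const, of 0] by simp
  moreover have "d x = 1"
  proof (rule d(3))
    fix i j assume ij: "i \<in> I2" "j \<in> I2"
    have "T (unit j) \<in> cspace (I1 \<times> A2)"
      using X_in(1)[OF xW] by (auto simp: T_def cspace_def)
    then have "T (unit j) = (\<lambda>k. \<Sum>s\<in>I1 \<times> A2. T (unit j) s * unit s k)"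
      using cspace_expand[of "I1 \<times> A2" "T (unit j)"] finite_I(1) by (simp add: fun_eq_iff sum_fun_apply)
    then have GT: "G (T (unit j)) = (\<lambda>k. \<Sum>s\<in>I1 \<times> A2. T (unit j) s * G (unit s) k)"
      using clinear_comb[OF G(1), of "T (unit j)" unit "I1 \<times> A2"] by simp
    have "unit j i = G (T (unit j)) i" using G(2)[OF unit_in_cspace[OF ij(2)]] by simp
    also have "\<dots> = (\<Sum>s\<in>I1 \<times> A2. T (unit j) s * G (unit s) i)" by (rule fun_cong[OF GT])
    also have "\<dots> = f i j x" unfolding f_def by (intro sum.cong) (auto simp: T_def)
    finally show "f i j x = (if i = j then 1 else 0)" by (auto simp: unit_def)
  qed
  ultimately show False by simp
qed

section \<open>Reconstruction of a point of Z from the relations\<close>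

text \<open>The group element is the identity on \<open>M\<^sub>3\<close> and
  \<open>N\<^sub>1\<close>; prescribed columns of g2 and g1 make the equations for the first two
  components hold, and w is then read off from the third. \<open>pencil_inj\<close> is assumed for
  every iota because the complement in \<open>P\<^sub>2\<close> is chosen only inside the
  proof.\<close>

lemma Zset_memI:
  assumes xW: "x \<in> bigW D m1 m2 m3 n1" and rel: "relations x"
    and X3_inj: "\<And>t. t \<in> cspace (M3 \<times> A32) \<Longrightarrow> blk A32 (X3 x) t = 0 \<Longrightarrow> t = 0"
    and pencil_inj: "\<And>iota t. clinear iota \<Longrightarrow> (\<And>v. iota v \<in> cspace I2) \<Longrightarrow>
      (\<And>t. t \<in> cspace ({..<m2} <+> M3 \<times> A32) \<Longrightarrow> iota (\<lambda>m. t (Inl m)) + blk A32 (X3 x) (\<lambda>s. t (Inr s)) = 0 \<Longrightarrow> t = 0) \<Longrightarrow>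
      t \<in> cspace ({..<m2} \<times> A2 <+> M3 \<times> A3) \<Longrightarrow> blk2 A2 (\<lambda>a v. X2 x a (iota v)) A3 (E x) t = 0 \<Longrightarrow> t = 0"
  shows "x \<in> Zset D m1 m2 m3 n1"
proof -
  let ?S = "{..<m2} \<times> A2 <+> M3 \<times> A3"
  have I1: "I1 = {..<m1} <+> ?S" and I2: "I2 = {..<m2} <+> M3 \<times> A32" by (simp_all add: P1_def P2_def)
  obtain x2 x3 psi where x: "x = (x2, x3, psi)" by (cases x)
  have x3: "x3 \<in> Hom (M3 \<times> A32) ({..<m2} <+> M3 \<times> A32)" using xW by (simp add: x bigW_def I2)
  have app_x3: "app (M3 \<times> A32) x3 t = blk A32 (X3 x) t" for t
    unfolding app_Times X3_def x by simp
  obtain g2 where g2: "g2 \<in> GL I2" "\<And>r s. g2 r (Inr s) = x3 r s"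
    using extend_to_GL[OF _ _ x3] X3_inj app_x3 unfolding I2 by auto
  \<comment> \<open>The restriction of g2 to \<open>M\<^sub>2\<close>; its image is a complement to
    that of \<open>M\<^sub>3 \<otimes> A\<^sub>3\<^sub>2\<close>.\<close>
  define iota where "iota = (\<lambda>v. app I2 g2 (case_sum v (\<lambda>_. 0)))"
  have g2_Hom: "g2 \<in> Hom I2 I2" using g2(1) by (simp add: GL_def)
  have g2_split: "app I2 g2 u = iota (\<lambda>m. u (Inl m)) + blk A32 (X3 x) (\<lambda>s. u (Inr s))" for u
  proof -
    have "app I2 g2 u = app {..<m2} (\<lambda>j i. g2 j (Inl i)) (\<lambda>i. u (Inl i)) + app (M3 \<times> A32) x3 (\<lambda>i. u (Inr i))" for u
      unfolding I2 using g2(2) by (subst app_Plus) auto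
    moreover have "app (M3 \<times> A32) x3 (\<lambda>_. 0) = 0" by (simp add: app_def fun_eq_iff)
    ultimately show ?thesis by (simp add: iota_def app_x3)
  qed
  have iota: "clinear iota" "\<And>v. iota v \<in> cspace I2"
  proof -
    have "clinear (\<lambda>v. case_sum v (\<lambda>_. 0 :: complex))" by (auto simp: clinear_iff fun_eq_iff split: sum.splits)
    then show "clinear iota" unfolding iota_def by (rule clinear_compose[OF clinear_app])
    show "iota v \<in> cspace I2" for v unfolding iota_def by (rule app_in_cspace[OF g2_Hom])
  qed
  have iota_inj: "t = 0" if "t \<in> cspace ({..<m2} <+> M3 \<times> A32)"
    "iota (\<lambda>m. t (Inl m)) + blk A32 (X3 x) (\<lambda>s. t (Inr s)) = 0" for t
  proof -
    obtain k2 where "\<And>v. v \<in> cspace I2 \<Longrightarrow> app I2 k2 (app I2 g2 v) = v"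
      using app_GL_inverse[OF finite_I(2) g2(1)] by metis
    then have "app I2 k2 (app I2 g2 t) = t" using that(1) by (simp add: I2)
    then show ?thesis using that(2) unfolding g2_split by (simp add: app_zero)
  qed
  let ?f = "blk2 A2 (\<lambda>a v. X2 x a (iota v)) A3 (E x)"
  have lini: "clinear (\<lambda>v. X2 x a (iota v))" "clinear (\<lambda>v. Psi2 x k (iota v))" for a k
    using clinear_compose[OF clinear_X(1) iota(1)] clinear_compose[OF clinear_X(5) iota(1)] by auto
  have linf: "clinear ?f" by (rule clinear_blk2[OF lini(1) clinear_X(4)])
  \<comment> \<open>The columns that g1 must have for the equation \<open>e2\<close> to hold:
    \<open>X2\<close> after iota on \<open>M\<^sub>2 \<otimes> A\<^sub>2\<^sub>1\<close>, and
    \<open>E\<close> on \<open>M\<^sub>3 \<otimes> A\<^sub>3\<^sub>1\<close>.\<close>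
  define F where "F = (\<lambda>p s. if s \<in> ?S then ?f (unit s) p else 0)"
  have app_F: "app ?S F t = ?f t" if "t \<in> cspace ?S" for t
  proof -
    have "app ?S F t = app ?S (\<lambda>p s. ?f (unit s) p) t" by (rule app_cong) (simp add: F_def)
    then show ?thesis using app_units[OF linf _ that] by simp
  qed
  have f_in: "?f t \<in> cspace I1" for t
    unfolding blk2_def using X_in[OF xW] E_in[OF xW] by (intro cvec.subspace_add[OF subspace_cspace] blk_in)
  then have F_Hom: "F \<in> Hom ?S ({..<m1} <+> ?S)" unfolding I1 by (auto simp: F_def Hom_def cspace_def)
  obtain g1 where g1: "g1 \<in> GL I1" "\<And>r s. g1 r (Inr s) = F r s"
  proof -
    have "t = 0" if "t \<in> cspace ?S" "app ?S F t = 0" for t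
      using pencil_inj[OF iota iota_inj that(1)] that app_F by simp
    then show thesis using extend_to_GL[OF _ _ F_Hom] that unfolding I1 by auto
  qed
  define G1 where "G1 = (\<lambda>v. app I1 g1 (case_sum v (\<lambda>_. 0)))"
  have G1: "clinear G1"
  proof -
    have "clinear (\<lambda>v. case_sum v (\<lambda>_. 0 :: complex))" by (auto simp: clinear_iff fun_eq_iff split: sum.splits)
    then show ?thesis unfolding G1_def by (rule clinear_compose[OF clinear_app])
  qed
  have g1_split: "app I1 g1 r = G1 (\<lambda>m. r (Inl m)) + ?f (\<lambda>s. r (Inr s))" if "r \<in> cspace I1" for r
  proof -
    have *: "app I1 g1 r = app {..<m1} (\<lambda>j i. g1 j (Inl i)) (\<lambda>i. r (Inl i)) + app ?S F (\<lambda>i. r (Inr i))" for r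
      unfolding I1 using g1(2) by (subst app_Plus) auto
    moreover have "app ?S F (\<lambda>_. 0) = 0" by (simp add: app_def fun_eq_iff)
    moreover have "(\<lambda>s. r (Inr s)) \<in> cspace ?S" using that unfolding I1 cspace_Plus by blast
    ultimately show ?thesis by (simp add: G1_def app_F)
  qed
  \<comment> \<open>The equation \<open>e1\<close> on the three summands of \<open>P\<^sub>1\<close>
    dictates w; on the last two the relations express \<open>Psi\<close> through \<open>Psi2\<close>
    and \<open>Phi3\<close>. The value 0 outside the index sets puts w into
    \<open>smallW\<close>.\<close>
  define w :: wpt where "w =
    ((\<lambda>(n, l) m. if m < m1 \<and> l < h11 D then Psi x l (G1 (unit m)) n else 0),
     (\<lambda>(n, k) m. if m < m2 \<and> k < h12 D then Psi2 x k (iota (unit m)) n else 0),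
     (\<lambda>(n, k) m. if m < m3 \<and> k < h13 D then Phi3 x k (unit m) n else 0))"
  have w: "w \<in> smallW D m1 m2 m3 n1"
    using X_in(3)[OF xW] E_in(2,3)[OF xW] by (auto simp: w_def smallW_def Hom_def cspace_def)
  have phi1: "\<phi>1 w l v = Psi x l (G1 v)" if "l < h11 D" "v \<in> cspace {..<m1}" for l v
  proof -
    have "\<phi>1 w l v = app {..<m1} (\<lambda>n m. Psi x l (G1 (unit m)) n) v"
      unfolding \<phi>1_def by (rule app_cong) (simp add: w_def that)
    then show ?thesis using app_units[OF clinear_compose[OF clinear_X(3) G1] _ that(2)] by simp
  qed
  have phi2: "\<phi>2 w k v = Psi2 x k (iota v)" if "k < h12 D" "v \<in> cspace {..<m2}" for k v
  proof -
    have "\<phi>2 w k v = app {..<m2} (\<lambda>n m. Psi2 x k (iota (unit m)) n) v"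
      unfolding \<phi>2_def by (rule app_cong) (simp add: w_def that)
    then show ?thesis using app_units[OF lini(2) _ that(2)] by simp
  qed
  have phi3: "\<phi>3 w k v = Phi3 x k v" if "k < h13 D" "v \<in> cspace M3" for k v
  proof -
    have "\<phi>3 w k v = app M3 (\<lambda>n m. Phi3 x k (unit m) n) v"
      unfolding \<phi>3_def by (rule app_cong) (simp add: w_def that)
    then show ?thesis using app_units[OF clinear_X(6) _ that(2)] by simp
  qed
  have e2: "X2 x a (app I2 g2 u) = app I1 g1 (Xi2 a u)" if a: "a < a21 D" and u: "u \<in> cspace I2" for a u
  proof -
    have u2: "(\<lambda>s. u (Inr s)) \<in> slices_in A32 (cspace M3)"
      using u unfolding I2 cspace_Plus slices_in_cspace by blast
    have "X2 x a (blk A32 (X3 x) (\<lambda>s. u (Inr s))) = blk A3 (E x) (contract A32 (mulA D a) (\<lambda>s. u (Inr s)))"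
      using rel a u2 clinear_X
      by (intro blk_contract[where U = "cspace M3", symmetric]) (auto simp: mulA_def relations_def)
    moreover have "blk A2 (\<lambda>a v. X2 x a (iota v)) (slot a (\<lambda>m. u (Inl m))) = X2 x a (iota (\<lambda>m. u (Inl m)))"
      using a lini by (intro blk_slot) auto
    moreover have "G1 (\<lambda>_. 0) = 0" using clinearD(3)[OF G1] by (simp add: zero_fun_def)
    ultimately show ?thesis
      unfolding g1_split[OF Xi2_in[OF u a]] g2_split clinearD(1)[OF clinear_X(1)]
      by (simp add: Xi2_def blk2_def)
  qed
  have e3: "X3 x b (app M3 (id_map M3) v) = app I2 g2 (Xi3 b v)" if b: "b < a32 D" and v: "v \<in> cspace M3" for b v
  proof -
    have "iota (\<lambda>_. 0) = 0" using clinearD(3)[OF iota(1)] by (simp add: zero_fun_def)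
    moreover have "blk A32 (X3 x) (slot b v) = X3 x b v" using b clinear_X by (intro blk_slot) auto
    ultimately show ?thesis unfolding g2_split app_id_map[OF finite_lessThan v] by (simp add: Xi3_def)
  qed
  have e1: "Psi x l (app I1 g1 r) = app {..<n1} (id_map {..<n1}) (Gam w l r)" if l: "l < h11 D" and r: "r \<in> cspace I1" for l r
  proof -
    have r': "(\<lambda>m. r (Inl m)) \<in> cspace {..<m1}" "(\<lambda>s. r (Inr s)) \<in> cspace ?S"
      using r unfolding I1 cspace_Plus[of r] by blast+
    have r2: "(\<lambda>s. r (Inr (Inl s))) \<in> slices_in A2 (cspace {..<m2})" "(\<lambda>s. r (Inr (Inr s))) \<in> slices_in A3 (cspace M3)"
      using r'(2) unfolding cspace_Plus[of "\<lambda>s. r (Inr s)"] slices_in_cspace by blast+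
    let ?c2 = "contract A2 (act_21 D l) (\<lambda>s. r (Inr (Inl s)))" and ?c3 = "contract A3 (act_31 D l) (\<lambda>s. r (Inr (Inr s)))"
    have c2: "?c2 \<in> slices_in H2 (cspace {..<m2})" and c3: "?c3 \<in> slices_in H3 (cspace M3)"
      using D_Hom(2,3) by (intro contract_in[OF subspace_cspace r2(1)] contract_in[OF subspace_cspace r2(2)]; auto simp: Hom_def)+
    have "Psi x l (?f (\<lambda>s. r (Inr s))) = blk2 H2 (\<lambda>k v. Psi2 x k (iota v)) H3 (Phi3 x) (case_sum ?c2 ?c3)"
      using rel iota(2) l r'(2) lini clinear_X
      by (intro blk2_delta1[where k = m2 and ?m3.0 = m3 and t = "\<lambda>s. r (Inr s)", symmetric]) (auto simp: relations_def)
    also have "\<dots> = blk2 H2 (\<phi>2 w) H3 (\<phi>3 w) (case_sum ?c2 ?c3)"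
      unfolding blk2_def blk_def sum.case
      using slices_inD[OF c2] slices_inD[OF c3] by (intro arg_cong2[of _ _ _ _ "(+)"] sum.cong) (simp_all add: phi2 phi3)
    finally have "Psi x l (app I1 g1 r) = Gam w l r"
      unfolding g1_split[OF r] clinearD(1)[OF clinear_X(3)] Gam_def by (simp add: phi1[OF l r'(1)])
    moreover have "Psi x l (app I1 g1 r) \<in> cspace {..<n1}" by (rule X_in(3)[OF xW])
    ultimately show ?thesis by (simp add: app_id_map)
  qed
  show ?thesis
    unfolding Zset_iff
  proof (intro conjI bexI)
    show "transports x (g1, g2, id_map M3, id_map {..<n1}) w" using e1 e2 e3 by (simp add: transports_def)
    show "(g1, g2, id_map M3, id_map {..<n1}) \<in> bigG D m1 m2 m3 n1"
      using g1(1) g2(1) by (simp add: bigG_def id_map_GL)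
  qed (use xW w in auto)
qed

section \<open>Semi-stability and the conclusion\<close>

lemma card_I: "card I1 = m1 + m2 * a21 D + m3 * a31 D" "card I2 = m2 + m3 * a32 D"
  by (simp_all add: P1_def P2_def card_Plus)

text \<open>The definition of semi-stability leaves out the full family, but there the two totals
  make the left side 1 - 1 = 0. Invariance of tensor spaces is replaced by invariance under every
  map of the family.\<close>

lemma semistable_ineq:
  assumes x: "x \<in> semistable D m1 m2 m3 n1 \<alpha>1 \<alpha>2 \<alpha>3 \<mu>"
    and total: "\<alpha>1 * real (card I1) + \<alpha>2 * real (card I2) + \<alpha>3 * real m3 = 1" "\<mu> * real n1 = 1"
    and U: "subspace_of U1 (cspace I1)" "subspace_of U2 (cspace I2)"
      "subspace_of U3 (cspace M3)" "subspace_of Q (cspace {..<n1})"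
    and nz: "cvec.dim U1 > 0 \<or> cvec.dim U2 > 0 \<or> cvec.dim U3 > 0"
    and closed: "\<And>a. a < a21 D \<Longrightarrow> X2 x a ` U2 \<subseteq> U1" "\<And>b. b < a32 D \<Longrightarrow> X3 x b ` U3 \<subseteq> U2"
      "\<And>l. l < h11 D \<Longrightarrow> Psi x l ` U1 \<subseteq> Q"
  shows "\<alpha>1 * real (cvec.dim U1) + \<alpha>2 * real (cvec.dim U2) + \<alpha>3 * real (cvec.dim U3)
    - \<mu> * real (cvec.dim Q) \<le> 0"
proof (cases "U1 = cspace I1 \<and> U2 = cspace I2 \<and> U3 = cspace M3 \<and> Q = cspace {..<n1}")
  case True
  then show ?thesis using total by (simp add: dim_cspace finite_I)
next
  case False
  obtain x2 x3 psi where xe: "x = (x2, x3, psi)" by (cases x)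
  have closed': "app (I \<times> A) y ` tensor_space V (cspace A) \<subseteq> V'"
    if V: "finite A" "cvec.subspace V" "cvec.subspace V'" "\<And>a. a \<in> A \<Longrightarrow> app I (sl y a) ` V \<subseteq> V'"
    for I :: "'i set" and A :: "nat set" and y :: "'j \<Rightarrow> 'i \<times> nat \<Rightarrow> complex" and V V'
  proof
    fix v assume "v \<in> app (I \<times> A) y ` tensor_space V (cspace A)"
    then obtain t where t: "t \<in> slices_in A V" "v = blk A (\<lambda>a. app I (sl y a)) t"
      unfolding tensor_space_eq_slices_in[OF V(2,1)] app_Times by blast
    show "v \<in> V'"
      unfolding t(2) using slices_inD[OF t(1)] V(4) by (intro blk_closed[OF V(3)]) blast
  qed
  have sub: "cvec.subspace U1" "cvec.subspace U2" "cvec.subspace U3" "cvec.subspace Q"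
    using U by (auto simp: subspace_of_def)
  have "app (I2 \<times> A2) x2 ` tensor_space U2 (cspace A2) \<subseteq> U1"
    using closed(1) by (intro closed' sub) (auto simp: X2_def xe)
  moreover have "app (M3 \<times> A32) x3 ` tensor_space U3 (cspace A32) \<subseteq> U2"
    using closed(2) by (intro closed' sub) (auto simp: X3_def xe)
  moreover have "app (I1 \<times> H1) psi ` tensor_space U1 (cspace H1) \<subseteq> Q"
    using closed(3) by (intro closed' sub) (auto simp: Psi_def xe)
  moreover have "\<not> (U1 = {0} \<and> U2 = {0} \<and> U3 = {0} \<and> Q = {0})"
    using nz by (auto simp: cvec.dim_zero_space)
  ultimately show ?thesis
    using x U False unfolding semistable_def xe mem_Collect_eq prod.case by blast
qed

end

theorem proposition8p2p1:
  fixes D :: comp_data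
    and m1 m2 m3 n1 :: nat
    and lambda1 lambda2 lambda3 mu1 alpha1 alpha2 alpha3 :: real
  assumes "composition_system D"
    and "lambda1 \<in> \<rat>" "lambda2 \<in> \<rat>" "lambda3 \<in> \<rat>" "mu1 \<in> \<rat>"
    and "lambda1 * real m1 + lambda2 * real m2 + lambda3 * real m3 = 1"
    and "mu1 * real n1 = 1"
    and "lambda1 = alpha1"
    and "lambda2 = real (a21 D) * alpha1 + alpha2"
    and "lambda3 = real (a31 D) * alpha1 + real (a32 D) * alpha2 + alpha3"
    and "alpha1 > 0" "alpha2 > 0" "alpha3 > 0"
    and "alpha2 * c3 D m3 + lambda1 * c3' D m3 \<ge> mu1 * c3 D m3 * c3' D m3
       \<or> lambda3 \<ge> mu1 * c3' D m3 * real (a32 D) + real (a31 D) * lambda1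
       \<or> lambda3 \<ge> mu1 * c3 D m3 * real (a31 D) + real (a32 D) * alpha2
       \<or> lambda3 \<ge> mu1 * c3 D m3 * real (a32 D) * real (a21 D)"
    and "lambda2 \<ge> real (a21 D) * mu1 * c1 D m2 m3"
    and "lambda3 \<ge> real (a31 D) * mu1 * c1 D m2 m3"
  shows "(zariski_closure pt_coords (bigW D m1 m2 m3 n1) (Zset D m1 m2 m3 n1)
            - Zset D m1 m2 m3 n1)
         \<inter> semistable D m1 m2 m3 n1 alpha1 alpha2 alpha3 mu1 = {}"
proof -
  interpret setting D m1 m2 m3 n1 by unfold_locales (rule assms(1))
  have "x \<in> Zset D m1 m2 m3 n1"
    if x: "x \<in> Zbar" and ss: "x \<in> semistable D m1 m2 m3 n1 alpha1 alpha2 alpha3 mu1" for x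
  proof -
    have xW: "x \<in> bigW D m1 m2 m3 n1" using x by (simp add: zariski_closure_def)
    have rel: "relations x" by (rule closure_relations[OF x])
    \<comment> \<open>Collecting the coefficients of m1, m2 and m3 gives lambda1, lambda2 and
      lambda3.\<close>
    have total: "alpha1 * real (card I1) + alpha2 * real (card I2) + alpha3 * real m3 = 1"
      using assms(6,8-10) by (simp add: card_I algebra_simps)
    note ineq = semistable_ineq[OF ss total assms(7)]
    have mu: "mu1 > 0"
    proof (rule ccontr)
      assume "\<not> mu1 > 0"
      then have "mu1 * real n1 \<le> 0" by (simp add: mult_nonpos_nonneg)
      then show False using assms(7) by simp
    qed
    have sub0: "subspace_of {0} (cspace I)" "subspace_of (cspace I) (cspace I)" for I :: "'i set"
      using cvec.subspace_0[OF subspace_cspace] by (auto simp: subspace_of_def subspace_cspace cvec.subspace_single_0)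
    \<comment> \<open>If \<open>H\<^sub>1\<^sub>1 = 0\<close>, the full spaces
      \<open>P\<^sub>i\<close> together with 0 in \<open>N\<^sub>1\<close> are an invariant family
      on which the linear form has the value 1.\<close>
    have h11: "h11 D > 0"
    proof (rule ccontr)
      assume "\<not> h11 D > 0"
      have "alpha1 * real (cvec.dim (cspace I1)) + alpha2 * real (cvec.dim (cspace I2))
          + alpha3 * real (cvec.dim (cspace M3)) - mu1 * real (cvec.dim {0 :: nat \<Rightarrow> complex}) \<le> 0"
      proof (rule ineq)
        show "0 < cvec.dim (cspace I1) \<or> 0 < cvec.dim (cspace I2) \<or> 0 < cvec.dim (cspace M3)"
        proof (rule ccontr)
          assume "\<not> ?thesis"
          then have "cvec.dim (cspace I1) = 0" "cvec.dim (cspace I2) = 0" "cvec.dim (cspace M3) = 0" by simp_all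
          then have "card I1 = 0" "card I2 = 0" "m3 = 0"
            unfolding dim_cspace[OF finite_I(1)] dim_cspace[OF finite_I(2)] dim_cspace[OF finite_lessThan] card_lessThan .
          then show False using total by simp
        qed
        show "X2 x a ` cspace I2 \<subseteq> cspace I1" "X3 x b ` cspace M3 \<subseteq> cspace I2" for a b
          using X_in[OF xW] by auto
        show "Psi x l ` cspace I1 \<subseteq> {0}" if "l < h11 D" for l using that \<open>\<not> h11 D > 0\<close> by simp
      qed (rule sub0)+
      then show False using total by (simp add: dim_cspace finite_I cvec.dim_zero_space)
    qed
    \<comment> \<open>\<open>H\<^sub>1\<^sub>1\<close>, and then \<open>A\<^sub>3\<^sub>1\<close>,
      are nonzero images of tensor products, whose factors are therefore nonzero.\<close>
    have A_pos: "a21 D > 0" "a31 D > 0" "a32 D > 0"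
    proof -
      show "a21 D > 0" using surj_map_domain_nonempty[OF D_surj(3)] h11 by (auto simp: lessThan_empty_iff)
      show "a31 D > 0" using surj_map_domain_nonempty[OF D_surj(2)] h11 by (auto simp: lessThan_empty_iff)
      then show "a32 D > 0" using surj_map_domain_nonempty[OF D_surj(1)] by (auto simp: lessThan_empty_iff)
    qed
    have lp: "limit_point D m3 n1 I1 I2 (X2 x) (X3 x) (Psi x) (E x) (Psi2 x) (Phi3 x) alpha1 alpha2 alpha3 mu1"
    proof (rule limit_point.intro)
      show "X2 x a (X3 x b v) = (\<lambda>i. \<Sum>c<a31 D. comp_A D c (b, a) * E x c v i)"
        if "a < a21 D" "b < a32 D" "v \<in> cspace M3" for a b v
        using rel that unfolding relations_def by blast
      show "Psi x l (X2 x a v) = (\<lambda>n. \<Sum>k<h12 D. act_21 D l (k, a) * Psi2 x k v n)"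
        if "a < a21 D" "l < h11 D" "v \<in> cspace I2" for a l v
        using rel that unfolding relations_def by blast
      show "Psi x l (E x c v) = (\<lambda>n. \<Sum>k<h13 D. act_31 D l (k, c) * Phi3 x k v n)"
        if "c < a31 D" "l < h11 D" "v \<in> cspace M3" for c l v
        using rel that unfolding relations_def by blast
      show "Psi2 x j (X3 x b v) = (\<lambda>n. \<Sum>k<h13 D. act_32 D j (k, b) * Phi3 x k v n)"
        if "b < a32 D" "j < h12 D" "v \<in> cspace M3" for b j v
        using relations_D[OF rel that xW] .
      show "alpha1 * real (cvec.dim U1) + alpha2 * real (cvec.dim U2) + alpha3 * real (cvec.dim U3)
          - mu1 * real (cvec.dim Q) \<le> 0"
        if U: "subspace_of U1 (cspace I1)" "subspace_of U2 (cspace I2)" "subspace_of U3 (cspace M3)"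
          "subspace_of Q (cspace {..<n1})" "0 < cvec.dim U2 \<or> 0 < cvec.dim U3"
          "\<And>a. a < a21 D \<Longrightarrow> X2 x a ` U2 \<subseteq> U1" "\<And>b. b < a32 D \<Longrightarrow> X3 x b ` U3 \<subseteq> U2"
          "\<And>l. l < h11 D \<Longrightarrow> Psi x l ` U1 \<subseteq> Q" for U1 U2 U3 Q
        using ineq[OF U(1-4) disjI2[OF U(5)] U(6-8)] .
    qed (rule assms(1,11-13) mu finite_I clinear_X X_in[OF xW] E_in[OF xW] A_pos)+
    \<comment> \<open>For \<open>m3 = 0\<close> the domain is 0; otherwise
      \<open>closure_kernel\<close> excludes degenerate elements of
      \<open>A\<^sub>3\<^sub>2\<close>.\<close>
    have X3_inj: "t = 0" if t: "t \<in> cspace (M3 \<times> A32)" "blk A32 (X3 x) t = 0" for t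
    proof (cases "m3 = 0")
      case True
      then show ?thesis using t(1) by (auto simp: cspace_def fun_eq_iff)
    next
      case False
      show ?thesis
      proof (rule limit_point.X3_injective[OF lp _ assms(10) _ t])
        fix w assume w: "w \<in> cspace A32"
          "\<And>a c. a < a21 D \<Longrightarrow> c < a31 D \<Longrightarrow> (\<Sum>b<a32 D. comp_A D c (b, a) * w b) = 0"
        show "w = 0"
        proof (rule ccontr)
          assume "w \<noteq> 0"
          have "\<exists>u\<in>cspace I2. u \<noteq> 0 \<and> (\<forall>a<a21 D. X2 x a u = 0)"
            by (rule closure_kernel[OF x _ w(1) \<open>w \<noteq> 0\<close>]) (use False w(2) in auto)
          then obtain u where u: "u \<in> cspace I2" "u \<noteq> 0" "\<And>a. a < a21 D \<Longrightarrow> X2 x a u = 0"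
            by blast
          \<comment> \<open>The line through u, with 0 in the other three spaces, is invariant, and
            the linear form has the value \<open>alpha2 > 0\<close> on it.\<close>
          let ?U = "cvec.span {u}"
          have dim: "cvec.dim ?U = 1"
            using cvec.dim_span_eq_card_independent[of "{u}"] u(2) by simp
          have "alpha1 * real (cvec.dim {0 :: ix1 \<Rightarrow> complex}) + alpha2 * real (cvec.dim ?U)
              + alpha3 * real (cvec.dim {0 :: nat \<Rightarrow> complex}) - mu1 * real (cvec.dim {0 :: nat \<Rightarrow> complex}) \<le> 0"
          proof (rule ineq)
            show "subspace_of ?U (cspace I2)"
              using cvec.span_minimal[OF _ subspace_cspace, of "{u}" I2] u(1)
              by (simp add: subspace_of_def cvec.subspace_span)
            show "X2 x a ` ?U \<subseteq> {0}" if "a < a21 D" for a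
            proof clarify
              fix v assume v: "v \<in> ?U"
              show "X2 x a v = 0"
                by (rule cpair.linear_eq_0_on_span[OF clinear_X(1) _ v]) (use u(3)[OF that] in auto)
            qed
            show "X3 x b ` {0} \<subseteq> ?U" for b by (simp add: clinearD(3)[OF clinear_X(2)] cvec.span_zero)
            show "Psi x l ` {0} \<subseteq> {0}" for l by (simp add: clinearD(3)[OF clinear_X(3)])
            show "0 < cvec.dim {0 :: ix1 \<Rightarrow> complex} \<or> 0 < cvec.dim ?U \<or> 0 < cvec.dim {0 :: nat \<Rightarrow> complex}"
              using dim by simp
          qed (rule sub0)+
          then show False using dim assms(12) by (simp add: cvec.dim_zero_space)
        qed
      qed (use assms(8,14) in auto)
    qed
    show ?thesis
    proof (rule Zset_memI[OF xW rel X3_inj])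
      fix iota :: "(nat \<Rightarrow> complex) \<Rightarrow> ix2 \<Rightarrow> complex" and t
      assume *: "clinear iota" "\<And>v. iota v \<in> cspace I2"
        "\<And>t. t \<in> cspace ({..<m2} <+> M3 \<times> A32) \<Longrightarrow> iota (\<lambda>m. t (Inl m)) + blk A32 (X3 x) (\<lambda>x. t (Inr x)) = 0 \<Longrightarrow> t = 0"
        "t \<in> cspace ({..<m2} \<times> A2 <+> M3 \<times> A3)" "blk2 A2 (\<lambda>a v. X2 x a (iota v)) A3 (E x) t = 0"
      show "t = 0"
      proof (rule limit_point.pencil_injective[OF lp *(1,2) _ _ _ *(4,5)])
        show "s = 0" if "s \<in> cspace ({..<m2} <+> M3 \<times> A32)"
          "iota (\<lambda>m. s (Inl m)) + blk A32 (X3 x) (\<lambda>x. s (Inr x)) = 0" for s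
          using *(3)[OF that] .
      qed (use assms(9,10,15,16) in simp_all)
    qed
  qed
  then show ?thesis by blast
qed

end
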